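(* There are absolute constants $c,C>0$ such that for every $2<p\le\infty$ and every integer $r\ge2$, with $D=2^{128r}$ and $Y_{p,r}=\ell_p^r(\ell_2^D)$, \[ c\,r^{1/2-1/p}\ \le\ \mathfrak C_{Y_{p,r}}\ \le\ C\,r^{1/2-1/p}. \]
   Context: All Banach spaces are real, and $1/\infty=0$. The space $\ell_p^r(\ell_2^D)$ consists of $x=(x^{(1)},\dots,x^{(r)})$ with $x^{(i)}\in\mathbb R^D$, with norm $\|x\|=\left(\sum_{i=1}^r\|x^{(i)}\|_2^p\right)^{1/p}$ for $p<\infty$ and $\|x\|=\max_i\|x^{(i)}\|_2$ for $p=\infty$, where $\|\cdot\|_2$ is the Euclidean norm. An admissible sequence on a metric space $(K,d)$ is a refining sequence of partitions $(\mathcal A_n)_{n\ge0}$ of $K$ (each $\mathcal A_{n+1}$ refines $\mathcal A_n$) such that $|\mathcal A_0|=1$ and $|\mathcal A_n|\le2^{2^n}$ for $n\ge1$. For $x\in K$, $\mathcal A_n(x)$ is the element of $\mathcal A_n$ containing $x$. Define \[ \gamma_2(K,d)=\inf_{(\mathcal A_n)}\sup_{x\in K}\sum_{n\ge0}2^{n/2}\operatorname{diam}\bigl(\mathcal A_n(x)\bigr), \] the infimum being over all admissible sequences. For a subset $K$ of a Banach space $X$, $\gamma_2(K;X)$ is $\gamma_2(K,d)$ with $d$ the metric induced by the norm of $X$. $\operatorname{conv}T$ is the convex hull of $T$. The convexification profile of a Banach space $X$ is, for integers $N\ge2$, \[ \mathfrak C_X(N)=\sup_{\substack{T\subset X\text{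 finite}\\ 2\le|T|\le N}}\frac{\gamma_2(\operatorname{conv}T;X)}{\gamma_2(T;X)},\qquad \mathfrak C_X=\sup_{N\ge2}\mathfrak C_X(N). \] The denominator is positive since $\gamma_2(T)\ge\operatorname{diam}(T)$ when $|T|\ge2$. Known result (Talagrand): there is a universal constant $L$ such that $\gamma_2(\operatorname{conv}T;H)\le L\,\gamma_2(T;H)$ for every finite subset $T$ of a Hilbert space $H$. *)

theory Defs
  imports
    "HOL-Analysis.Analysis"
    "HOL-Library.Function_Algebras"
    "HOL-Library.Disjoint_Sets"
begin

(* Pointwise scalar multiplication on functions, so that the library's convex hull applies to
   spaces of functions.  The dimension D depends on r, so the spaces below cannot be types. *)

instantiation "fun" :: (type, real_vector) real_vector
begin

definition scaleR_fun :: "real \<Rightarrow> ('a \<Rightarrow> 'b) \<Rightarrow> 'a \<Rightarrow> 'b"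
  where "scaleR_fun a f = (\<lambda>x. a *\<^sub>R f x)"

instance
  by standard (simp_all add: scaleR_fun_def plus_fun_def algebra_simps)

end

definition admissible :: "'a set \<Rightarrow> (nat \<Rightarrow> 'a set set) \<Rightarrow> bool"
  where "admissible K A \<longleftrightarrow>
    (\<forall>n. partition_on K (A n)) \<and>
    (\<forall>n. refines K (A (Suc n)) (A n)) \<and>
    card (A 0) = 1 \<and>
    (\<forall>n\<ge>1. finite (A n) \<and> card (A n) \<le> 2 ^ (2 ^ n))"

definition cell :: "'a set set \<Rightarrow> 'a \<Rightarrow> 'a set"
  where "cell P x = (THE B. B \<in> P \<and> x \<in> B)"

definition ediam :: "('a \<Rightarrow> 'a \<Rightarrow> real) \<Rightarrow> 'a set \<Rightarrow> ennreal"
  where "ediam d B = (SUP x\<in>B. SUP y\<in>B. ennreal (d x y))"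

definition gamma2 :: "'a set \<Rightarrow> ('a \<Rightarrow> 'a \<Rightarrow> real) \<Rightarrow> ennreal"
  where "gamma2 K d =
    (INF A\<in>{A. admissible K A}. SUP x\<in>K. \<Sum>n. ennreal (2 powr (real n / 2)) * ediam d (cell (A n) x))"

(* A normed space is given by a linear subspace V of an ambient real vector space together with
   a function nrm that is a norm on V.  For finite T with at least two points the denominator
   below is positive and finite, so the conventions for division in ennreal play no role. *)

definition gamma2_norm :: "('a::real_vector \<Rightarrow> real) \<Rightarrow> 'a set \<Rightarrow> ennreal"
  where "gamma2_norm nrm K = gamma2 K (\<lambda>x y. nrm (x - y))"

definition convexification_profile_at :: "'a::real_vector set \<Rightarrow> ('a \<Rightarrow> real) \<Rightarrow> nat \<Rightarrow> ennreal"
  where "convexification_profile_at V nrm N =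
    (SUP T\<in>{T. T \<subseteq> V \<and> finite T \<and> 2 \<le> card T \<and> card T \<le> N}.
       gamma2_norm nrm (convex hull T) / gamma2_norm nrm T)"

definition convexification_profile :: "'a::real_vector set \<Rightarrow> ('a \<Rightarrow> real) \<Rightarrow> ennreal"
  where "convexification_profile V nrm = (SUP N\<in>{2..}. convexification_profile_at V nrm N)"

(* The vector (x^(1), ..., x^(r)) of elements of R^D is encoded with indices starting at 0 and
   with value 0 outside the index range. *)

definition lpl2_space :: "nat \<Rightarrow> nat \<Rightarrow> (nat \<Rightarrow> nat \<Rightarrow> real) set"
  where "lpl2_space r D = {x. \<forall>i j. \<not> (i < r \<and> j < D) \<longrightarrow> x i j = 0}"

definition lpl2_norm :: "ereal \<Rightarrow> nat \<Rightarrow> nat \<Rightarrow> (nat \<Rightarrow> nat \<Rightarrow> real) \<Rightarrow> real"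
  where "lpl2_norm p r D x =
    (if p = \<infinity> then Max ((\<lambda>i. L2_set (x i) {..<D}) ` {..<r})
     else (\<Sum>i<r. L2_set (x i) {..<D} powr real_of_ereal p) powr (1 / real_of_ereal p))"

lemma subspace_lpl2_space: "subspace (lpl2_space r D)"
  by (auto simp: subspace_def lpl2_space_def scaleR_fun_def)

end

theory Submission
  imports Defs "HOL-Real_Asymp.Real_Asymp"
begin

text \<open>Upper bound: the norm of \<open>\<ell>_p^r(\<ell>_2^D)\<close> and the Euclidean norm differ by at most the factor
  \<open>r powr (1/2 - 1/p)\<close>, so it suffices that \<open>\<gamma>\<^sub>2(conv T) \<le> L \<gamma>\<^sub>2(T)\<close> in Euclidean space. As in the
  majorizing measure theorem this goes through the width \<open>E max\<^bsub>t \<in> T\<^esub> \<langle>t, G\<rangle>\<close>, which does not change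
  under convex hulls, is bounded by \<open>\<gamma>\<^sub>2(T)\<close> by chaining, and dominates \<open>\<gamma>\<^sub>2(conv T)\<close> by a greedy
  partition scheme. Instead of a Gaussian vector \<open>G\<close> we use normalized sums of \<open>n\<close> Rademacher
  vectors with \<open>n \<rightarrow> \<infinity>\<close>. The growth condition of the partition scheme then follows from the
  Sudakov--Fernique inequality, which Lindeberg replacement gives up to \<open>o(1)\<close>: compare the process on
  \<open>2^k\<close> separated clusters with independent copies on each cluster plus the process on the
  vertices of the cube \<open>{-1,1}^k\<close>.

  Lower bound: \<open>T\<close> is the set of all \<open>(e\<^bsub>h(0)\<^esub>, \<dots>, e\<^bsub>h(r-1)\<^esub>)\<close>, of cardinality \<open>D^r\<close>. Its convex hull
  contains the points whose block \<open>i\<close> is an average of \<open>2^i\<close> basis vectors. Counting shows that for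
  a typical such point the cell at level \<open>i + q\<close>, \<open>2^q \<approx> 31 r\<close>, still contains points whose
  blocks \<open>i\<close> are at distance of order \<open>2^(-i/2)\<close>. So all \<open>r\<close> scales contribute, in different
  blocks, to the same chaining sum.\<close>

section \<open>Rademacher averages and the Sudakov--Fernique comparison\<close>

text \<open>For fixed \<open>n\<close> every expectation is a finite average, so no Gaussian measure
  has to be constructed. The price: the comparison of maxima holds only for large \<open>n\<close>
  and up to an additive error, and convergence of the widths in \<open>n\<close> is not established.
  The functional on subsets of conv T is therefore a supremum of eventual lower bounds for widths of
  finite subsets (\<open>wsup\<close>), in which the error disappears again. The exponent in the
  lower bound comes from a count. Since log_2 |T| = 128 r^2 and diam T is at most 2 r^(1/p),
  gamma2(T) is at most of order r^(1 + 1/p). On the hull each of the r scales contributes about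
  2^((i+q)/2) 2^(-i/2), of order sqrt r, and together they give r^(3/2). The dimension 2^(128 r)
  splits as 2^r sub-blocks of length 2^(127 r): room for 2^i averaged directions in every block, and
  an alphabet so large that a typical cell at the level charged to scale i still contains words that
  are far apart in block i.\<close>

text \<open>\<open>rade vs \<phi> y\<close> is the expectation of \<open>\<phi> (y + \<Sum>\<^sub>i \<epsilon>\<^sub>i v\<^sub>i)\<close> for independent random signs \<open>\<epsilon>\<^sub>i\<close>, and
  \<open>reach vs y\<close> is the support of that random vector.\<close>

primrec rade :: "'v::real_vector list \<Rightarrow> ('v \<Rightarrow> real) \<Rightarrow> 'v \<Rightarrow> real" where
  "rade [] \<phi> y = \<phi> y"
| "rade (v # vs) \<phi> y = (rade vs \<phi> (y + v) + rade vs \<phi> (y - v)) / 2"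

primrec reach :: "'v::real_vector list \<Rightarrow> 'v \<Rightarrow> 'v set" where
  "reach [] y = {y}"
| "reach (v # vs) y = reach vs (y + v) \<union> reach vs (y - v)"

text \<open>Pointwise bounds are later available only for special states: linear functionals in the
  chaining, small increments in the Taylor expansion. Hence the hypothesis is limited to
  \<open>reach\<close>.\<close>

lemma rade_mono_on:
  "(\<And>u. u \<in> reach vs y \<Longrightarrow> \<phi> u \<le> \<psi> u) \<Longrightarrow> rade vs \<phi> y \<le> rade vs \<psi> y"
proof (induction vs arbitrary: y)
  case (Cons v vs)
  have "rade vs \<phi> (y + v) \<le> rade vs \<psi> (y + v)" "rade vs \<phi> (y - v) \<le> rade vs \<psi> (y - v)"
    using Cons.prems by (auto intro!: Cons.IH)
  then show ?case by simp
qed simp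

lemma rade_mono: "(\<And>u. \<phi> u \<le> \<psi> u) \<Longrightarrow> rade vs \<phi> y \<le> rade vs \<psi> y"
  by (rule rade_mono_on)

lemma reach_induct:
  assumes "u \<in> reach vs y" "P y" "\<And>u v. P u \<Longrightarrow> v \<in> set vs \<Longrightarrow> P (u + v) \<and> P (u - v)"
  shows "P u"
  using assms
proof (induction vs arbitrary: y)
  case (Cons v vs)
  from Cons.prems(2,3) have *: "P (y + v)" "P (y - v)" by auto
  from Cons.prems(1) consider "u \<in> reach vs (y + v)" | "u \<in> reach vs (y - v)" by auto
  then show ?case
    by cases (use Cons.IH * Cons.prems(3) in \<open>auto\<close>)
qed auto

lemma rade_const [simp]: "rade vs (\<lambda>_. c) y = c"
  by (induction vs arbitrary: y) auto

lemma rade_add: "rade vs (\<lambda>u. \<phi> u + \<psi> u) y = rade vs \<phi> y + rade vs \<psi> y"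
  by (induction vs arbitrary: y) (auto simp: field_simps)

lemma rade_cmult: "rade vs (\<lambda>u. c * \<phi> u) y = c * rade vs \<phi> y"
  by (induction vs arbitrary: y) (auto simp: field_simps)

lemma rade_diff: "rade vs (\<lambda>u. \<phi> u - \<psi> u) y = rade vs \<phi> y - rade vs \<psi> y"
  using rade_add[of vs \<phi> "\<lambda>u. - 1 * \<psi> u" y] by (simp only: rade_cmult) simp

lemma rade_sum: "rade vs (\<lambda>u. \<Sum>i\<in>I. \<phi> i u) y = (\<Sum>i\<in>I. rade vs (\<phi> i) y)"
  by (induction I rule: infinite_finite_induct) (auto simp: rade_add)

lemma rade_append: "rade (us @ vs) \<phi> y = rade us (rade vs \<phi>) y"
  by (induction us arbitrary: y) auto

lemma rade_shift: "rade vs \<phi> (y + z) = rade vs (\<lambda>u. \<phi> (u + z)) y"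
proof (induction vs arbitrary: y)
  case (Cons v vs)
  have *: "y + z + v = y + v + z" "y + z - v = y - v + z" by (simp_all add: algebra_simps)
  show ?case unfolding rade.simps * Cons ..
qed simp

lemma rade_commute: "rade us (rade vs \<phi>) y = rade vs (rade us \<phi>) y"
proof (induction us arbitrary: y)
  case Nil
  show ?case by (simp cong: if_cong)
next
  case (Cons u us)
  have "rade vs (rade (u # us) \<phi>) y = rade vs (\<lambda>z. (1/2) * (rade us \<phi> (z + u) + rade us \<phi> (z + - u))) y"
    by (intro arg_cong[where f = "\<lambda>\<phi>. rade vs \<phi> y"] ext) (simp add: field_simps)
  also have "\<dots> = (rade vs (rade us \<phi>) (y + u) + rade vs (rade us \<phi>) (y + - u)) / 2"
    unfolding rade_cmult rade_add rade_shift by simp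
  also have "\<dots> = rade (u # us) (rade vs \<phi>) y" by (simp add: Cons)
  finally show ?case ..
qed

lemma rade_map:
  assumes "linear f"
  shows "rade (map f vs) \<phi> (f y) = rade vs (\<lambda>u. \<phi> (f u)) y"
  by (induction vs arbitrary: y) (simp_all add: linear_add[OF assms, symmetric] linear_diff[OF assms, symmetric])

text \<open>The scaling keeps the covariance independent of \<open>n\<close>
  (\<open>sum_list_noise\<close>), while a single block of steps has size of order n^(-1/2).
  Third-order errors of n blocks then add up to order n^(-1/2).\<close>

definition noise :: "nat \<Rightarrow> 'v::real_vector list \<Rightarrow> 'v list" where
  "noise n vs = concat (replicate n (map (\<lambda>v. (1 / sqrt (real n)) *\<^sub>R v) vs))"

lemma map_noise: "linear f \<Longrightarrow> map f (noise n vs) = noise n (map f vs)"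
  by (simp add: noise_def map_concat o_def linear_cmul)

text \<open>Interleaved blocks can be sorted because the order of the signs is irrelevant
  (\<open>rade_commute\<close>). So the noise of a concatenated list is a pair of independent noises
  that can be averaged one after the other.\<close>

lemma rade_replicate_append:
  "rade (concat (replicate n (us @ vs))) \<phi> y
    = rade (concat (replicate n us)) (rade (concat (replicate n vs)) \<phi>) y"
proof (induction n arbitrary: y)
  case (Suc n)
  let ?U = "concat (replicate n us)" and ?V = "concat (replicate n vs)"
  have "rade (concat (replicate (Suc n) (us @ vs))) \<phi> y = rade us (rade vs (rade ?U (rade ?V \<phi>))) y"
  proof -
    have "rade (concat (replicate n (us @ vs))) \<phi> = rade ?U (rade ?V \<phi>)" by (rule ext) (rule Suc)
    moreover have "rade (us @ vs @ L) \<phi> y = rade us (rade vs (rade L \<phi>)) y" for L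
      by (simp add: rade_append ext[of "rade (vs @ L) \<phi>"])
    ultimately show ?thesis by simp
  qed
  also have "rade vs (rade ?U (rade ?V \<phi>)) = rade ?U (rade vs (rade ?V \<phi>))"
    by (rule ext) (rule rade_commute)
  also have "rade vs (rade ?V \<phi>) = rade (vs @ ?V) \<phi>"
    by (rule ext) (simp add: rade_append)
  finally show ?case by (simp add: rade_append)
qed simp

lemma rade_noise_append: "rade (noise n (us @ vs)) \<phi> y = rade (noise n us) (rade (noise n vs) \<phi>) y"
  by (simp add: noise_def rade_replicate_append)

lemma sum_list_noise:
  fixes \<l> :: "'v::real_vector \<Rightarrow> real"
  assumes "linear \<l>" "n > 0"
  shows "(\<Sum>v\<leftarrow>noise n vs. (\<l> v)\<^sup>2) = (\<Sum>v\<leftarrow>vs. (\<l> v)\<^sup>2)"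
proof -
  have *: "(\<Sum>v\<leftarrow>concat (replicate m L). g v) = real m * (\<Sum>v\<leftarrow>L. g v)" for m g and L :: "'v list"
    by (induction m) (auto simp: algebra_simps)
  have "(\<Sum>v\<leftarrow>vs. (\<l> ((1 / sqrt (real n)) *\<^sub>R v))\<^sup>2) = (1 / n) * (\<Sum>v\<leftarrow>vs. (\<l> v)\<^sup>2)"
    using assms
    by (simp add: linear_cmul power_mult_distrib power_divide sum_list_const_mult[symmetric] cong: map_cong)
  with assms show ?thesis unfolding noise_def * by (simp add: o_def)
qed

section \<open>Moments of Rademacher sums\<close>

lemma rade_linear: "linear \<l> \<Longrightarrow> rade vs \<l> y = \<l> y"
  by (induction vs arbitrary: y) (auto simp: linear_add linear_diff)

lemma rade_square:
  "linear \<l> \<Longrightarrow> rade vs (\<lambda>u. (\<l> u)\<^sup>2) y = (\<l> y)\<^sup>2 + (\<Sum>v\<leftarrow>vs. (\<l> v)\<^sup>2)"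
  by (induction vs arbitrary: y) (auto simp: linear_add linear_diff power2_eq_square algebra_simps)

text \<open>Termwise comparison of power series, by
  \<open>2 ^ n * fact n \<le> fact (2 * n)\<close>. This is the source of the subgaussian bound
  \<open>rade_exp\<close>.\<close>

lemma cosh_le_exp_half_square: "(exp x + exp (- x)) / 2 \<le> exp (x\<^sup>2 / 2)" for x :: real
proof -
  have "(\<lambda>n. if even n then x ^ n /\<^sub>R fact n else 0) sums cosh x" by (rule cosh_converges)
  then have "(\<lambda>n. (\<lambda>n. if even n then x ^ n /\<^sub>R fact n else 0) (2 * n)) sums cosh x"
    by (subst sums_mono_reindex) (auto simp: strict_mono_def elim!: evenE)
  then have a: "(\<lambda>n. x ^ (2 * n) / fact (2 * n)) sums cosh x" by (simp add: field_simps)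
  have b: "(\<lambda>n. (x\<^sup>2 / 2) ^ n / fact n) sums exp (x\<^sup>2 / 2)"
    using exp_converges[of "x\<^sup>2 / 2"] by (simp add: field_simps)
  have f: "2 ^ n * fact n \<le> (fact (2 * n) :: real)" for n
  proof (induction n)
    case (Suc n)
    have "2 ^ Suc n * fact (Suc n) = (2 * real (Suc n)) * (2 ^ n * fact n)" by simp
    also have "\<dots> \<le> (2 * real (Suc n)) * ((2 * real n + 1) * fact (2 * n))"
      using Suc by (intro mult_left_mono order_trans[OF Suc]) (auto simp: algebra_simps)
    also have "\<dots> = fact (2 * Suc n)" by (simp add: algebra_simps)
    finally show ?case .
  qed simp
  have "x ^ (2 * n) / fact (2 * n) \<le> (x\<^sup>2 / 2) ^ n / fact n" for n
    unfolding power_divide power_mult[symmetric] divide_divide_eq_left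
    by (intro divide_left_mono f) (auto simp: power_mult)
  from sums_le[OF this a b] show ?thesis by (simp add: cosh_def)
qed

lemma rade_exp:
  "linear \<l> \<Longrightarrow> rade vs (\<lambda>u. exp (\<l> u)) y \<le> exp (\<l> y + (\<Sum>v\<leftarrow>vs. (\<l> v)\<^sup>2) / 2)"
proof (induction vs arbitrary: y)
  case (Cons v vs)
  let ?s = "(\<Sum>v\<leftarrow>vs. (\<l> v)\<^sup>2) / 2"
  have "rade (v # vs) (\<lambda>u. exp (\<l> u)) y \<le> (exp (\<l> (y + v) + ?s) + exp (\<l> (y - v) + ?s)) / 2"
    using Cons.IH[OF Cons.prems, of "y + v"] Cons.IH[OF Cons.prems, of "y - v"] by simp
  also have "\<dots> = exp (\<l> y + ?s) * ((exp (\<l> v) + exp (- \<l> v)) / 2)"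
    using Cons.prems by (simp add: linear_add linear_diff exp_add[symmetric] distrib_left add_ac)
  also have "\<dots> \<le> exp (\<l> y + ?s) * exp ((\<l> v)\<^sup>2 / 2)"
    by (intro mult_left_mono cosh_le_exp_half_square) auto
  finally show ?case by (simp add: exp_add[symmetric] add_divide_distrib algebra_simps)
qed simp

text \<open>At \<open>y = 0\<close> the bound is the Gaussian fourth moment; each induction step has
  2 b^4 to spare, where b is the value of \<open>\<l>\<close> at the new vector.\<close>

lemma rade_fourth:
  fixes \<l> :: "'v::real_vector \<Rightarrow> real"
  defines "s vs \<equiv> (\<Sum>v\<leftarrow>vs. (\<l> v)\<^sup>2)"
  assumes "linear \<l>"
  shows "rade vs (\<lambda>u. (\<l> u) ^ 4) y \<le> (\<l> y) ^ 4 + 6 * (\<l> y)\<^sup>2 * s vs + 3 * (s vs)\<^sup>2"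
proof (induction vs arbitrary: y)
  case (Cons v vs)
  define a b where "a = \<l> y" and "b = \<l> v"
  have "rade (v # vs) (\<lambda>u. (\<l> u) ^ 4) y \<le> (((a + b) ^ 4 + 6 * (a + b)\<^sup>2 * s vs + 3 * (s vs)\<^sup>2)
     + ((a - b) ^ 4 + 6 * (a - b)\<^sup>2 * s vs + 3 * (s vs)\<^sup>2)) / 2"
    using Cons.IH[of "y + v"] Cons.IH[of "y - v"] assms(2) by (simp add: linear_add linear_diff a_def b_def)
  also have "\<dots> = a ^ 4 + 6 * a\<^sup>2 * (b\<^sup>2 + s vs) + 3 * (b\<^sup>2 + s vs)\<^sup>2 - 2 * (b\<^sup>2)\<^sup>2"
    by algebra
  also have "\<dots> \<le> a ^ 4 + 6 * a\<^sup>2 * (b\<^sup>2 + s vs) + 3 * (b\<^sup>2 + s vs)\<^sup>2" by simp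
  finally show ?case by (simp add: s_def a_def b_def)
qed (simp add: s_def)

text \<open>Khinchine's lower bound from the second and fourth moments: |x| is minorized by an even
  quartic polynomial that touches it at |x| = c, and that polynomial is averaged.\<close>

lemma rade_abs:
  fixes \<l> :: "'v::real_vector \<Rightarrow> real"
  assumes "linear \<l>" "(\<Sum>v\<leftarrow>vs. (\<l> v)\<^sup>2) = s"
  shows "sqrt (s / 3) \<le> rade vs (\<lambda>u. \<bar>\<l> u\<bar>) 0"
proof (cases "s > 0")
  case True
  \<comment> \<open>The quartic yields the bound 3 s / (2 c) - 3 s^2 / (2 c^3), which is largest at
    c^2 = 3 s.\<close>
  define c where "c = sqrt (3 * s)"
  have c: "c > 0" "c\<^sup>2 = 3 * s" using True by (auto simp: c_def)
  have pt: "(3 / (2 * c)) * x\<^sup>2 - (1 / (2 * c ^ 3)) * x ^ 4 \<le> \<bar>x\<bar>" for x :: real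
  proof -
    define t where "t = \<bar>x\<bar> / c"
    have t: "t \<ge> 0" "\<bar>x\<bar> = c * t" using c by (auto simp: t_def)
    have "x\<^sup>2 = \<bar>x\<bar>\<^sup>2" by simp
    then have x2: "x\<^sup>2 = c\<^sup>2 * t\<^sup>2" unfolding t(2) power_mult_distrib .
    have "x ^ 4 = (x\<^sup>2)\<^sup>2" by simp
    then have x4: "x ^ 4 = c ^ 4 * t ^ 4" unfolding x2 by (simp add: power_mult_distrib)
    have "0 \<le> t * ((t - 1)\<^sup>2 * (t + 2)) / 2" using t by auto
    also have "\<dots> = t - (3 / 2 * t\<^sup>2 - t ^ 4 / 2)" by (simp add: power2_eq_square power4_eq_xxxx field_simps)
    finally have "c * (3 / 2 * t\<^sup>2 - t ^ 4 / 2) \<le> c * t" using c(1) by simp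
    moreover have "(3 / (2 * c)) * x\<^sup>2 - (1 / (2 * c ^ 3)) * x ^ 4 = c * (3 / 2 * t\<^sup>2 - t ^ 4 / 2)"
      unfolding x2 x4 using c(1) by (simp add: field_simps power2_eq_square power3_eq_cube power4_eq_xxxx)
    ultimately show ?thesis using t by simp
  qed
  have "rade vs (\<lambda>u. \<bar>\<l> u\<bar>) 0
      \<ge> (3 / (2 * c)) * rade vs (\<lambda>u. (\<l> u)\<^sup>2) 0 - (1 / (2 * c ^ 3)) * rade vs (\<lambda>u. (\<l> u) ^ 4) 0"
    unfolding rade_cmult[symmetric] rade_diff[symmetric] by (rule rade_mono) (rule pt)
  moreover have "rade vs (\<lambda>u. (\<l> u)\<^sup>2) 0 = s" using assms by (simp add: rade_square linear_0)
  moreover have "(1 / (2 * c ^ 3)) * rade vs (\<lambda>u. (\<l> u) ^ 4) 0 \<le> (1 / (2 * c ^ 3)) * (3 * s\<^sup>2)"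
    using rade_fourth[OF assms(1), of vs 0] assms c by (intro mult_left_mono) (auto simp: linear_0)
  moreover have "(3 / (2 * c)) * s - (1 / (2 * c ^ 3)) * (3 * s\<^sup>2) = c / 3"
  proof -
    have s: "s = c\<^sup>2 / 3" using c by simp
    show ?thesis unfolding s using c(1) by (simp add: field_simps power2_eq_square power3_eq_cube)
  qed
  moreover have "sqrt (s / 3) = c / 3"
    using c True by (intro real_sqrt_unique) (auto simp: power_divide)
  ultimately show ?thesis by simp
next
  case False
  have "0 \<le> (\<Sum>v\<leftarrow>vs. (\<l> v)\<^sup>2)" by (rule sum_list_nonneg) auto
  then have "s = 0" using False assms(2) by simp
  moreover have "rade vs (\<lambda>_. 0) 0 \<le> rade vs (\<lambda>u. \<bar>\<l> u\<bar>) 0" by (rule rade_mono) simp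
  ultimately show ?thesis by simp
qed


section \<open>Second-order expansion of log-sum-exp and Lindeberg replacement\<close>

lemma abs_exp_minus_quadratic_le:
  fixes x :: real assumes "\<bar>x\<bar> \<le> 1"
  shows "\<bar>exp x - 1 - x - x\<^sup>2 / 2\<bar> \<le> \<bar>x\<bar> ^ 3 / 2"
proof -
  obtain t where t: "\<bar>t\<bar> \<le> \<bar>x\<bar>" "exp x = (\<Sum>m<3. x ^ m / fact m) + exp t / fact 3 * x ^ 3"
    using Maclaurin_exp_le[of x 3] by blast
  have "exp t \<le> exp 1" using t assms by simp
  also have "exp 1 \<le> (3::real)" using exp_le by simp
  finally have e: "exp t / 6 \<le> 1 / 2" by simp
  have "exp x - 1 - x - x\<^sup>2 / 2 = exp t / 6 * x ^ 3"
    using t(2) by (simp add: eval_nat_numeral fact_numeral)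
  then have "\<bar>exp x - 1 - x - x\<^sup>2 / 2\<bar> = exp t / 6 * \<bar>x\<bar> ^ 3"
    by (simp only: abs_mult power_abs abs_divide) simp
  also have "\<dots> \<le> 1 / 2 * \<bar>x\<bar> ^ 3" using e by (intro mult_right_mono) auto
  finally show ?thesis by simp
qed

text \<open>Cumulant expansion. Centering at the mean kills the linear term; the remainder of the
  exponential costs 4 M^3, that of the logarithm 4.5 M^3. The variance is written as a double sum
  over pairs so that only increments of \<open>u\<close> enter.\<close>

lemma ln_mgf_second_order:
  fixes \<pi> u :: "'i \<Rightarrow> real"
  assumes "finite I" and pos: "\<And>i. i \<in> I \<Longrightarrow> \<pi> i \<ge> 0" and one: "sum \<pi> I = 1"
    and u: "\<And>i. i \<in> I \<Longrightarrow> \<bar>u i\<bar> \<le> M" and M: "0 \<le> M" "M \<le> 1/4"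
  shows "\<bar>ln (\<Sum>i\<in>I. \<pi> i * exp (u i)) - (\<Sum>i\<in>I. \<pi> i * u i)
      - (\<Sum>i\<in>I. \<Sum>j\<in>I. \<pi> i * \<pi> j * (u i - u j)\<^sup>2) / 4\<bar> \<le> 9 * M ^ 3"
proof -
  define m where "m = (\<Sum>i\<in>I. \<pi> i * u i)"
  define v where "v i = u i - m" for i
  define s where "s = (\<Sum>i\<in>I. \<pi> i * (v i)\<^sup>2)"
  define z where "z = (\<Sum>i\<in>I. \<pi> i * exp (v i)) - 1"
  have "\<bar>m\<bar> \<le> (\<Sum>i\<in>I. \<pi> i * M)"
    unfolding m_def using pos u
    by (intro order_trans[OF sum_abs] sum_mono) (auto simp: abs_mult intro!: mult_left_mono)
  then have m: "\<bar>m\<bar> \<le> M" using one by (simp add: sum_distrib_right[symmetric])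
  have v: "\<bar>v i\<bar> \<le> 2 * M" if "i \<in> I" for i using u[OF that] m by (auto simp: v_def)
  have v0: "(\<Sum>i\<in>I. \<pi> i * v i) = 0"
    using one by (simp add: v_def algebra_simps sum_subtractf sum_distrib_right[symmetric] flip: m_def)
       (simp add: m_def sum_distrib_left[symmetric])
  have var: "(\<Sum>i\<in>I. \<Sum>j\<in>I. \<pi> i * \<pi> j * (u i - u j)\<^sup>2) = 2 * s"
  proof -
    have "(\<Sum>i\<in>I. \<Sum>j\<in>I. \<pi> i * \<pi> j * (u i - u j)\<^sup>2)
        = (\<Sum>i\<in>I. \<Sum>j\<in>I. (\<pi> i * (v i)\<^sup>2) * \<pi> j + \<pi> i * (\<pi> j * (v j)\<^sup>2) - 2 * ((\<pi> i * v i) * (\<pi> j * v j)))"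
      by (intro sum.cong refl) (simp add: v_def power2_eq_square algebra_simps)
    also have "\<dots> = s * sum \<pi> I + sum \<pi> I * s - 2 * ((\<Sum>i\<in>I. \<pi> i * v i) * (\<Sum>i\<in>I. \<pi> i * v i))"
      unfolding sum.distrib sum_subtractf s_def
      by (simp add: sum_product sum_distrib_left[symmetric])
    finally show ?thesis using one v0 by simp
  qed
  have s0: "0 \<le> s" unfolding s_def using pos by (intro sum_nonneg) auto
  have "s \<le> (\<Sum>i\<in>I. \<pi> i * (2 * M)\<^sup>2)" unfolding s_def
  proof (intro sum_mono mult_left_mono pos)
    show "(v i)\<^sup>2 \<le> (2 * M)\<^sup>2" if "i \<in> I" for i
      using power_mono[OF v[OF that], of 2] by simp
  qed
  then have s4: "s \<le> 4 * M\<^sup>2" using one by (simp add: sum_distrib_right[symmetric] power_mult_distrib)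
  have "(\<Sum>i\<in>I. \<pi> i * (exp (v i) - 1 - v i - (v i)\<^sup>2 / 2))
      = (\<Sum>i\<in>I. \<pi> i * exp (v i)) - sum \<pi> I - (\<Sum>i\<in>I. \<pi> i * v i) - s / 2"
    by (simp add: s_def right_diff_distrib sum_subtractf sum_divide_distrib)
  then have "\<bar>z - s / 2\<bar> = \<bar>\<Sum>i\<in>I. \<pi> i * (exp (v i) - 1 - v i - (v i)\<^sup>2 / 2)\<bar>"
    using one v0 by (simp add: z_def)
  also have "\<dots> \<le> (\<Sum>i\<in>I. \<pi> i * (4 * M ^ 3))"
  proof (intro order_trans[OF sum_abs] sum_mono)
    fix i assume i: "i \<in> I"
    have "\<bar>exp (v i) - 1 - v i - (v i)\<^sup>2 / 2\<bar> \<le> \<bar>v i\<bar> ^ 3 / 2"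
      using v[OF i] M by (intro abs_exp_minus_quadratic_le) auto
    also have "\<dots> \<le> (2 * M) ^ 3 / 2" using v[OF i] by (intro divide_right_mono power_mono) auto
    finally show "\<bar>\<pi> i * (exp (v i) - 1 - v i - (v i)\<^sup>2 / 2)\<bar> \<le> \<pi> i * (4 * M ^ 3)"
      using pos[OF i] by (simp add: abs_mult power_mult_distrib mult_left_mono)
  qed
  finally have zs: "\<bar>z - s / 2\<bar> \<le> 4 * M ^ 3" using one by (simp add: sum_distrib_right[symmetric])
  have M3: "M ^ 3 \<le> M\<^sup>2 / 4"
    using mult_left_mono[OF M(2), of "M\<^sup>2"] by (simp add: power2_eq_square power3_eq_cube)
  have zM: "\<bar>z\<bar> \<le> 3 * M\<^sup>2" using zs s0 s4 M3 by linarith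
  also have "3 * M\<^sup>2 \<le> 1 / 2"
    using power_mono[OF M(2) M(1), of 2] by (simp add: power2_eq_square)
  finally have zh: "\<bar>z\<bar> \<le> 1 / 2" .
  then have "\<bar>ln (1 + z) - z\<bar> \<le> 2 * z\<^sup>2" by (rule abs_ln_one_plus_x_minus_x_bound)
  also have "2 * z\<^sup>2 \<le> 2 * (3 * M\<^sup>2)\<^sup>2"
    using zM by (intro mult_left_mono) (metis abs_ge_zero power2_abs power_mono, simp)
  also have "\<dots> = 18 * M * M ^ 3" by (simp add: power2_eq_square power3_eq_cube)
  also have "\<dots> \<le> 4.5 * M ^ 3" using M by (intro mult_right_mono) auto
  finally have lnz: "\<bar>ln (1 + z) - z\<bar> \<le> 4.5 * M ^ 3" .
  have "(\<Sum>i\<in>I. \<pi> i * exp (u i)) = exp m * (1 + z)"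
    by (simp add: z_def v_def exp_diff sum_distrib_left)
  moreover have "0 < 1 + z" using zh by linarith
  ultimately have "ln (\<Sum>i\<in>I. \<pi> i * exp (u i)) = m + ln (1 + z)" by (simp add: ln_mult)
  moreover have "0 \<le> M ^ 3" using M by simp
  ultimately show ?thesis using var lnz zs unfolding m_def[symmetric] by argo
qed

text \<open>Smooth substitute for the maximum, with gradient \<open>softmax\<close>: the replacement
  argument needs a controlled third-order remainder, which \<open>Max\<close> does not have.\<close>

definition lse :: "'i set \<Rightarrow> ('i \<Rightarrow> real) \<Rightarrow> real" where
  "lse I y = ln (\<Sum>i\<in>I. exp (y i))"

definition softmax :: "'i set \<Rightarrow> ('i \<Rightarrow> real) \<Rightarrow> 'i \<Rightarrow> real" where
  "softmax I y i = exp (y i) / (\<Sum>j\<in>I. exp (y j))"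

text \<open>The expected second-order term of the Taylor expansion of \<open>lse I\<close> at \<open>y\<close> in the direction of the
  Rademacher sum of \<open>vs\<close>. It sees only the squared increments of the process, which is why a
  comparison of increments suffices.\<close>

definition softvar :: "'i set \<Rightarrow> ('i \<Rightarrow> real) \<Rightarrow> ('i \<Rightarrow> real) list \<Rightarrow> real" where
  "softvar I y vs = (\<Sum>i\<in>I. \<Sum>j\<in>I. softmax I y i * softmax I y j * (\<Sum>v\<leftarrow>vs. (v i - v j)\<^sup>2)) / 4"

lemma sum_softmax: "finite I \<Longrightarrow> I \<noteq> {} \<Longrightarrow> sum (softmax I y) I = 1"
  and softmax_nonneg: "0 \<le> softmax I y i"
proof -
  show "0 \<le> softmax I y i" by (simp add: softmax_def sum_nonneg)
  assume "finite I" "I \<noteq> {}"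
  then have "(\<Sum>j\<in>I. exp (y j)) > 0" by (intro sum_pos) auto
  then show "sum (softmax I y) I = 1" by (simp add: softmax_def sum_divide_distrib[symmetric])
qed

lemma linear_eval [simp]: "linear (\<lambda>y :: 'i \<Rightarrow> real. y i)"
  and linear_eval_diff [simp]: "linear (\<lambda>y :: 'i \<Rightarrow> real. y i - y j)"
  by (auto intro!: linearI simp: scaleR_fun_def algebra_simps)

lemma reach_abs_le:
  assumes "u \<in> reach vs 0" "\<And>v. v \<in> set vs \<Longrightarrow> \<bar>v i\<bar> \<le> B"
  shows "\<bar>(u :: 'i \<Rightarrow> real) i\<bar> \<le> real (length vs) * B"
proof -
  have "\<bar>u i\<bar> \<le> \<bar>y i\<bar> + real (length vs) * B" if "u \<in> reach vs y" for y
    using that assms(2)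
  proof (induction vs arbitrary: y)
    case (Cons v vs)
    have v: "\<bar>v i\<bar> \<le> B" using Cons.prems(2)[of v] by simp
    from Cons.prems(1) consider "u \<in> reach vs (y + v)" | "u \<in> reach vs (y - v)" by auto
    then show ?case
    proof cases
      case 1
      have "\<bar>u i\<bar> \<le> \<bar>(y + v) i\<bar> + real (length vs) * B" by (rule Cons.IH[OF 1]) (simp add: Cons.prems(2))
      with v show ?thesis by (simp add: algebra_simps)
    next
      case 2
      have "\<bar>u i\<bar> \<le> \<bar>(y - v) i\<bar> + real (length vs) * B" by (rule Cons.IH[OF 2]) (simp add: Cons.prems(2))
      with v show ?thesis by (simp add: algebra_simps)
    qed
  qed simp
  from this[OF assms(1)] show ?thesis by simp
qed

text \<open>Moving from \<open>y\<close> by \<open>u\<close> changes \<open>lse\<close> by the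
  logarithm of an exponential average with weights \<open>softmax I y\<close>. Averaging over the
  signs removes the linear term and turns squared increments of \<open>u\<close> into sums of
  squares over \<open>vs\<close>.\<close>

lemma rade_lse:
  fixes vs :: "('i \<Rightarrow> real) list"
  assumes I: "finite I" "I \<noteq> {}" and B: "\<And>v i. v \<in> set vs \<Longrightarrow> i \<in> I \<Longrightarrow> \<bar>v i\<bar> \<le> B"
    and M: "real (length vs) * B \<le> M" "0 \<le> M" "M \<le> 1/4"
  shows "\<bar>rade vs (lse I) y - lse I y - softvar I y vs\<bar> \<le> 9 * M ^ 3"
proof -
  let ?\<pi> = "softmax I y"
  define Z where "Z = (\<Sum>j\<in>I. exp (y j))"
  have Z: "Z > 0" unfolding Z_def using I by (intro sum_pos) auto
  define q where "q u = lse I y + ((\<Sum>i\<in>I. ?\<pi> i * u i) + (1/4) * (\<Sum>i\<in>I. \<Sum>j\<in>I. (?\<pi> i * ?\<pi> j) * (u i - u j)\<^sup>2))"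
    for u :: "'i \<Rightarrow> real"
  have lq: "\<bar>lse I (u + y) - q u\<bar> \<le> 9 * M ^ 3" if u: "u \<in> reach vs 0" for u
  proof -
    have "\<bar>u i\<bar> \<le> M" if "i \<in> I" for i
      using reach_abs_le[OF u, of i B] B[OF _ that] M by fastforce
    then have "\<bar>ln (\<Sum>i\<in>I. ?\<pi> i * exp (u i)) - (\<Sum>i\<in>I. ?\<pi> i * u i)
      - (\<Sum>i\<in>I. \<Sum>j\<in>I. ?\<pi> i * ?\<pi> j * (u i - u j)\<^sup>2) / 4\<bar> \<le> 9 * M ^ 3"
      using I M by (intro ln_mgf_second_order) (auto simp: sum_softmax softmax_nonneg)
    moreover have "lse I (u + y) = lse I y + ln (\<Sum>i\<in>I. ?\<pi> i * exp (u i))"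
    proof -
      have "(\<Sum>i\<in>I. exp ((u + y) i)) = Z * (\<Sum>i\<in>I. ?\<pi> i * exp (u i))"
        using Z by (simp add: softmax_def sum_distrib_left exp_add mult.commute flip: Z_def)
      moreover have "(\<Sum>i\<in>I. ?\<pi> i * exp (u i)) > 0"
        using I Z by (intro sum_pos) (auto simp: softmax_def Z_def)
      ultimately show ?thesis using Z by (simp add: lse_def ln_mult flip: Z_def)
    qed
    ultimately show ?thesis by (simp add: q_def)
  qed
  have "rade vs q 0 = lse I y + softvar I y vs"
    unfolding q_def rade_add rade_cmult rade_sum
    by (simp add: rade_linear rade_square softvar_def)
  moreover have "rade vs (lse I) y = rade vs (\<lambda>u. lse I (u + y)) 0"
    using rade_shift[of vs "lse I" 0 y] by simp
  moreover have "rade vs (\<lambda>u. lse I (u + y)) 0 \<le> rade vs (\<lambda>u. q u + 9 * M ^ 3) 0"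
    using lq by (intro rade_mono_on) (smt (verit))
  moreover have "rade vs (\<lambda>u. q u - 9 * M ^ 3) 0 \<le> rade vs (\<lambda>u. lse I (u + y)) 0"
    using lq by (intro rade_mono_on) (smt (verit))
  ultimately show ?thesis by (simp add: rade_add rade_diff)
qed

text \<open>Lindeberg replacement: blocks commute, so they can be exchanged one at a time, each
  exchange costing \<open>\<delta>\<close> whatever the current state is.\<close>

lemma rade_replicate_mono:
  assumes "\<And>y. rade us \<phi> y \<le> rade vs \<phi> y + \<delta>"
  shows "rade (concat (replicate n us)) \<phi> y \<le> rade (concat (replicate n vs)) \<phi> y + real n * \<delta>"
proof (induction n arbitrary: y)
  case (Suc n)
  let ?U = "concat (replicate n us)" and ?V = "concat (replicate n vs)"
  have "rade (concat (replicate (Suc n) us)) \<phi> y = rade ?U (rade us \<phi>) y"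
    by (simp add: rade_append rade_commute)
  also have "\<dots> \<le> rade ?U (\<lambda>u. rade vs \<phi> u + \<delta>) y" by (intro rade_mono assms)
  also have "\<dots> = rade vs (rade ?U \<phi>) y + \<delta>" by (simp add: rade_add rade_commute[of ?U])
  also have "\<dots> \<le> rade vs (\<lambda>u. rade ?V \<phi> u + real n * \<delta>) y + \<delta>"
    by (intro add_right_mono rade_mono Suc)
  finally show ?case by (simp add: rade_add rade_append algebra_simps)
qed simp

text \<open>The second-order terms are ordered by the increment hypothesis because the weights
  \<open>softmax\<close> are nonnegative. There remains the Taylor error, twice 9 M^3 per block with
  M = K / sqrt n, hence 18 K^3 / sqrt n over all \<open>n\<close> blocks.\<close>

lemma lse_comparison:
  fixes us vs :: "('i \<Rightarrow> real) list"
  assumes I: "finite I" "I \<noteq> {}"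
    and le: "\<And>i j. i \<in> I \<Longrightarrow> j \<in> I \<Longrightarrow> (\<Sum>v\<leftarrow>us. (v i - v j)\<^sup>2) \<le> (\<Sum>v\<leftarrow>vs. (v i - v j)\<^sup>2)"
    and "\<epsilon> > 0"
  shows "\<forall>\<^sub>F n in sequentially. rade (noise n us) (lse I) 0 \<le> rade (noise n vs) (lse I) 0 + \<epsilon>"
proof -
  define B where "B = (\<Sum>v\<in>set us \<union> set vs. \<Sum>i\<in>I. \<bar>v i\<bar>)"
  have B: "\<bar>v i\<bar> \<le> B" if "v \<in> set us \<union> set vs" "i \<in> I" for v i
  proof -
    have "\<bar>v i\<bar> \<le> (\<Sum>i\<in>I. \<bar>v i\<bar>)" using I that by (intro member_le_sum) auto
    also have "\<dots> \<le> B" unfolding B_def using that by (intro member_le_sum) (auto intro: sum_nonneg)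
    finally show ?thesis .
  qed
  have B0: "B \<ge> 0" by (auto simp: B_def intro!: sum_nonneg)
  define K where "K = real (length us + length vs) * B"
  have K0: "K \<ge> 0" using B0 by (simp add: K_def)
  have lim: "(\<lambda>n. c / sqrt (real n)) \<longlonglongrightarrow> 0" for c
    by real_asymp
  have "\<forall>\<^sub>F n in sequentially. K / sqrt (real n) < 1/4"
    by (rule order_tendstoD(2)[OF lim]) simp
  moreover have "\<forall>\<^sub>F n in sequentially. 18 * K ^ 3 / sqrt (real n) < \<epsilon>"
    by (rule order_tendstoD(2)[OF lim]) fact
  ultimately show ?thesis using eventually_gt_at_top[of 0]
  proof eventually_elim
    case (elim n)
    let ?s = "1 / sqrt (real n)" and ?M = "K / sqrt (real n)"
    let ?us = "map ((*\<^sub>R) ?s) us" and ?vs = "map ((*\<^sub>R) ?s) vs"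
    have *: "\<bar>rade (map ((*\<^sub>R) ?s) ws) (lse I) y - lse I y - softvar I y (map ((*\<^sub>R) ?s) ws)\<bar> \<le> 9 * ?M ^ 3"
      if "set ws \<subseteq> set us \<union> set vs" "length ws \<le> length us + length vs" for ws y
    proof (rule rade_lse[OF I, where B = "B / sqrt n"])
      fix v i assume "v \<in> set (map ((*\<^sub>R) ?s) ws)" "i \<in> I"
      then obtain w where "v = ?s *\<^sub>R w" "w \<in> set ws" by auto
      then show "\<bar>v i\<bar> \<le> B / sqrt n"
        using B[of w i] that \<open>i \<in> I\<close> by (auto simp: scaleR_fun_def divide_right_mono)
    next
      have "real (length ws) * B \<le> K" unfolding K_def using that B0 by (intro mult_right_mono) auto
      then show "real (length (map ((*\<^sub>R) ?s) ws)) * (B / sqrt n) \<le> ?M"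
        by (simp add: divide_right_mono)
    qed (use elim K0 in auto)
    have sv: "softvar I y ?us \<le> softvar I y ?vs" for y
    proof -
      have sc: "(\<Sum>v\<leftarrow>map ((*\<^sub>R) ?s) ws. (v i - v j)\<^sup>2) = (1 / n) * (\<Sum>v\<leftarrow>ws. (v i - v j)\<^sup>2)" for ws i j
        by (simp add: o_def scaleR_fun_def power_divide sum_list_const_mult[symmetric] flip: diff_divide_distrib)
      show ?thesis unfolding softvar_def sc
        by (intro divide_right_mono sum_mono mult_left_mono le) (auto simp: softmax_nonneg)
    qed
    have "rade ?us (lse I) y \<le> rade ?vs (lse I) y + 18 * ?M ^ 3" for y
      using *[of us y] *[of vs y] sv[of y] by simp
    then have le: "rade (noise n us) (lse I) 0 \<le> rade (noise n vs) (lse I) 0 + real n * (18 * ?M ^ 3)"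
      unfolding noise_def by (rule rade_replicate_mono)
    have "real n * (18 * ?M ^ 3) = 18 * K ^ 3 / sqrt n"
    proof -
      have "sqrt n ^ 3 = n * sqrt n" using elim by (simp add: power3_eq_cube)
      then show ?thesis using elim by (simp add: power_divide)
    qed
    also have "\<dots> \<le> \<epsilon>" using elim by simp
    finally have "real n * (18 * ?M ^ 3) \<le> \<epsilon>" .
    from order_trans[OF le add_left_mono[OF this]] show ?case .
  qed
qed

lemma max_comparison:
  fixes us vs :: "('i \<Rightarrow> real) list"
  assumes I: "finite I" "I \<noteq> {}"
    and le: "\<And>i j. i \<in> I \<Longrightarrow> j \<in> I \<Longrightarrow> (\<Sum>v\<leftarrow>us. (v i - v j)\<^sup>2) \<le> (\<Sum>v\<leftarrow>vs. (v i - v j)\<^sup>2)"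
    and "\<epsilon> > 0"
  shows "\<forall>\<^sub>F n in sequentially.
    rade (noise n us) (\<lambda>y. Max (y ` I)) 0 \<le> rade (noise n vs) (\<lambda>y. Max (y ` I)) 0 + \<epsilon>"
proof -
  \<comment> \<open>Rescaled \<open>lse\<close> exceeds the maximum by at most
    \<open>ln (card I) / \<beta>\<close>, which is at most half of \<open>\<epsilon>\<close> here;
    adding 1 keeps \<open>\<beta>\<close> positive when \<open>I\<close> is a singleton. The other
    half pays for the replacement.\<close>
  define \<beta> where "\<beta> = 2 * (ln (card I) + 1) / \<epsilon>"
  have c1: "card I \<ge> 1" using I by (simp add: Suc_leI card_gt_0_iff)
  then have "ln (card I) \<ge> 0" by simp
  then have \<beta>: "\<beta> > 0" "ln (card I) / \<beta> \<le> \<epsilon> / 2"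
    using \<open>\<epsilon> > 0\<close> by (auto simp: \<beta>_def field_simps)
  have lb: "Max (y ` I) \<le> (1 / \<beta>) * lse I (\<beta> *\<^sub>R y)"
    and ub: "(1 / \<beta>) * lse I (\<beta> *\<^sub>R y) \<le> Max (y ` I) + ln (card I) / \<beta>" for y
  proof -
    have "Max (y ` I) \<in> y ` I" using I by (intro Max_in) auto
    then obtain k where k: "k \<in> I" "Max (y ` I) = y k" by auto
    have "exp (\<beta> * y k) \<le> (\<Sum>i\<in>I. exp (\<beta> * y i))" using I k by (intro member_le_sum) auto
    then have "ln (exp (\<beta> * y k)) \<le> ln (\<Sum>i\<in>I. exp (\<beta> * y i))"
      by (subst ln_le_cancel_iff) (use less_le_trans[OF exp_gt_zero] in auto)
    then show "Max (y ` I) \<le> (1 / \<beta>) * lse I (\<beta> *\<^sub>R y)"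
      using \<beta> k by (simp add: lse_def scaleR_fun_def field_simps)
    have "(\<Sum>i\<in>I. exp (\<beta> * y i)) \<le> (\<Sum>i\<in>I. exp (\<beta> * y k))"
      using I \<beta> by (intro sum_mono) (auto simp flip: k(2))
    then have "ln (\<Sum>i\<in>I. exp (\<beta> * y i)) \<le> ln (real (card I) * exp (\<beta> * y k))"
      using I c1 by (subst ln_le_cancel_iff) (auto intro!: sum_pos mult_pos_pos)
    also have "\<dots> = ln (card I) + \<beta> * y k" using c1 by (simp add: ln_mult)
    finally show "(1 / \<beta>) * lse I (\<beta> *\<^sub>R y) \<le> Max (y ` I) + ln (card I) / \<beta>"
      using \<beta> k by (simp add: lse_def scaleR_fun_def field_simps)
  qed
  have lin: "linear ((*\<^sub>R) \<beta> :: ('i \<Rightarrow> real) \<Rightarrow> _)" by (simp add: linear_scaleR)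
  have sc: "rade (noise n ws) (\<lambda>y. (1 / \<beta>) * lse I (\<beta> *\<^sub>R y)) 0
      = (1 / \<beta>) * rade (noise n (map ((*\<^sub>R) \<beta>) ws)) (lse I) 0" for n and ws :: "('i \<Rightarrow> real) list"
    unfolding rade_cmult map_noise[OF lin, symmetric] using rade_map[OF lin, of "noise n ws" "lse I" 0] by simp
  have "\<forall>\<^sub>F n in sequentially. rade (noise n (map ((*\<^sub>R) \<beta>) us)) (lse I) 0
     \<le> rade (noise n (map ((*\<^sub>R) \<beta>) vs)) (lse I) 0 + \<beta> * \<epsilon> / 2"
  proof (rule lse_comparison[OF I])
    fix i j assume "i \<in> I" "j \<in> I"
    have sc: "(\<Sum>v\<leftarrow>map ((*\<^sub>R) \<beta>) ws. (v i - v j)\<^sup>2) = \<beta>\<^sup>2 * (\<Sum>v\<leftarrow>ws. (v i - v j)\<^sup>2)" for ws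
      by (simp add: o_def scaleR_fun_def power_mult_distrib sum_list_const_mult[symmetric] flip: right_diff_distrib)
    show "(\<Sum>v\<leftarrow>map ((*\<^sub>R) \<beta>) us. (v i - v j)\<^sup>2) \<le> (\<Sum>v\<leftarrow>map ((*\<^sub>R) \<beta>) vs. (v i - v j)\<^sup>2)"
      unfolding sc by (intro mult_left_mono le) (use \<open>i \<in> I\<close> \<open>j \<in> I\<close> in auto)
  qed (use \<beta> \<open>\<epsilon> > 0\<close> in auto)
  then show ?thesis
  proof eventually_elim
    case (elim n)
    have "rade (noise n us) (\<lambda>y. Max (y ` I)) 0 \<le> (1 / \<beta>) * rade (noise n (map ((*\<^sub>R) \<beta>) us)) (lse I) 0"
      unfolding sc[symmetric] by (intro rade_mono lb)
    also have "\<dots> \<le> (1 / \<beta>) * rade (noise n (map ((*\<^sub>R) \<beta>) vs)) (lse I) 0 + \<epsilon> / 2"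
      using elim \<beta> by (simp add: field_simps)
    also have "\<dots> \<le> rade (noise n vs) (\<lambda>y. Max (y ` I) + ln (card I) / \<beta>) 0 + \<epsilon> / 2"
      unfolding sc[symmetric] by (intro add_right_mono rade_mono ub)
    finally have "rade (noise n us) (\<lambda>y. Max (y ` I)) 0
        \<le> rade (noise n vs) (\<lambda>y. Max (y ` I)) 0 + ln (card I) / \<beta> + \<epsilon> / 2" by (simp only: rade_add rade_const)
    also have "\<dots> = rade (noise n vs) (\<lambda>y. Max (y ` I)) 0 + (ln (card I) / \<beta> + \<epsilon> / 2)" by (rule add.assoc)
    also have "\<dots> \<le> rade (noise n vs) (\<lambda>y. Max (y ` I)) 0 + \<epsilon>"
      using \<beta>(2) by (intro add_left_mono) argo
    finally show ?case .
  qed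
qed

section \<open>Chaining\<close>

lemma partition_on_cell:
  assumes "partition_on K P" "x \<in> K"
  shows "cell P x \<in> P" "x \<in> cell P x"
proof -
  from assms have "\<exists>!B. B \<in> P \<and> x \<in> B"
    unfolding partition_on_def by (auto dest: disjointD)
  from theI'[OF this] show "cell P x \<in> P" "x \<in> cell P x" by (simp_all add: cell_def)
qed

lemma cell_eqI:
  assumes "partition_on K P" "B \<in> P" "x \<in> B"
  shows "cell P x = B"
  unfolding cell_def using assms by (intro the_equality) (auto simp: partition_on_def dest: disjointD)

lemma le_ediam: "x \<in> B \<Longrightarrow> y \<in> B \<Longrightarrow> ennreal (d x y) \<le> ediam d B"
  unfolding ediam_def by (rule SUP_upper2, assumption, rule SUP_upper)

lemma ediam_le: "(\<And>x y. x \<in> B \<Longrightarrow> y \<in> B \<Longrightarrow> d x y \<le> r) \<Longrightarrow> ediam d B \<le> ennreal r"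
  unfolding ediam_def by (intro SUP_least ennreal_leI)

lemma two_powr_half: "2 powr (real n / 2) = sqrt 2 ^ n"
  by (simp add: powr_half_sqrt_powr sqrt_def powr_realpow flip: powr_powr real_root_power)

lemma admissible_0: "admissible K A \<Longrightarrow> A 0 = {K}"
  unfolding admissible_def by (metis card_1_singletonE ccpo_Sup_singleton partition_on_def)

text \<open>The Euclidean structure is given by finitely many linear functionals, so the number of
  coordinates may depend on parameters. The resulting \<open>ds\<close> is only a pseudometric on
  the ambient space; \<open>reach_ds_0\<close> deals with points at distance 0.\<close>

locale coords =
  fixes es :: "'e list" and crd :: "'e \<Rightarrow> 'v::real_vector \<Rightarrow> real"
  assumes distinct_es: "distinct es" and linear_crd: "\<And>e. linear (crd e)"
begin

definition ds :: "'v \<Rightarrow> 'v \<Rightarrow> real" where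
  "ds x y = L2_set (\<lambda>e. crd e x - crd e y) (set es)"

lemma ds_nonneg [simp]: "0 \<le> ds x y" by (simp add: ds_def L2_set_nonneg)

lemma ds_commute: "ds x y = ds y x" by (simp add: ds_def L2_set_def power2_commute)

lemma ds_self [simp]: "ds x x = 0" by (simp add: ds_def L2_set_def)

lemma ds_triangle: "ds x z \<le> ds x y + ds y z"
  using L2_set_triangle_ineq[of "\<lambda>e. crd e x - crd e y" "\<lambda>e. crd e y - crd e z" "set es"]
  by (simp add: ds_def)

lemma ds_power2: "(ds x y)\<^sup>2 = (\<Sum>e\<leftarrow>es. (crd e x - crd e y)\<^sup>2)"
  by (simp add: ds_def L2_set_def sum_nonneg sum_list_distinct_conv_sum_set distinct_es)

text \<open>The index set of the process is the space itself: a state \<open>y\<close> assigns to \<open>t\<close> the value of the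
  inner product of \<open>t\<close> with the random vector, and the coordinate functionals \<open>crd e\<close> are the
  directions of the walk.\<close>

definition width :: "nat \<Rightarrow> 'v set \<Rightarrow> real" where
  "width n S = rade (noise n (map crd es)) (\<lambda>y. Max (y ` S)) 0"

lemma rade_noise_eval [simp]: "rade vs (\<lambda>y. y i) 0 = (0::real)" for i :: 'i
  by (simp add: rade_linear)

lemma width_nonneg: "finite S \<Longrightarrow> S \<noteq> {} \<Longrightarrow> 0 \<le> width n S"
proof -
  assume S: "finite S" "S \<noteq> {}"
  then obtain t where t: "t \<in> S" by auto
  have "rade (noise n (map crd es)) (\<lambda>y. y t) 0 \<le> width n S"
    unfolding width_def using S t by (intro rade_mono) auto
  then show ?thesis by simp
qed

text \<open>Every reachable state lies in the span of the coordinate functionals; \<open>P\<close>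
  plays the part of membership in a linear subspace containing them.\<close>

lemma reach_noise:
  assumes "u \<in> reach (noise n (map crd es)) 0" "P 0" "\<And>f g. P f \<Longrightarrow> P g \<Longrightarrow> P (f + g)"
    "\<And>c f. P f \<Longrightarrow> P (c *\<^sub>R f)" "\<And>e. e \<in> set es \<Longrightarrow> P (crd e)"
  shows "P u"
proof (rule reach_induct[where P = P, OF assms(1,2)])
  fix u v assume u: "P u" and "v \<in> set (noise n (map crd es))"
  then have "P v" by (auto simp: noise_def intro!: assms(4,5) split: if_splits)
  moreover have "u - v = u + (-1) *\<^sub>R v" by simp
  ultimately show "P (u + v) \<and> P (u - v)" using u by (metis assms(3,4))
qed

lemma reach_linear: "u \<in> reach (noise n (map crd es)) 0 \<Longrightarrow> linear u"
  by (erule reach_noise)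
     (auto intro!: linearI simp: linear_crd linear_add linear_cmul scaleR_fun_def algebra_simps)

lemma reach_ds_0: "u \<in> reach (noise n (map crd es)) 0 \<Longrightarrow> ds s t = 0 \<Longrightarrow> u s = u t"
  by (erule reach_noise) (auto simp: scaleR_fun_def ds_def L2_set_eq_0_iff)

text \<open>Reachable states are linear functionals, so on the hull they do not exceed their maximum
  on \<open>T\<close>.\<close>

lemma width_convex_hull:
  assumes "finite T" "finite S" "S \<noteq> {}" "S \<subseteq> convex hull T"
  shows "width n S \<le> width n T"
  unfolding width_def
proof (rule rade_mono_on)
  fix y assume "y \<in> reach (noise n (map crd es)) 0"
  then have y: "linear y" by (rule reach_linear)
  have "y s \<le> Max (y ` T)" if "s \<in> S" for s
  proof -
    from that assms have "s \<in> convex hull T" by auto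
    then obtain w where w: "\<And>t. t \<in> T \<Longrightarrow> 0 \<le> w t" "sum w T = 1" "(\<Sum>t\<in>T. w t *\<^sub>R t) = s"
      using assms(1) by (auto simp: convex_hull_finite)
    have "y s = (\<Sum>t\<in>T. w t * y t)"
      using y by (simp add: w(3)[symmetric] linear_sum linear_cmul)
    also have "\<dots> \<le> (\<Sum>t\<in>T. w t * Max (y ` T))"
      using w assms(1) by (intro sum_mono mult_left_mono) auto
    also have "\<dots> = Max (y ` T)" using w by (simp flip: sum_distrib_right)
    finally show ?thesis .
  qed
  with assms show "Max (y ` S) \<le> Max (y ` T)" by auto
qed

lemma sum_noise_diff:
  assumes "n > 0"
  shows "(\<Sum>v\<leftarrow>noise n (map crd es). (c * (v s - v t))\<^sup>2) = c\<^sup>2 * (ds s t)\<^sup>2"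
proof -
  have "linear (\<lambda>v :: 'v \<Rightarrow> real. c * (v s - v t))"
    by (auto intro!: linearI simp: scaleR_fun_def algebra_simps)
  from sum_list_noise[OF this assms]
  have "(\<Sum>v\<leftarrow>noise n (map crd es). (c * (v s - v t))\<^sup>2) = (\<Sum>e\<leftarrow>es. c\<^sup>2 * (crd e s - crd e t)\<^sup>2)"
    by (simp only: map_map o_def power_mult_distrib)
  then show ?thesis by (simp only: ds_power2 sum_list_const_mult)
qed

text \<open>Replaces tail estimate and union bound in the chaining. An increment up to 3 s times
  \<open>ds u v\<close> is accepted; the excess is dominated by an exponential whose average is at
  most exp(-5 s^2 / 2) by \<open>increment_exp\<close>, small enough to add up over all
  links.\<close>

lemma increment_le:
  assumes y: "y \<in> reach (noise n (map crd es)) 0" and "s \<ge> 1"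
  shows "y u - y v \<le> s * ds u v * (3 + exp (s / ds u v * (y u - y v) - 3 * s\<^sup>2))"
proof (cases "ds u v = 0")
  case True
  with reach_ds_0[OF y] show ?thesis by simp
next
  case False
  then have d: "ds u v > 0" using ds_nonneg[of u v] by linarith
  define X where "X = (y u - y v) / ds u v"
  have "s * X - 3 * s\<^sup>2 \<le> exp (s * X - 3 * s\<^sup>2)" using exp_ge_add_one_self[of "s * X - 3 * s\<^sup>2"] by linarith
  also have "\<dots> \<le> s\<^sup>2 * exp (s * X - 3 * s\<^sup>2)" using assms(2) by (simp add: power2_eq_square mult_ge1_I)
  finally have "s * X \<le> s * (s * (3 + exp (s * X - 3 * s\<^sup>2)))"
    by (simp add: algebra_simps power2_eq_square)
  then have "X \<le> s * (3 + exp (s * X - 3 * s\<^sup>2))" using assms(2) by simp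
  then have "ds u v * X \<le> ds u v * (s * (3 + exp (s * X - 3 * s\<^sup>2)))"
    using d by (intro mult_left_mono) auto
  then show ?thesis using d by (simp add: X_def mult_ac)
qed

lemma increment_exp:
  assumes "n > 0" "s \<ge> 1"
  shows "rade (noise n (map crd es)) (\<lambda>y. exp (s / ds u v * (y u - y v) - 3 * s\<^sup>2)) 0 \<le> exp (- (5/2) * s\<^sup>2)"
proof -
  have lin: "linear (\<lambda>y :: 'v \<Rightarrow> real. c * (y u - y v))" for c
    by (auto intro!: linearI simp: scaleR_fun_def algebra_simps)
  have "(\<Sum>w\<leftarrow>noise n (map crd es). (s / ds u v * (w u - w v))\<^sup>2) \<le> s\<^sup>2"
    \<comment> \<open>For \<open>ds u v = 0\<close> the quotient \<open>s / ds u v\<close> is 0 by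
      convention.\<close>
    using assms unfolding sum_noise_diff[OF assms(1)] by (cases "ds u v = 0") (auto simp: power_divide)
  then have "rade (noise n (map crd es)) (\<lambda>y. exp (s / ds u v * (y u - y v))) 0 \<le> exp (s\<^sup>2 / 2)"
    by (intro order_trans[OF rade_exp[OF lin]]) simp
  from mult_left_mono[OF this, of "exp (- 3 * s\<^sup>2)"]
  have "exp (- 3 * s\<^sup>2) * rade (noise n (map crd es)) (\<lambda>y. exp (s / ds u v * (y u - y v))) 0
      \<le> exp (- (5/2) * s\<^sup>2)" by (simp add: exp_add[symmetric] algebra_simps)
  then show ?thesis by (simp add: rade_cmult[symmetric] exp_add[symmetric])
qed

text \<open>With s^2 = 2^(m+1), the average exp(-5 s^2 / 2) of one excess term beats the number
  2^(2^(m+2)) of links at level m. All excess terms together average at most 1, and 4 is 3 +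
  1.\<close>

lemma width_chaining:
  assumes T: "finite T" "T \<noteq> {}" and "n > 0"
    and \<pi>: "\<And>t. t \<in> T \<Longrightarrow> \<pi> 0 t = t0" "\<And>t. t \<in> T \<Longrightarrow> \<pi> N t = t"
    and card: "\<And>m. m < N \<Longrightarrow> card ((\<lambda>t. (\<pi> (Suc m) t, \<pi> m t)) ` T) \<le> 2 ^ 2 ^ (m + 2)"
    and \<gamma>: "\<And>t. t \<in> T \<Longrightarrow> (\<Sum>m<N. sqrt 2 ^ Suc m * ds (\<pi> (Suc m) t) (\<pi> m t)) \<le> \<gamma>"
  shows "width n T \<le> 4 * \<gamma>"
proof -
  define P where "P m = (\<lambda>t. (\<pi> (Suc m) t, \<pi> m t)) ` T" for m
  define s :: "nat \<Rightarrow> real" where "s m = sqrt 2 ^ Suc m" for m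
  define \<Theta> where "\<Theta> m p y = exp (s m / ds (fst p) (snd p) * (y (fst p) - y (snd p)) - 3 * (s m)\<^sup>2)"
    for m p and y :: "'v \<Rightarrow> real"
  let ?R = "rade (noise n (map crd es))"
  obtain t where "t \<in> T" using T by auto
  have "0 \<le> (\<Sum>m<N. sqrt 2 ^ Suc m * ds (\<pi> (Suc m) t) (\<pi> m t))" by (intro sum_nonneg) auto
  with \<gamma>[OF \<open>t \<in> T\<close>] have \<gamma>0: "0 \<le> \<gamma>" by linarith
  have s: "s m \<ge> 1" "(s m)\<^sup>2 = 2 ^ Suc m" for m
  proof -
    show "s m \<ge> 1" unfolding s_def by (intro one_le_power) auto
    have "(s m)\<^sup>2 = (sqrt 2 ^ 2) ^ Suc m" unfolding s_def by (simp only: power_mult[symmetric] mult.commute)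
    then show "(s m)\<^sup>2 = 2 ^ Suc m" by simp
  qed
  have "Max (y ` T) \<le> y t0 + \<gamma> * (3 + (\<Sum>m<N. \<Sum>p\<in>P m. \<Theta> m p y))"
    if y: "y \<in> reach (noise n (map crd es)) 0" for y
  proof -
    let ?E = "3 + (\<Sum>m<N. \<Sum>p\<in>P m. \<Theta> m p y)"
    have "0 \<le> ?E" unfolding \<Theta>_def by (intro add_nonneg_nonneg sum_nonneg) auto
    have "y t \<le> y t0 + \<gamma> * ?E" if t: "t \<in> T" for t
    proof -
      have "y t - y t0 = (\<Sum>m<N. y (\<pi> (Suc m) t) - y (\<pi> m t))"
        using \<pi>[OF t] by (simp add: sum_lessThan_telescope[of "\<lambda>m. y (\<pi> m t)"])
      also have "\<dots> \<le> (\<Sum>m<N. s m * ds (\<pi> (Suc m) t) (\<pi> m t) * ?E)"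
      proof (rule sum_mono)
        fix m assume m: "m \<in> {..<N}"
        let ?p = "(\<pi> (Suc m) t, \<pi> m t)"
        have p: "?p \<in> P m" using t by (auto simp: P_def)
        \<comment> \<open>The excess of one link is bounded by the sum over all links, which does
          not depend on \<open>t\<close>; this yields a common bound for the maximum over
          \<open>T\<close>.\<close>
        have "\<Theta> m ?p y \<le> (\<Sum>p\<in>P m. \<Theta> m p y)"
          using p T by (intro member_le_sum) (auto simp: \<Theta>_def P_def)
        also have "\<dots> \<le> (\<Sum>m<N. \<Sum>p\<in>P m. \<Theta> m p y)"
          by (rule member_le_sum[OF m]) (auto simp: \<Theta>_def intro!: sum_nonneg)
        finally have "s m * ds (\<pi> (Suc m) t) (\<pi> m t) * (3 + \<Theta> m ?p y)
            \<le> s m * ds (\<pi> (Suc m) t) (\<pi> m t) * ?E"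
          using s(1)[of m] by (intro mult_left_mono) auto
        then show "y (\<pi> (Suc m) t) - y (\<pi> m t) \<le> s m * ds (\<pi> (Suc m) t) (\<pi> m t) * ?E"
          using increment_le[OF y s(1)[of m], of "\<pi> (Suc m) t" "\<pi> m t"] by (simp add: \<Theta>_def)
      qed
      also have "\<dots> = (\<Sum>m<N. s m * ds (\<pi> (Suc m) t) (\<pi> m t)) * ?E"
        by (simp add: sum_distrib_right)
      also have "\<dots> \<le> \<gamma> * ?E"
        using \<gamma>[OF t] \<open>0 \<le> ?E\<close> unfolding s_def by (rule mult_right_mono)
      finally show ?thesis by simp
    qed
    then show ?thesis using T by auto
  qed
  then have "width n T \<le> ?R (\<lambda>y. y t0 + \<gamma> * (3 + (\<Sum>m<N. \<Sum>p\<in>P m. \<Theta> m p y))) 0"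
    unfolding width_def by (intro rade_mono_on)
  also have "\<dots> = \<gamma> * (3 + (\<Sum>m<N. \<Sum>p\<in>P m. ?R (\<Theta> m p) 0))"
    by (simp add: rade_add rade_cmult rade_sum)
  finally have le: "width n T \<le> \<gamma> * (3 + (\<Sum>m<N. \<Sum>p\<in>P m. ?R (\<Theta> m p) 0))" .
  have "(\<Sum>m<N. \<Sum>p\<in>P m. ?R (\<Theta> m p) 0) \<le> (\<Sum>m<N. (1 / 2) ^ Suc m)"
  proof (rule sum_mono)
    fix m assume m: "m \<in> {..<N}"
    let ?l = "2 ^ Suc m :: real"
    have "(\<Sum>p\<in>P m. ?R (\<Theta> m p) 0) \<le> (\<Sum>p\<in>P m. exp (- (5/2) * (s m)\<^sup>2))"
      unfolding \<Theta>_def using assms(3) s(1) by (intro sum_mono increment_exp)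
    also have "\<dots> = card (P m) * exp (- (5/2) * ?l)" by (simp add: s)
    also have "\<dots> \<le> exp (1.4 * ?l) * exp (- (5/2) * ?l)"
    proof (intro mult_right_mono)
      have "real (card (P m)) \<le> real (2 ^ 2 ^ (m + 2))"
        using card[of m] m unfolding P_def of_nat_le_iff by simp
      also have "\<dots> = exp (ln 2 * (2 * ?l))"
        by (simp add: powr_realpow[symmetric] powr_def mult.commute)
      also have "\<dots> \<le> exp (1.4 * ?l)"
        using mult_right_mono[OF ln2_le_25_over_36, of "2 * ?l"] by simp
      finally show "real (card (P m)) \<le> exp (1.4 * ?l)" .
    qed simp
    also have "\<dots> \<le> exp (- ?l)" by (simp flip: exp_add)
    also have "\<dots> \<le> (1 / 2) ^ Suc m"
    proof -
      have "?l \<le> exp ?l" using exp_ge_add_one_self[of ?l] by linarith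
      then have "inverse (exp ?l) \<le> inverse ?l" by (rule le_imp_inverse_le) simp
      then show ?thesis unfolding exp_minus power_one_over inverse_eq_divide .
    qed
    finally show "(\<Sum>p\<in>P m. ?R (\<Theta> m p) 0) \<le> (1 / 2) ^ Suc m" .
  qed
  also have "(\<Sum>m<N. (1 / 2 :: real) ^ Suc m) \<le> 1"
  proof -
    have "(\<Sum>m<N. (1 / 2 :: real) ^ Suc m) = 1 - (1 / 2) ^ N" by (induction N) auto
    then show ?thesis by simp
  qed
  finally have "\<gamma> * (3 + (\<Sum>m<N. \<Sum>p\<in>P m. ?R (\<Theta> m p) 0)) \<le> \<gamma> * (3 + 1)"
    using \<gamma>0 by (intro mult_left_mono add_left_mono)
  with le show ?thesis by (simp only: mult.commute) simp
qed

text \<open>The chain runs through representatives of the cells of \<open>t\<close>. Two consecutive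
  points of it lie in the cell of the coarser level \<open>m\<close>; using the weight sqrt 2 ^ Suc
  m in place of sqrt 2 ^ m costs a factor sqrt 2, and 4 sqrt 2 is at most 6.\<close>

lemma width_le_admissible:
  assumes T: "finite T" "T \<noteq> {}" and "n > 0" and A: "admissible T A"
    and \<gamma>: "\<And>t. t \<in> T \<Longrightarrow> (\<Sum>n. ennreal (2 powr (real n / 2)) * ediam ds (cell (A n) t)) \<le> ennreal \<gamma>"
    and "\<gamma> \<ge> 0"
  shows "width n T \<le> 6 * \<gamma>"
proof -
  note A' = A[unfolded admissible_def]
  define rep where "rep C = (SOME c :: 'v. c \<in> C)" for C
  have part: "partition_on T (A m)" for m using A' by blast
  have rep: "rep C \<in> C" if "C \<in> A m" for C m
    using that part[of m] unfolding rep_def by (metis ex_in_conv partition_onD3 someI)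
  have fin: "finite (A m)" and cd: "card (A m) \<le> 2 ^ 2 ^ m" for m
    using A' by (cases m; force intro: card_ge_0_finite)+
  have "card T < 2 ^ 2 ^ Suc (card T)"
    by (rule less_trans[OF lessI less_trans[OF less_exp less_exp]])
  then obtain N where N: "N \<ge> 1" "card T \<le> 2 ^ 2 ^ N" by (metis less_imp_le le_add1 plus_1_eq_Suc)
  \<comment> \<open>From level \<open>N\<close> on every point represents itself, so the chain ends
    at \<open>t\<close>; the count for level \<open>N\<close> still holds because
    \<open>card T \<le> 2 ^ 2 ^ N\<close>.\<close>
  define \<pi> where "\<pi> m t = (if m < N then rep (cell (A m) t) else t)" for m t
  have \<pi>_cell: "\<pi> m t \<in> cell (A m) t" if "t \<in> T" for m t
    using partition_on_cell[OF part that, of m] rep by (auto simp: \<pi>_def)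
  have cell_mono: "cell (A (Suc m)) t \<subseteq> cell (A m) t" if t: "t \<in> T" for m t
  proof -
    have "refines T (A (Suc m)) (A m)" using A' by blast
    then obtain Y where "Y \<in> A m" "cell (A (Suc m)) t \<subseteq> Y"
      using partition_on_cell[OF part t, of "Suc m"] unfolding refines_def by blast
    then show ?thesis using partition_on_cell[OF part t, of "Suc m"] cell_eqI[OF part, of Y m t] by auto
  qed
  have "width n T \<le> 4 * (sqrt 2 * \<gamma>)"
  proof (rule width_chaining[OF T \<open>n > 0\<close>])
    show "\<pi> 0 t = rep T" if "t \<in> T" for t
      using N that partition_on_cell[OF part that, of 0] by (simp add: \<pi>_def admissible_0[OF A])
    show "\<pi> N t = t" for t by (simp add: \<pi>_def)
    show "card ((\<lambda>t. (\<pi> (Suc m) t, \<pi> m t)) ` T) \<le> 2 ^ 2 ^ (m + 2)" if "m < N" for m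
    proof -
      have img: "\<pi> m ` T \<subseteq> rep ` A m" if "m < N" for m
        using that partition_on_cell(1)[OF part] by (auto simp: \<pi>_def)
      have ci: "card (\<pi> m ` T) \<le> 2 ^ 2 ^ m" if "m \<le> N" for m
      proof (cases "m < N")
        case True
        then have "card (\<pi> m ` T) \<le> card (rep ` A m)" by (intro card_mono finite_imageI fin img)
        also have "\<dots> \<le> card (A m)" by (rule card_image_le[OF fin])
        finally show ?thesis using cd[of m] by simp
      next
        case False
        then have "\<pi> m ` T = T" "m = N" using that by (auto simp: \<pi>_def)
        then show ?thesis using N by simp
      qed
      have "card ((\<lambda>t. (\<pi> (Suc m) t, \<pi> m t)) ` T) \<le> card (\<pi> (Suc m) ` T \<times> \<pi> m ` T)"
        using T by (intro card_mono) auto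
      also have "\<dots> \<le> 2 ^ 2 ^ Suc m * 2 ^ 2 ^ m"
        unfolding card_cartesian_product using that by (intro mult_mono ci) auto
      also have "\<dots> \<le> 2 ^ 2 ^ (m + 2)"
        by (simp flip: power_add)
      finally show ?thesis .
    qed
    show "(\<Sum>m<N. sqrt 2 ^ Suc m * ds (\<pi> (Suc m) t) (\<pi> m t)) \<le> sqrt 2 * \<gamma>" if t: "t \<in> T" for t
    proof -
      have "ennreal (\<Sum>m<N. sqrt 2 ^ m * ds (\<pi> (Suc m) t) (\<pi> m t))
          = (\<Sum>m<N. ennreal (2 powr (real m / 2)) * ennreal (ds (\<pi> (Suc m) t) (\<pi> m t)))"
        by (simp add: two_powr_half ennreal_mult sum_ennreal[symmetric])
      also have "\<dots> \<le> (\<Sum>m<N. ennreal (2 powr (real m / 2)) * ediam ds (cell (A m) t))"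
        by (intro sum_mono mult_left_mono le_ediam) (use \<pi>_cell[OF t] cell_mono[OF t] in auto)
      also have "\<dots> \<le> (\<Sum>m. ennreal (2 powr (real m / 2)) * ediam ds (cell (A m) t))"
        by (rule sum_le_suminf) auto
      also have "\<dots> \<le> ennreal \<gamma>" by (rule \<gamma>[OF t])
      finally have "(\<Sum>m<N. sqrt 2 ^ m * ds (\<pi> (Suc m) t) (\<pi> m t)) \<le> \<gamma>"
        using \<open>\<gamma> \<ge> 0\<close> by (simp add: ennreal_le_iff)
      then show ?thesis by (simp add: sum_distrib_left[symmetric] mult.assoc)
    qed
  qed
  also have "\<dots> \<le> 6 * \<gamma>"
  proof -
    have "sqrt 2 \<le> 3 / 2" by (rule real_le_lsqrt) (auto simp: power2_eq_square)
    from mult_right_mono[OF this \<open>\<gamma> \<ge> 0\<close>] show ?thesis by (simp add: mult.commute)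
  qed
  finally show ?thesis .
qed

end

section \<open>Growth of the width\<close>

lemma Max_add_const:
  "finite S \<Longrightarrow> S \<noteq> {} \<Longrightarrow> Max ((\<lambda>t. f t + c) ` S) = Max (f ` S) + (c::real)"
  using Max_add_commute by blast

lemma rade_zero_vectors: "(\<And>v. v \<in> set vs \<Longrightarrow> v = 0) \<Longrightarrow> rade vs \<phi> y = \<phi> y"
proof (induction vs arbitrary: y)
  case (Cons v vs)
  have "v = 0" by (rule Cons.prems) simp
  moreover have "rade vs \<phi> y = \<phi> y" by (rule Cons.IH) (simp add: Cons.prems)
  ultimately show ?case by simp
qed simp

lemma noise_zero_vectors: "(\<And>v. v \<in> set vs \<Longrightarrow> v = 0) \<Longrightarrow> v \<in> set (noise n vs) \<Longrightarrow> v = 0"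
  by (auto simp: noise_def split: if_splits)

definition sign :: "nat set \<Rightarrow> nat \<Rightarrow> real" where
  "sign A j = (if j \<in> A then 1 else - 1)"

context coords
begin

text \<open>The process \<open>b \<langle>sign A, g\<rangle> + \<langle>t - \<tau> A, G\<^sub>A\<rangle>\<close> on pairs \<open>(A, t)\<close>, with independent \<open>g\<close> and \<open>G\<^sub>A\<close>: the
  cube term needs only a lower bound on \<open>E \<bar>g\<^sub>j\<bar>\<close>, not on the maximum of independent Gaussians.\<close>

definition signs_part :: "real \<Rightarrow> nat \<Rightarrow> (nat set \<times> 'v \<Rightarrow> real) list" where
  "signs_part b k = map (\<lambda>j p. b * sign (fst p) j) [0..<k]"

definition copy_part :: "(nat set \<Rightarrow> 'v) \<Rightarrow> nat set \<Rightarrow> (nat set \<times> 'v \<Rightarrow> real) list" where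
  "copy_part \<tau> A = map (\<lambda>e p. if fst p = A then crd e (snd p) - crd e (\<tau> A) else 0) es"

text \<open>\<open>\<phi>\<close> will be the average over the copies for a given cube part. The
  maximum over all sign vectors turns the cube part into b times the sum of the |g_j|, and
  \<open>rade_abs\<close> with s = 1 gives 1 / sqrt 3 for each of them.\<close>

lemma signs_part_max:
  assumes "n > 0" "b \<ge> 0"
    and \<phi>: "\<And>y. (\<And>A t t'. y (A, t) = y (A, t')) \<Longrightarrow> \<phi> y \<ge> c + Max ((\<lambda>A. y (A, t0)) ` Pow {..<k})"
  shows "c + b * real k / sqrt 3 \<le> rade (noise n (signs_part b k)) \<phi> 0"
proof -
  define L where "L w = (\<lambda>p :: nat set \<times> 'v. b * (\<Sum>j<k. sign (fst p) j * w j))" for w :: "nat \<Rightarrow> real"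
  define us where "us = map (\<lambda>j i. if i = j then 1 else 0 :: real) [0..<k]"
  have lin: "linear L"
    by (auto intro!: linearI simp: L_def scaleR_fun_def fun_eq_iff algebra_simps sum.distrib sum_distrib_left)
  have sp: "signs_part b k = map L us"
    by (auto simp: signs_part_def us_def L_def fun_eq_iff sum.delta if_distrib cong: if_cong)
  have L0: "L 0 = 0" using lin by (rule linear_0)
  have "c + b * real k / sqrt 3 \<le> c + b * (\<Sum>j<k. rade (noise n us) (\<lambda>w. \<bar>w j\<bar>) 0)"
  proof -
    have "sqrt (1 / 3) \<le> rade (noise n us) (\<lambda>w. \<bar>w j\<bar>) 0" if "j < k" for j
    proof (rule rade_abs[OF linear_eval])
      have "(\<Sum>v\<leftarrow>us. (v j)\<^sup>2) = (\<Sum>i\<in>{0..<k}. (if j = i then 1 else 0)\<^sup>2)"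
        unfolding us_def map_map o_def by (subst sum_list_distinct_conv_sum_set) auto
      also have "\<dots> = (\<Sum>i\<in>{0..<k}. if j = i then 1 else 0)" by (intro sum.cong) auto
      also have "\<dots> = 1" using that by simp
      finally show "(\<Sum>v\<leftarrow>noise n us. (v j)\<^sup>2) = 1"
        using sum_list_noise[OF linear_eval assms(1)] by metis
    qed
    then have "(\<Sum>j<k. sqrt (1 / 3)) \<le> (\<Sum>j<k. rade (noise n us) (\<lambda>w. \<bar>w j\<bar>) 0)"
      by (intro sum_mono) auto
    from mult_left_mono[OF this \<open>b \<ge> 0\<close>] show ?thesis by (simp add: real_sqrt_divide)
  qed
  also have "\<dots> = rade (noise n us) (\<lambda>w. c + b * (\<Sum>j<k. \<bar>w j\<bar>)) 0"
    by (simp only: rade_add rade_cmult rade_sum rade_const)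
  also have "\<dots> \<le> rade (noise n us) (\<lambda>w. \<phi> (L w)) 0"
  proof (rule rade_mono)
    fix w :: "nat \<Rightarrow> real"
    let ?A = "{j. j < k \<and> w j \<ge> 0}"
    have "b * (\<Sum>j<k. \<bar>w j\<bar>) = L w (?A, t0)"
      unfolding L_def by (intro arg_cong2[where f = "(*)"] refl sum.cong) (auto simp: sign_def)
    also have "\<dots> \<le> Max ((\<lambda>A. L w (A, t0)) ` Pow {..<k})" by (intro Max_ge) auto
    finally have "c + b * (\<Sum>j<k. \<bar>w j\<bar>) \<le> c + Max ((\<lambda>A. L w (A, t0)) ` Pow {..<k})" by simp
    also have "\<dots> \<le> \<phi> (L w)" by (rule \<phi>) (simp add: L_def)
    finally show "c + b * (\<Sum>j<k. \<bar>w j\<bar>) \<le> \<phi> (L w)" .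
  qed
  also have "\<dots> = rade (noise n (signs_part b k)) \<phi> 0"
    unfolding sp map_noise[OF lin, symmetric] rade_map[OF lin, of _ _ 0, unfolded L0] ..
  finally show ?thesis .
qed

text \<open>Only pairs with first component \<open>A\<close> are kept. On these the other copies
  vanish, and copy \<open>A\<close> contributes \<open>width n (S A)\<close>, since subtracting the
  value at \<open>\<tau> A\<close> does not change the average. In the application \<open>A\<close>
  is the sign vector that maximizes the cube part.\<close>

lemma copy_part_max:
  assumes "n > 0" and As: "set As = Pow {..<k}" "distinct As" and A: "A \<in> Pow {..<k}"
    and S: "\<And>A. A \<in> Pow {..<k} \<Longrightarrow> finite (S A) \<and> S A \<noteq> {}"
    and y: "\<And>t t'. y (A, t) = y (A, t')"
  shows "y (A, t0) + width n (S A)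
    \<le> rade (noise n (concat (map (copy_part \<tau>) As))) (\<lambda>z. Max (z ` Sigma (Pow {..<k}) S)) y"
proof -
  from A As obtain pre post where pp: "As = pre @ A # post" by (metis split_list)
  have nA: "A' \<noteq> A" if "A' \<in> set pre \<union> set post" for A' using that As(2) pp by auto
  define L where "L z = (\<lambda>t. z (A, t))" for z :: "nat set \<times> 'v \<Rightarrow> real"
  define M where "M w = (\<lambda>t. w t - w (\<tau> A))" for w :: "'v \<Rightarrow> real"
  define \<phi> where "\<phi> w = Max (w ` S A)" for w :: "'v \<Rightarrow> real"
  have lin: "linear L" "linear M"
    by (auto intro!: linearI simp: L_def M_def scaleR_fun_def fun_eq_iff algebra_simps)
  have z: "rade (noise n (map L (concat (map (copy_part \<tau>) Bs)))) \<psi> w = \<psi> w"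
    if "set Bs \<subseteq> set pre \<union> set post" for Bs \<psi> w
  proof (rule rade_zero_vectors, erule noise_zero_vectors[rotated])
    fix v assume "v \<in> set (map L (concat (map (copy_part \<tau>) Bs)))"
    then obtain A' e where "A' \<in> set Bs" "v = L (\<lambda>p. if fst p = A' then crd e (snd p) - crd e (\<tau> A') else 0)"
      by (auto simp: copy_part_def)
    then show "v = 0" using nA[of A'] that by (auto simp: L_def fun_eq_iff)
  qed
  have LA: "map L (copy_part \<tau> A) = map M (map crd es)"
    by (auto simp: L_def M_def copy_part_def fun_eq_iff)
  have Ly: "L y = (\<lambda>t. y (A, t0))" using y by (auto simp: L_def)
  have MR: "Max ((M u + L y) ` S A) = Max (u ` S A) + (y (A, t0) - u (\<tau> A))" for u
  proof -
    have "(M u + L y) ` S A = (\<lambda>t. u t + (y (A, t0) - u (\<tau> A))) ` S A"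
      by (intro image_cong) (auto simp: M_def Ly)
    then show ?thesis using S[OF A] by (simp add: Max_add_const)
  qed
  have "y (A, t0) + width n (S A) = rade (noise n (map crd es)) (\<lambda>u. Max (u ` S A) + (y (A, t0) - u (\<tau> A))) 0"
    unfolding rade_add rade_diff by (simp add: width_def)
  also have "\<dots> = rade (noise n (map crd es)) (\<lambda>u. \<phi> (M u + L y)) 0"
    by (simp only: MR \<phi>_def)
  also have "\<dots> = rade (noise n (map M (map crd es))) \<phi> (M 0 + L y)"
    unfolding map_noise[OF lin(2), symmetric] rade_shift rade_map[OF lin(2)] ..
  also have "M 0 + L y = L y" using linear_0[OF lin(2)] by simp
  also have "rade (noise n (map M (map crd es))) \<phi> (L y)
      = rade (noise n (map L (concat (map (copy_part \<tau>) As)))) \<phi> (L y)"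
  proof -
    let ?m = "\<lambda>Bs. noise n (map L (concat (map (copy_part \<tau>) Bs)))"
    have e: "map L (concat (map (copy_part \<tau>) As)) = map L (concat (map (copy_part \<tau>) pre)) @
        map M (map crd es) @ map L (concat (map (copy_part \<tau>) post))"
      unfolding pp by (simp only: map_append concat_append list.map concat.simps LA)
    have "rade (?m post) \<phi> = \<phi>" by (rule ext) (rule z, simp)
    then show ?thesis unfolding e rade_noise_append by (subst z) simp_all
  qed
  also have "\<dots> = rade (noise n (concat (map (copy_part \<tau>) As))) (\<lambda>z. \<phi> (L z)) y"
    unfolding map_noise[OF lin(1), symmetric] rade_map[OF lin(1)] ..
  also have "\<dots> \<le> rade (noise n (concat (map (copy_part \<tau>) As))) (\<lambda>z. Max (z ` Sigma (Pow {..<k}) S)) y"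
  proof (rule rade_mono)
    fix z
    show "\<phi> (L z) \<le> Max (z ` Sigma (Pow {..<k}) S)"
      unfolding \<phi>_def L_def using S A by (intro Max_mono) (auto intro!: finite_SigmaI)
  qed
  finally show ?thesis .
qed

text \<open>Increments between different clusters: the comparison process has squared increment at
  most 4 b^2 k + 2 (a / 8)^2 = 17/32 a^2, while the squared distance is at least (a - 2 a / 8)^2 =
  18/32 a^2. Within one cluster the cube part cancels and both sides agree.\<close>

lemma width_growth:
  fixes k :: nat and \<tau> :: "nat set \<Rightarrow> 'v"
  assumes k: "k \<ge> 1" and a: "a > 0" and "\<epsilon> > 0"
    and sep: "\<And>A B. A \<subseteq> {..<k} \<Longrightarrow> B \<subseteq> {..<k} \<Longrightarrow> A \<noteq> B \<Longrightarrow> a \<le> ds (\<tau> A) (\<tau> B)"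
    and S: "\<And>A. A \<subseteq> {..<k} \<Longrightarrow> finite (S A) \<and> S A \<noteq> {}"
    and near: "\<And>A t. A \<subseteq> {..<k} \<Longrightarrow> t \<in> S A \<Longrightarrow> ds t (\<tau> A) \<le> a / 8"
    and c: "\<And>A. A \<subseteq> {..<k} \<Longrightarrow> \<forall>\<^sub>F n in sequentially. c \<le> width n (S A)"
  shows "\<forall>\<^sub>F n in sequentially. a * sqrt k / 5 + c - \<epsilon> \<le> width n (\<Union>A\<in>Pow {..<k}. S A)"
proof -
  \<comment> \<open>Chosen so that \<open>b\<^sup>2 * real k = a\<^sup>2 / 8\<close>; the gain b k /
    sqrt 3 then equals a sqrt k / sqrt 24, which is at least a sqrt k / 5.\<close>
  define b where "b = a / (sqrt 8 * sqrt k)"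
  define I where "I = Sigma (Pow {..<k}) S"
  obtain As where As: "set As = Pow {..<k}" "distinct As"
    using finite_distinct_list[of "Pow {..<k}"] by auto
  let ?copies = "concat (map (copy_part \<tau>) As)"
  define us where "us = signs_part b k @ ?copies"
  define L where "L y = (\<lambda>p :: nat set \<times> 'v. y (snd p))" for y :: "'v \<Rightarrow> real"
  have linL: "linear L" by (auto intro!: linearI simp: L_def scaleR_fun_def fun_eq_iff)
  have b: "b > 0" "b\<^sup>2 * real k = a\<^sup>2 / 8" using a k by (auto simp: b_def power_divide power_mult_distrib)
  have I: "finite I" "I \<noteq> {}" using S unfolding I_def by (auto intro!: finite_SigmaI)
  have "(\<Sum>v\<leftarrow>us. (v p - v q)\<^sup>2) \<le> (\<Sum>v\<leftarrow>map L (map crd es). (v p - v q)\<^sup>2)" if pq: "p \<in> I" "q \<in> I" for p q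
  proof -
    obtain A t B t' where [simp]: "p = (A, t)" "q = (B, t')" by (cases p, cases q)
    from pq have AB: "A \<subseteq> {..<k}" "t \<in> S A" "B \<subseteq> {..<k}" "t' \<in> S B" by (auto simp: I_def)
    have r: "(\<Sum>v\<leftarrow>map L (map crd es). (v p - v q)\<^sup>2) = (ds t t')\<^sup>2"
      by (simp add: ds_power2 o_def L_def)
    have l1: "(\<Sum>v\<leftarrow>signs_part b k. (v p - v q)\<^sup>2) = (\<Sum>j<k. b\<^sup>2 * (sign A j - sign B j)\<^sup>2)"
      by (simp add: signs_part_def o_def sum_list_distinct_conv_sum_set atLeast0LessThan
          power_mult_distrib flip: right_diff_distrib)
    have cp: "(\<Sum>v\<leftarrow>copy_part \<tau> C. (v p - v q)\<^sup>2)
        = (if C = A \<and> C = B then (ds t t')\<^sup>2 else if C = A then (ds t (\<tau> A))\<^sup>2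
           else if C = B then (ds t' (\<tau> B))\<^sup>2 else 0)" for C
      by (auto simp: copy_part_def o_def ds_power2)
    have "(\<Sum>v\<leftarrow>?copies. (v p - v q)\<^sup>2) = (\<Sum>C\<leftarrow>As. \<Sum>v\<leftarrow>copy_part \<tau> C. (v p - v q)\<^sup>2)"
      by (induction As) auto
    then have l2: "(\<Sum>v\<leftarrow>?copies. (v p - v q)\<^sup>2) = (\<Sum>C\<in>Pow {..<k}. \<Sum>v\<leftarrow>copy_part \<tau> C. (v p - v q)\<^sup>2)"
      using As by (simp add: sum_list_distinct_conv_sum_set)
    show ?thesis
    proof (cases "A = B")
      case True
      have "(\<Sum>v\<leftarrow>?copies. (v p - v q)\<^sup>2) = (\<Sum>C\<in>Pow {..<k}. if C = A then (ds t t')\<^sup>2 else 0)"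
        unfolding l2 cp using True by (intro sum.cong) auto
      also have "\<dots> = (ds t t')\<^sup>2" using AB by (subst sum.delta) auto
      finally show ?thesis unfolding r us_def using l1 True by simp
    next
      case False
      have "(\<Sum>v\<leftarrow>?copies. (v p - v q)\<^sup>2)
          = (\<Sum>C\<in>Pow {..<k}. (if C = A then (ds t (\<tau> A))\<^sup>2 else 0) + (if C = B then (ds t' (\<tau> B))\<^sup>2 else 0))"
        unfolding l2 cp using False by (intro sum.cong) auto
      also have "\<dots> = (ds t (\<tau> A))\<^sup>2 + (ds t' (\<tau> B))\<^sup>2"
        using AB unfolding sum.distrib by (simp add: sum.delta)
      also have "\<dots> \<le> (a / 8)\<^sup>2 + (a / 8)\<^sup>2"
        using AB by (intro add_mono power_mono near) auto
      finally have c2: "(\<Sum>v\<leftarrow>?copies. (v p - v q)\<^sup>2) \<le> a\<^sup>2 / 32" by (simp add: power_divide)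
      have "(\<Sum>j<k. b\<^sup>2 * (sign A j - sign B j)\<^sup>2) \<le> (\<Sum>j<k. b\<^sup>2 * 4)"
        by (intro sum_mono mult_left_mono) (auto simp: sign_def)
      also have "\<dots> = a\<^sup>2 / 2" using b by (simp add: algebra_simps)
      finally have c1: "(\<Sum>v\<leftarrow>signs_part b k. (v p - v q)\<^sup>2) \<le> a\<^sup>2 / 2" using l1 by simp
      have "a \<le> ds (\<tau> A) t + ds t t' + ds t' (\<tau> B)"
        using sep[OF AB(1,3) False] ds_triangle[of "\<tau> A" "\<tau> B" t] ds_triangle[of t "\<tau> B" t'] by linarith
      then have "3 / 4 * a \<le> ds t t'" using near[OF AB(1,2)] near[OF AB(3,4)] ds_commute[of t "\<tau> A"] by simp
      then have "(3 / 4 * a)\<^sup>2 \<le> (ds t t')\<^sup>2" using a by (intro power_mono) auto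
      moreover have "(3 / 4 * a)\<^sup>2 = 9 / 16 * a\<^sup>2" by (simp add: power_mult_distrib power_divide)
      moreover have "(\<Sum>v\<leftarrow>us. (v p - v q)\<^sup>2)
          = (\<Sum>v\<leftarrow>signs_part b k. (v p - v q)\<^sup>2) + (\<Sum>v\<leftarrow>?copies. (v p - v q)\<^sup>2)"
        by (simp add: us_def)
      moreover have "0 \<le> a\<^sup>2" by simp
      ultimately show ?thesis unfolding r using c1 c2 by argo
    qed
  qed
  from max_comparison[OF I this \<open>\<epsilon> > 0\<close>]
  have "\<forall>\<^sub>F n in sequentially. rade (noise n us) (\<lambda>y. Max (y ` I)) 0
      \<le> rade (noise n (map L (map crd es))) (\<lambda>y. Max (y ` I)) 0 + \<epsilon>" .
  moreover have "\<forall>\<^sub>F n in sequentially. \<forall>A\<in>Pow {..<k}. c \<le> width n (S A)"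
    using c by (intro eventually_ball_finite) auto
  ultimately show ?thesis using eventually_gt_at_top[of 0]
  proof eventually_elim
    case (elim n)
    have "a * sqrt k / 5 \<le> b * real k / sqrt 3"
    proof -
      have "b * real k / sqrt 3 = b * (sqrt k * sqrt k) / sqrt 3" by simp
      also have "\<dots> = a * sqrt k / (sqrt 8 * sqrt 3)"
        unfolding b_def using k by (simp del: real_sqrt_mult_self)
      also have "sqrt 8 * sqrt 3 = sqrt 24" by (simp flip: real_sqrt_mult)
      finally have "b * real k / sqrt 3 = a * sqrt k / sqrt 24" .
      moreover have "sqrt 24 \<le> 5" by (rule real_le_lsqrt) auto
      ultimately show ?thesis using a by (simp only:) (rule divide_left_mono, auto)
    qed
    moreover have "c + b * real k / sqrt 3 \<le> rade (noise n us) (\<lambda>y. Max (y ` I)) 0"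
      unfolding us_def rade_noise_append
    proof (rule signs_part_max[where ?t0.0 = undefined])
      fix y :: "nat set \<times> 'v \<Rightarrow> real" assume y: "\<And>A t t'. y (A, t) = y (A, t')"
      let ?M = "Max ((\<lambda>A. y (A, undefined)) ` Pow {..<k})"
      have "?M \<in> (\<lambda>A. y (A, undefined)) ` Pow {..<k}" by (intro Max_in) auto
      then obtain A where A: "A \<in> Pow {..<k}" "?M = y (A, undefined)" by auto
      have "c \<le> width n (S A)" using elim(2) A(1) by blast
      then have "c + ?M \<le> y (A, undefined) + width n (S A)" unfolding A(2) by simp
      also have "\<dots> \<le> rade (noise n ?copies) (\<lambda>y. Max (y ` I)) y"
        unfolding I_def using elim S A by (intro copy_part_max As y) auto
      finally show "c + ?M \<le> rade (noise n ?copies) (\<lambda>y. Max (y ` I)) y" .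
    qed (use elim(3) b(1) in simp_all)
    moreover have "rade (noise n (map L (map crd es))) (\<lambda>y. Max (y ` I)) 0 = width n (\<Union>A\<in>Pow {..<k}. S A)"
    proof -
      have "snd ` I = (\<Union>A\<in>Pow {..<k}. S A)" unfolding I_def by (rule snd_image_Sigma)
      then have "L y ` I = y ` (\<Union>A\<in>Pow {..<k}. S A)" for y unfolding L_def by (metis image_image)
      moreover have "rade (noise n (map L (map crd es))) (\<lambda>y. Max (y ` I)) (L 0)
          = rade (noise n (map crd es)) (\<lambda>y. Max (L y ` I)) 0"
        unfolding map_noise[OF linL, symmetric] rade_map[OF linL] ..
      ultimately show ?thesis using linear_0[OF linL] by (simp only: width_def)
    qed
    ultimately show ?case using elim(1) by argo
  qed
qed

end

section \<open>Partitions from a functional with growth\<close>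

lemma sqrt2_bounds: "4 / 3 \<le> sqrt 2" "sqrt 2 \<le> 3 / 2"
proof -
  show "4 / 3 \<le> sqrt 2" by (rule real_le_rsqrt) (simp add: power2_eq_square)
  show "sqrt 2 \<le> 3 / 2" by (rule real_le_lsqrt) (simp_all add: power2_eq_square)
qed

lemma sum_sqrt2_powers: "(\<Sum>n\<le>m. sqrt 2 ^ n) \<le> 4 * sqrt 2 ^ m"
proof (induction m)
  case (Suc m)
  have "(4 + sqrt 2) * sqrt 2 ^ m \<le> (4 * sqrt 2) * sqrt 2 ^ m"
    using sqrt2_bounds by (intro mult_right_mono) auto
  then have "4 * sqrt 2 ^ m + sqrt 2 * sqrt 2 ^ m \<le> 4 * (sqrt 2 * sqrt 2 ^ m)"
    by (simp only: distrib_right mult.assoc)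
  with Suc show ?case unfolding sum.atMost_Suc power_Suc by linarith
qed simp

lemma sum_second_difference:
  "(\<Sum>j\<le>J. g j - g (j + 2)) = g 0 + g 1 - g (J + 1) - g (J + 2)" for g :: "nat \<Rightarrow> real"
  by (induction J) (auto simp: eval_nat_numeral)

text \<open>Steps that increase the label shrink the summand by \<open>sqrt 2 / 8\<close>, so only the steps that keep it
  matter; within one label these form a geometric sum, and the last one is paid for by the drop of
  \<open>f\<close> over the next two labels.\<close>

lemma label_sum_bound:
  fixes k :: "nat \<Rightarrow> nat" and f :: "nat \<Rightarrow> real"
  assumes c: "c > 0" and k0: "k 0 = 0"
    and step: "\<And>n. k (Suc n) = k n \<or> k (Suc n) = Suc (k n)"
    and f0: "\<And>n. 0 \<le> f n" and fdec: "\<And>n. f (Suc n) \<le> f n"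
    and stay: "\<And>n. k (Suc n) = k n \<Longrightarrow> c * (sqrt 2 ^ n / 8 ^ k n) \<le> f n"
    and drop: "\<And>n p. k (Suc n) = k n \<Longrightarrow> n < p \<Longrightarrow> k p = Suc (k n) \<Longrightarrow> k (Suc p) = Suc (Suc (k n))
      \<Longrightarrow> f (Suc p) + c * (sqrt 2 ^ n / 8 ^ k n) \<le> f n"
  shows "(\<Sum>n<N. sqrt 2 ^ n / 8 ^ k n) \<le> 2 + 16 * f 0 / c"
proof -
  define a where "a n = sqrt 2 ^ n / 8 ^ k n" for n
  have a0: "0 \<le> a n" for n by (simp add: a_def)
  have kmono: "mono k" using step by (intro mono_iff_le_Suc[THEN iffD2]) (metis le_SucI order_refl)
  have fmono: "f n \<le> f m" if "m \<le> n" for m n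
    using that fdec by (rule lift_Suc_antimono_le[rotated])
  define St where "St j = {n. n < N \<and> k (Suc n) = k n \<and> k n = j}" for j
  \<comment> \<open>The value of \<open>f\<close> at the first time the label is at least
    \<open>j\<close>, and 0 if this does not happen up to \<open>N\<close>. The drop over two labels
    becomes \<open>g j - g (j + 2)\<close>, which telescopes.\<close>
  define g where "g j = (if j \<le> k N then f (LEAST n. j \<le> k n) else 0)" for j
  have g0: "0 \<le> g j" "g j \<le> f 0" for j using f0 fmono by (auto simp: g_def)
  have level: "c * (\<Sum>n\<in>St j. a n) \<le> 4 * (g j - g (j + 2))" if "j \<le> k N" for j
  proof (cases "St j = {}")
    case True
    have "g (j + 2) \<le> g j"
    proof (cases "j + 2 \<le> k N")
      case True
      have "(LEAST n. j \<le> k n) \<le> (LEAST n. j + 2 \<le> k n)"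
        using LeastI[of "\<lambda>n. j + 2 \<le> k n", OF True] by (intro Least_le) simp
      then show ?thesis using True fmono by (simp add: g_def)
    next
      case False
      then have "g (j + 2) = 0" by (simp add: g_def)
      then show ?thesis using g0(1)[of j] by simp
    qed
    then show ?thesis using True by simp
  next
    case False
    have fin: "finite (St j)" by (simp add: St_def)
    define m where "m = Max (St j)"
    have "m \<in> St j" unfolding m_def using fin False by (rule Max_in)
    then have m: "m < N" "k (Suc m) = k m" "k m = j" by (auto simp: St_def)
    have "(\<Sum>n\<in>St j. a n) = (\<Sum>n\<in>St j. sqrt 2 ^ n) / 8 ^ j"
      unfolding sum_divide_distrib by (intro sum.cong) (auto simp: a_def St_def)
    also have "\<dots> \<le> (\<Sum>n\<le>m. sqrt 2 ^ n) / 8 ^ j"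
      using fin by (intro divide_right_mono sum_mono2) (auto simp: m_def)
    also have "\<dots> \<le> 4 * a m"
      using sum_sqrt2_powers[of m] by (simp add: a_def m divide_right_mono)
    finally have "c * (\<Sum>n\<in>St j. a n) \<le> c * (4 * a m)" using c by (intro mult_left_mono) auto
    moreover have "c * a m \<le> g j - g (j + 2)"
    proof -
      have "(LEAST n. j \<le> k n) \<le> m" using m by (intro Least_le) simp
      then have gj: "f m \<le> g j" using that fmono by (simp add: g_def)
      show ?thesis
      proof (cases "j + 2 \<le> k N")
        case True
        define q where "q = (LEAST n. j + 2 \<le> k n)"
        have q: "j + 2 \<le> k q" unfolding q_def using True by (rule LeastI)
        have "q \<noteq> 0" using q k0 by (intro notI) simp
        then obtain p where p: "q = Suc p" by (cases q) auto
        have "\<not> j + 2 \<le> k p" using not_less_Least[of p "\<lambda>n. j + 2 \<le> k n"] p by (auto simp: q_def)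
        then have kp: "k p = Suc j" "k (Suc p) = Suc (Suc j)" using q step[of p] p by auto
        have "m < p"
        proof (rule ccontr)
          assume "\<not> m < p"
          then have "k p \<le> k m" using kmono by (simp add: monoD)
          then show False using kp m by simp
        qed
        from drop[OF m(2) this] kp m have "f q + c * a m \<le> f m" by (simp add: p a_def)
        moreover have "g (j + 2) = f q" using True by (simp add: g_def q_def)
        ultimately show ?thesis using gj by simp
      next
        case False
        then have "g (j + 2) = 0" by (simp add: g_def)
        then show ?thesis using gj stay[OF m(2)] by (simp add: a_def)
      qed
    qed
    ultimately show ?thesis by (simp add: algebra_simps)
  qed
  have "c * (\<Sum>n\<in>{n. n < N \<and> k (Suc n) = k n}. a n) = c * (\<Sum>j\<le>k N. \<Sum>n\<in>St j. a n)"
  proof -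
    have "(\<Sum>j\<in>{..k N}. sum a {n \<in> {n. n < N \<and> k (Suc n) = k n}. k n = j}) = sum a {n. n < N \<and> k (Suc n) = k n}"
      by (intro sum.group) (auto intro: monoD[OF kmono])
    moreover have "St j = {n \<in> {n. n < N \<and> k (Suc n) = k n}. k n = j}" for j by (auto simp: St_def)
    ultimately show ?thesis by simp
  qed
  also have "\<dots> \<le> (\<Sum>j\<le>k N. 4 * (g j - g (j + 2)))"
    by (subst sum_distrib_left) (intro sum_mono level, simp)
  also have "\<dots> = 4 * (g 0 + g 1 - g (k N + 1) - g (k N + 2))"
    by (simp only: sum_distrib_left[symmetric] sum_second_difference)
  also have "\<dots> \<le> 8 * f 0" using g0[of 0] g0[of 1] g0[of "k N + 1"] g0[of "k N + 2"] by simp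
  finally have stays: "(\<Sum>n\<in>{n. n < N \<and> k (Suc n) = k n}. a n) \<le> 8 * f 0 / c"
    using c by (simp add: field_simps)
  \<comment> \<open>3/16 bounds sqrt 2 / 8, the ratio when the label grows; when it stays, the ratio
    sqrt 2 is at most 3/16 + 21/16.\<close>
  have next_le: "a (Suc n) \<le> (3 / 16) * a n + (if k (Suc n) = k n then (21 / 16) * a n else 0)" for n
    using mult_right_mono[OF sqrt2_bounds(2) a0[of n]] step[of n]
    by (auto simp: a_def field_simps)
  have "(\<Sum>n<N. a n) \<le> (\<Sum>n<Suc N. a n)" using a0[of N] by simp
  also have "\<dots> = 1 + (\<Sum>n<N. a (Suc n))"
    by (subst sum.lessThan_Suc_shift) (simp add: a_def k0)
  also have "\<dots> \<le> 1 + (\<Sum>n<N. (3 / 16) * a n + (if k (Suc n) = k n then (21 / 16) * a n else 0))"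
    by (intro add_left_mono sum_mono next_le)
  also have "\<dots> = 1 + (3 / 16) * (\<Sum>n<N. a n) + (21 / 16) * (\<Sum>n\<in>{n. n < N \<and> k (Suc n) = k n}. a n)"
  proof -
    have "{..<N} \<inter> {n. k (Suc n) = k n} = {n. n < N \<and> k (Suc n) = k n}" by auto
    then show ?thesis by (simp add: sum.distrib sum.If_cases sum_distrib_left)
  qed
  finally have "13 / 16 * (\<Sum>n<N. a n) \<le> 1 + 21 / 16 * (8 * f 0 / c)" using stays by simp
  moreover have "0 \<le> f 0 / c" using f0[of 0] c by simp
  ultimately have "(\<Sum>n<N. a n) \<le> 2 + 16 * f 0 / c" by simp
  then show ?thesis by (simp add: a_def)
qed

text \<open>\<open>F_growth\<close> takes 2^(2^n) clusters, indexed by the subsets of a set with 2^n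
  elements: this fits both the number of pieces allowed at level \<open>n\<close> and the sign cube
  of dimension 2^n in \<open>width_growth\<close>.\<close>

locale growth_functional =
  fixes d :: "'v \<Rightarrow> 'v \<Rightarrow> real" and K :: "'v set" and F :: "'v set \<Rightarrow> real"
  assumes d_self [simp]: "d x x = 0" and d_commute: "d x y = d y x"
    and d_triangle: "d x z \<le> d x y + d y z"
    and F_nonneg: "H \<noteq> {} \<Longrightarrow> H \<subseteq> K \<Longrightarrow> 0 \<le> F H"
    and F_mono: "H \<noteq> {} \<Longrightarrow> H \<subseteq> H' \<Longrightarrow> H' \<subseteq> K \<Longrightarrow> F H \<le> F H'"
    and F_growth: "\<And>n a \<tau> H c. a > 0 \<Longrightarrow>
      (\<And>A B. A \<subseteq> {..<2 ^ n} \<Longrightarrow> B \<subseteq> {..<2 ^ n} \<Longrightarrow> A \<noteq> B \<Longrightarrow> a \<le> d (\<tau> A) (\<tau> B)) \<Longrightarrow>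
      (\<And>A. A \<subseteq> {..<2 ^ n} \<Longrightarrow> H A \<noteq> {} \<and> H A \<subseteq> K) \<Longrightarrow>
      (\<And>A t. A \<subseteq> {..<2 ^ n} \<Longrightarrow> t \<in> H A \<Longrightarrow> d t (\<tau> A) \<le> a / 8) \<Longrightarrow>
      (\<And>A. A \<subseteq> {..<2 ^ n} \<Longrightarrow> c \<le> F (H A)) \<Longrightarrow>
      a * sqrt 2 ^ n / 5 + c \<le> F (\<Union>A\<in>Pow {..<(2 ^ n :: nat)}. H A)"
begin

text \<open>Greedy splitting: choose a centre whose ball of radius a / 8 has almost the largest
  \<open>F\<close>, remove its ball of radius \<open>a\<close>, and repeat. A point \<open>t\<close>
  of the remainder together with the centres gives 2^(2^n) points at mutual distance at least
  \<open>a\<close>, and each of their small balls has \<open>F\<close> at least that of the ball of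
  \<open>t\<close> minus \<open>\<eta>\<close>. Growth adds 2 \<open>\<eta>\<close>, so a net gain
  of \<open>\<eta>\<close> is left.\<close>

lemma split_exists:
  assumes C: "C \<noteq> {}" "C \<subseteq> K" and a: "a > 0"
  shows "\<exists>Q. partition_on C Q \<and> finite Q \<and> card Q \<le> 2 ^ 2 ^ n \<and>
    (\<forall>P\<in>Q. (\<exists>t\<in>C. \<forall>y\<in>P. d y t \<le> a) \<or>
      (\<forall>t\<in>P. F {y \<in> P. d y t \<le> a / 8} + a * sqrt 2 ^ n / 10 \<le> F C))"
proof -
  define \<eta> where "\<eta> = a * sqrt 2 ^ n / 10"
  have \<eta>: "\<eta> > 0" using a by (simp add: \<eta>_def)
  define good where "good C' t \<longleftrightarrow> t \<in> C' \<and>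
    (\<forall>u\<in>C'. F {y \<in> C'. d y u \<le> a / 8} \<le> F {y \<in> C'. d y t \<le> a / 8} + \<eta>)" for C' t
  have good_ex: "\<exists>t. good C' t" if C': "C' \<noteq> {}" "C' \<subseteq> C" for C'
  proof -
    let ?V = "(\<lambda>u. F {y \<in> C'. d y u \<le> a / 8}) ` C'"
    have bdd: "bdd_above ?V"
    proof (rule bdd_aboveI2)
      fix u assume u: "u \<in> C'"
      then have "u \<in> {y \<in> C'. d y u \<le> a / 8}" using a by simp
      then show "F {y \<in> C'. d y u \<le> a / 8} \<le> F K" using C' C by (intro F_mono) auto
    qed
    obtain v where v: "v \<in> ?V" "Sup ?V - \<eta> < v"
      using less_cSupD[of ?V "Sup ?V - \<eta>"] C' \<eta> by auto
    then obtain t where t: "t \<in> C'" "v = F {y \<in> C'. d y t \<le> a / 8}" by auto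
    have "F {y \<in> C'. d y u \<le> a / 8} \<le> Sup ?V" if "u \<in> C'" for u
      using that by (intro cSup_upper bdd) auto
    then show ?thesis using v(2) t unfolding good_def by (intro exI[of _ t]) force
  qed
  define pick where "pick C' = (SOME t. good C' t)" for C'
  have pick: "good C' (pick C')" if "C' \<noteq> {}" "C' \<subseteq> C" for C'
    unfolding pick_def using good_ex[OF that] by (rule someI_ex)
  define rest where "rest = rec_nat C (\<lambda>_ C'. C' - {y. d y (pick C') \<le> a})"
  have rest_0: "rest 0 = C" and rest_Suc: "rest (Suc i) = rest i - {y. d y (pick (rest i)) \<le> a}" for i
    by (simp_all add: rest_def)
  have rest_anti: "rest j \<subseteq> rest i" if "i \<le> j" for i j
    using that by (rule lift_Suc_antimono_le[rotated]) (auto simp: rest_Suc)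
  have rest_C: "rest i \<subseteq> C" for i using rest_anti[of 0 i] by (simp add: rest_0)
  \<comment> \<open>One less than the number of pieces allowed: the remainder is a piece as well,
    and the \<open>m\<close> centres with \<open>t\<close> make exactly \<open>2 ^ 2 ^ n\<close>
    points.\<close>
  define m :: nat where "m = 2 ^ 2 ^ n - 1"
  have m: "Suc m = 2 ^ 2 ^ n" by (simp add: m_def)
  define B where "B i = {y \<in> rest i. d y (pick (rest i)) \<le> a}" for i
  define Q where "Q = (B ` {..<m} \<union> {rest m}) - {{}}"
  have un: "C = rest i \<union> (\<Union>j<i. B j)" for i
    by (induction i) (auto simp: rest_0 rest_Suc B_def lessThan_Suc)
  have Bdisj: "B i \<inter> rest j = {}" if "i < j" for i j
    using rest_anti[of "Suc i" j] that by (auto simp: B_def rest_Suc)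
  have Bsub: "B i \<subseteq> rest i" for i by (auto simp: B_def)
  have BB: "B i \<inter> B j = {}" if "i \<noteq> j" for i j
    using that Bdisj[of i j] Bdisj[of j i] Bsub[of i] Bsub[of j] by (cases i j rule: linorder_cases) auto
  have part: "partition_on C Q"
  proof (rule partition_onI)
    show "\<Union> Q = C" using un[of m] by (auto simp: Q_def)
    show "disjnt P P'" if "P \<in> Q" "P' \<in> Q" "P \<noteq> P'" for P P'
    proof -
      have "P = rest m \<or> (\<exists>i<m. P = B i)" "P' = rest m \<or> (\<exists>i<m. P' = B i)"
        using that by (auto simp: Q_def)
      then show ?thesis
        using \<open>P \<noteq> P'\<close> BB Bdisj[of _ m] unfolding disjnt_def by (metis inf_commute)
    qed
    show "{} \<notin> Q" by (simp add: Q_def)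
  qed
  have fin: "finite Q" by (simp add: Q_def)
  have "card Q \<le> card (B ` {..<m} \<union> {rest m})" unfolding Q_def by (intro card_mono) auto
  also have "\<dots> \<le> card (B ` {..<m}) + card {rest m}" by (rule card_Un_le)
  also have "\<dots> \<le> Suc m" using card_image_le[of "{..<m}" B] by simp
  finally have card: "card Q \<le> 2 ^ 2 ^ n" by (simp only: m)
  have rem: "F {y \<in> rest m. d y t \<le> a / 8} + \<eta> \<le> F C" if t: "t \<in> rest m" for t
  proof -
    define \<tau> where "\<tau> i = (if i < m then pick (rest i) else t)" for i
    define H where "H i = {y \<in> rest i. d y (\<tau> i) \<le> a / 8}" for i
    have ne: "rest i \<noteq> {}" if "i \<le> m" for i using rest_anti[OF that] t by auto
    have \<tau>: "\<tau> i \<in> rest i" if "i \<le> m" for i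
      using that t pick[OF ne[OF that] rest_C] by (auto simp: \<tau>_def good_def)
    have sep1: "a \<le> d (\<tau> j) (\<tau> i)" if "i < j" "j \<le> m" for i j
      using \<tau>[OF that(2)] rest_anti[of "Suc i" j] that by (auto simp: rest_Suc \<tau>_def[of i])
    have sep: "a \<le> d (\<tau> i) (\<tau> j)" if "i \<noteq> j" "i \<le> m" "j \<le> m" for i j
      using that sep1[of i j] sep1[of j i] d_commute[of "\<tau> i" "\<tau> j"] by (cases i j rule: linorder_cases) auto
    have Hne: "\<tau> i \<in> H i" if "i \<le> m" for i using \<tau>[OF that] a by (simp add: H_def)
    have HK: "H i \<subseteq> C" for i using rest_C[of i] by (auto simp: H_def)
    have FH: "F (H m) - \<eta> \<le> F (H i)" if "i \<le> m" for i
    proof (cases "i < m")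
      case True
      have ti: "t \<in> rest i" using rest_anti[OF that] t by auto
      have "F (H m) \<le> F {y \<in> rest i. d y t \<le> a / 8}"
        using rest_anti[OF that] Hne[of m] rest_C[of i] C by (intro F_mono) (auto simp: H_def \<tau>_def)
      also have "\<dots> \<le> F (H i) + \<eta>"
        using pick[OF ne[OF that] rest_C] True ti by (simp add: good_def H_def \<tau>_def)
      finally show ?thesis by simp
    next
      case False
      with that \<eta> show ?thesis by simp
    qed
    obtain h where h: "bij_betw h (Pow {..<(2 ^ n :: nat)}) {..<Suc m}"
      using finite_same_card_bij[of "Pow {..<(2 ^ n :: nat)}" "{..<Suc m}"] by (auto simp: card_Pow m)
    have hm: "h A \<le> m" if "A \<subseteq> {..<2 ^ n}" for A
      using bij_betwE[OF h] that by (auto simp: less_Suc_eq_le)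
    have hne: "h A \<noteq> h A'" if "A \<subseteq> {..<2 ^ n}" "A' \<subseteq> {..<2 ^ n}" "A \<noteq> A'" for A A'
      using h that by (auto simp: bij_betw_def dest: inj_onD)
    have "a * sqrt 2 ^ n / 5 + (F (H m) - \<eta>) \<le> F (\<Union>A\<in>Pow {..<(2 ^ n :: nat)}. H (h A))"
    proof (rule F_growth[OF a, where \<tau> = "\<lambda>A. \<tau> (h A)"])
      show "H (h A) \<noteq> {} \<and> H (h A) \<subseteq> K" if "A \<subseteq> {..<2 ^ n}" for A
        using Hne[OF hm[OF that]] HK C by auto
    qed (use sep hm hne FH in \<open>auto simp: H_def\<close>)
    also have "\<dots> \<le> F C" using HK C Hne[OF hm[of "{}"]] by (intro F_mono) auto
    finally have "F (H m) + \<eta> \<le> F C" by (simp add: \<eta>_def)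
    then show ?thesis by (simp add: H_def \<tau>_def)
  qed
  have "(\<exists>t\<in>C. \<forall>y\<in>P. d y t \<le> a) \<or> (\<forall>t\<in>P. F {y \<in> P. d y t \<le> a / 8} + a * sqrt 2 ^ n / 10 \<le> F C)"
    if P: "P \<in> Q" for P
  proof -
    from P consider i where "i < m" "P = B i" "B i \<noteq> {}" | "P = rest m" by (auto simp: Q_def)
    then show ?thesis
    proof cases
      case 1
      then have "rest i \<noteq> {}" by (auto simp: B_def)
      from pick[OF this rest_C] have "pick (rest i) \<in> C" using rest_C by (auto simp: good_def)
      then show ?thesis using 1 by (auto simp: B_def)
    next
      case 2
      then show ?thesis using rem by (simp add: \<eta>_def)
    qed
  qed
  with part fin card show ?thesis by blast
qed

section \<open>Iterated splitting and the resulting admissible sequence\<close>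

definition csplit :: "nat \<Rightarrow> real \<Rightarrow> 'v set \<Rightarrow> 'v set set" where
  "csplit n a C = (SOME Q. partition_on C Q \<and> finite Q \<and> card Q \<le> 2 ^ 2 ^ n \<and>
    (\<forall>P\<in>Q. (\<exists>t\<in>C. \<forall>y\<in>P. d y t \<le> a) \<or>
      (\<forall>t\<in>P. F {y \<in> P. d y t \<le> a / 8} + a * sqrt 2 ^ n / 10 \<le> F C)))"

lemma csplit:
  assumes "C \<noteq> {}" "C \<subseteq> K" "a > 0"
  shows "partition_on C (csplit n a C)" "finite (csplit n a C)" "card (csplit n a C) \<le> 2 ^ 2 ^ n"
    "P \<in> csplit n a C \<Longrightarrow> \<not> (\<exists>t\<in>C. \<forall>y\<in>P. d y t \<le> a) \<Longrightarrow> t \<in> P \<Longrightarrow>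
      F {y \<in> P. d y t \<le> a / 8} + a * sqrt 2 ^ n / 10 \<le> F C"
  using someI_ex[OF split_exists[OF assms, of n]] unfolding csplit_def[symmetric] by blast+

text \<open>The cell of \<open>x\<close> at each level, with a label \<open>k\<close> recording that the cell lies in a ball of
  radius \<open>\<rho> / 8 ^ k\<close>; the label stays the same when \<open>x\<close> falls into the remainder of a split.\<close>

primrec cpath :: "real \<Rightarrow> 'v \<Rightarrow> nat \<Rightarrow> 'v set \<times> nat" where
  "cpath \<rho> x 0 = (K, 0)"
| "cpath \<rho> x (Suc n) = (let C = fst (cpath \<rho> x n); k = snd (cpath \<rho> x n); a = \<rho> / 8 ^ Suc k;
      P = cell (csplit n a C) x
    in (P, if \<exists>t\<in>C. \<forall>y\<in>P. d y t \<le> a then Suc k else k))"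

lemma path_cell:
  assumes "\<rho> > 0" "x \<in> K"
  shows "x \<in> fst (cpath \<rho> x n) \<and> fst (cpath \<rho> x n) \<subseteq> K"
proof (induction n)
  case (Suc n)
  let ?C = "fst (cpath \<rho> x n)" and ?a = "\<rho> / 8 ^ Suc (snd (cpath \<rho> x n))"
  have p: "partition_on ?C (csplit n ?a ?C)" using Suc assms by (intro csplit) auto
  have "cell (csplit n ?a ?C) x \<in> csplit n ?a ?C" "x \<in> cell (csplit n ?a ?C) x"
    using p Suc by (auto intro: partition_on_cell)
  moreover from this p have "cell (csplit n ?a ?C) x \<subseteq> ?C" by (auto dest: partition_onD1)
  ultimately show ?case using Suc by (auto simp: Let_def)
qed (use assms in auto)

lemma path_Suc:
  fixes n :: nat
  assumes "\<rho> > 0" "x \<in> K"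
  defines "C \<equiv> fst (cpath \<rho> x n)" and "a \<equiv> \<rho> / 8 ^ Suc (snd (cpath \<rho> x n))"
  shows "fst (cpath \<rho> x (Suc n)) \<in> csplit n a C" "fst (cpath \<rho> x (Suc n)) \<subseteq> C"
    "partition_on C (csplit n a C)"
proof -
  show p: "partition_on C (csplit n a C)" unfolding C_def a_def using path_cell[OF assms(1,2), of n] assms
    by (intro csplit) auto
  show c: "fst (cpath \<rho> x (Suc n)) \<in> csplit n a C"
    using partition_on_cell[OF p] path_cell[OF assms(1,2), of n] by (simp add: Let_def C_def a_def)
  then show "fst (cpath \<rho> x (Suc n)) \<subseteq> C" using p by (auto dest: partition_onD1)
qed

text \<open>The whole label and cell history is determined by the cell, so cells of one level with a
  common point coincide.\<close>

lemma path_eq: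
  assumes \<rho>: "\<rho> > 0" and x: "x \<in> K" and "y \<in> fst (cpath \<rho> x n)"
  shows "cpath \<rho> y n = cpath \<rho> x n"
  using assms(3)
proof (induction n)
  case (Suc n)
  note s = path_Suc[OF \<rho> x, of n]
  have yn: "cpath \<rho> y n = cpath \<rho> x n" using Suc s(2) by auto
  have "cell (csplit n (\<rho> / 8 ^ Suc (snd (cpath \<rho> x n))) (fst (cpath \<rho> x n))) y = fst (cpath \<rho> x (Suc n))"
    using s(3,1) Suc.prems by (rule cell_eqI)
  then show ?case unfolding cpath.simps(2)[of \<rho> y] yn by (simp add: Let_def)
qed simp

definition levels :: "real \<Rightarrow> nat \<Rightarrow> 'v set set" where
  "levels \<rho> n = (\<lambda>x. fst (cpath \<rho> x n)) ` K"

lemma partition_levels: "\<rho> > 0 \<Longrightarrow> partition_on K (levels \<rho> n)"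
proof (rule partition_onI)
  assume \<rho>: "\<rho> > 0"
  note pc = path_cell[OF \<rho>]
  show "\<Union> (levels \<rho> n) = K" using pc by (fastforce simp: levels_def)
  show "{} \<notin> levels \<rho> n" using pc by (fastforce simp: levels_def)
  show "disjnt P Q" if PQ: "P \<in> levels \<rho> n" "Q \<in> levels \<rho> n" "P \<noteq> Q" for P Q
  proof (rule ccontr)
    assume "\<not> disjnt P Q"
    then obtain z where z: "z \<in> P" "z \<in> Q" by (auto simp: disjnt_def)
    obtain x y where "x \<in> K" "y \<in> K" "P = fst (cpath \<rho> x n)" "Q = fst (cpath \<rho> y n)"
      using PQ by (auto simp: levels_def)
    with z path_eq[OF \<rho>] have "P = Q" by metis
    with PQ show False by simp
  qed
qed

text \<open>Cells are counted together with their labels, since both determine the next split.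
  Splitting 2^(2^n) cells into at most as many pieces each gives 2^(2^(n+1)).\<close>

lemma finite_paths:
  assumes \<rho>: "\<rho> > 0"
  shows "finite ((\<lambda>x. cpath \<rho> x n) ` K) \<and> card ((\<lambda>x. cpath \<rho> x n) ` K) \<le> 2 ^ 2 ^ n"
proof (induction n)
  case 0
  have "(\<lambda>x. cpath \<rho> x 0) ` K \<subseteq> {(K, 0)}" by auto
  from finite_subset[OF this] card_mono[OF _ this] show ?case by auto
next
  case (Suc n)
  let ?N = "(\<lambda>x. cpath \<rho> x n) ` K"
  define h where "h = (\<lambda>(C, k). (\<lambda>P. (P, if \<exists>t\<in>C. \<forall>y\<in>P. d y t \<le> \<rho> / 8 ^ Suc k then Suc k else k)) `
     csplit n (\<rho> / 8 ^ Suc k) C)"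
  have h: "finite (h p) \<and> card (h p) \<le> 2 ^ 2 ^ n" if p: "p \<in> ?N" for p
  proof -
    obtain x where x: "x \<in> K" "p = cpath \<rho> x n" using p by auto
    define C k where "C = fst p" and "k = snd p"
    have C: "C \<noteq> {}" "C \<subseteq> K" using path_cell[OF \<rho> x(1), of n] x by (auto simp: C_def)
    have a: "\<rho> / 8 ^ Suc k > 0" using \<rho> by simp
    have "p = (C, k)" by (simp add: C_def k_def)
    moreover have "finite (h (C, k))" unfolding h_def using csplit(2)[OF C a, of n] by simp
    moreover have "card (h (C, k)) \<le> 2 ^ 2 ^ n"
      unfolding h_def prod.case using card_image_le[OF csplit(2)[OF C a, of n]] csplit(3)[OF C a, of n]
      by (rule order_trans)
    ultimately show ?thesis by simp
  qed
  have sub: "(\<lambda>x. cpath \<rho> x (Suc n)) ` K \<subseteq> (\<Union>p\<in>?N. h p)"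
  proof (rule image_subsetI)
    fix x assume x: "x \<in> K"
    have "cpath \<rho> x (Suc n) \<in> h (cpath \<rho> x n)"
      using path_Suc(1)[OF \<rho> x, of n] unfolding h_def by (cases "cpath \<rho> x n") (simp add: Let_def)
    with x show "cpath \<rho> x (Suc n) \<in> (\<Union>p\<in>?N. h p)" by (intro UN_I[of "cpath \<rho> x n"]) auto
  qed
  have fin: "finite (\<Union>p\<in>?N. h p)" using Suc h by blast
  have "card (\<Union>p\<in>?N. h p) \<le> (\<Sum>p\<in>?N. card (h p))" using Suc by (intro card_UN_le) auto
  also have "\<dots> \<le> (\<Sum>p\<in>?N. 2 ^ 2 ^ n)" using h by (intro sum_mono) auto
  also have "\<dots> \<le> 2 ^ 2 ^ n * 2 ^ 2 ^ n" using Suc by simp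
  also have "\<dots> = 2 ^ 2 ^ Suc n" by (simp flip: power_add)
  finally have "card (\<Union>p\<in>?N. h p) \<le> 2 ^ 2 ^ Suc n" .
  then show ?case using finite_subset[OF sub fin] card_mono[OF fin sub] by linarith
qed

lemma admissible_levels:
  assumes \<rho>: "\<rho> > 0" and "K \<noteq> {}"
  shows "admissible K (levels \<rho>)"
proof -
  have lv: "levels \<rho> n = fst ` (\<lambda>x. cpath \<rho> x n) ` K" for n by (simp add: levels_def image_image)
  have "refines K (levels \<rho> (Suc n)) (levels \<rho> n)" for n
  proof -
    have "\<exists>Y\<in>levels \<rho> n. X \<subseteq> Y" if X: "X \<in> levels \<rho> (Suc n)" for X
    proof -
      from X obtain x where "x \<in> K" "X = fst (cpath \<rho> x (Suc n))" unfolding levels_def by blast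
      then show ?thesis using path_Suc(2)[OF \<rho>, of x n] unfolding levels_def by blast
    qed
    then show ?thesis unfolding refines_def by (simp add: partition_levels[OF \<rho>])
  qed
  moreover have "levels \<rho> 0 = {K}" using assms by (auto simp: levels_def)
  moreover have "finite (levels \<rho> n) \<and> card (levels \<rho> n) \<le> 2 ^ 2 ^ n" for n
    using finite_paths[OF \<rho>, of n] card_image_le[of "(\<lambda>x. cpath \<rho> x n) ` K" fst] unfolding lv by force
  ultimately show ?thesis unfolding admissible_def using partition_levels[OF \<rho>] by simp
qed

lemma path_diam:
  assumes \<rho>: "\<rho> > 0" and x: "x \<in> K" and K: "\<And>y. y \<in> K \<Longrightarrow> d y t0 \<le> \<rho>"
  shows "\<exists>t. \<forall>y\<in>fst (cpath \<rho> x n). d y t \<le> \<rho> / 8 ^ snd (cpath \<rho> x n)"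
proof (induction n)
  case 0
  then show ?case using K by auto
next
  case (Suc n)
  show ?case
  proof (cases "\<exists>t\<in>fst (cpath \<rho> x n). \<forall>y\<in>fst (cpath \<rho> x (Suc n)). d y t \<le> \<rho> / 8 ^ Suc (snd (cpath \<rho> x n))")
    case True
    then have "snd (cpath \<rho> x (Suc n)) = Suc (snd (cpath \<rho> x n))" by (simp add: Let_def)
    with True show ?thesis by auto
  next
    case False
    then have "snd (cpath \<rho> x (Suc n)) = snd (cpath \<rho> x n)" by (simp add: Let_def)
    with Suc path_Suc(2)[OF \<rho> x, of n] show ?thesis by (metis subsetD)
  qed
qed

text \<open>Applies \<open>label_sum_bound\<close> to the values of \<open>F\<close> along the path.
  For a remainder cell at label k the gain is a sqrt 2 ^ n / 10 with a = \<rho> / 8 ^ (k + 1); hence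
  c = \<rho> / 80, and 16 times 80 is 1280.\<close>

lemma path_sum:
  assumes \<rho>: "\<rho> > 0" and x: "x \<in> K"
  shows "(\<Sum>n<N. sqrt 2 ^ n / 8 ^ snd (cpath \<rho> x n)) \<le> 2 + 1280 * F K / \<rho>"
proof -
  define C k where "C n = fst (cpath \<rho> x n)" and "k n = snd (cpath \<rho> x n)" for n
  have xC: "x \<in> C n" "C n \<subseteq> K" for n using path_cell[OF \<rho> x, of n] by (auto simp: C_def)
  have CS: "C (Suc n) \<in> csplit n (\<rho> / 8 ^ Suc (k n)) (C n)" "C (Suc n) \<subseteq> C n" for n
    using path_Suc[OF \<rho> x, of n] by (auto simp: C_def k_def)
  have Cmono: "C n \<subseteq> C m" if "m \<le> n" for m n
    using that CS(2) by (rule lift_Suc_antimono_le[rotated])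
  have kS: "k (Suc n) = (if \<exists>t\<in>C n. \<forall>y\<in>C (Suc n). d y t \<le> \<rho> / 8 ^ Suc (k n) then Suc (k n) else k n)" for n
    by (simp add: C_def k_def Let_def)
  have rem: "F {y \<in> C (Suc n). d y t \<le> \<rho> / 8 ^ (k n + 2)} + \<rho> / 80 * (sqrt 2 ^ n / 8 ^ k n) \<le> F (C n)"
    if "k (Suc n) = k n" "t \<in> C (Suc n)" for n t
  proof -
    have "\<not> (\<exists>t\<in>C n. \<forall>y\<in>C (Suc n). d y t \<le> \<rho> / 8 ^ Suc (k n))" using that(1) kS[of n] by (metis n_not_Suc_n)
    from csplit(4)[OF _ _ _ CS(1) this that(2)] xC[of n] \<rho> show ?thesis by (auto simp: field_simps)
  qed
  have "(\<Sum>n<N. sqrt 2 ^ n / 8 ^ k n) \<le> 2 + 16 * F (C 0) / (\<rho> / 80)"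
  proof (rule label_sum_bound)
    show "k (Suc n) = k n \<or> k (Suc n) = Suc (k n)" for n by (simp add: kS)
    show "0 \<le> F (C n)" for n using xC[of n] by (intro F_nonneg) auto
    show "F (C (Suc n)) \<le> F (C n)" for n using xC[of n] xC[of "Suc n"] CS(2)[of n] by (intro F_mono) auto
    show "\<rho> / 80 * (sqrt 2 ^ n / 8 ^ k n) \<le> F (C n)" if "k (Suc n) = k n" for n
    proof -
      have "x \<in> {y \<in> C (Suc n). d y x \<le> \<rho> / 8 ^ (k n + 2)}" using xC \<rho> by simp
      then have "0 \<le> F {y \<in> C (Suc n). d y x \<le> \<rho> / 8 ^ (k n + 2)}"
        using xC(2)[of "Suc n"] by (intro F_nonneg) auto
      then show ?thesis using rem[OF that xC(1)] by simp
    qed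
    show "F (C (Suc p)) + \<rho> / 80 * (sqrt 2 ^ n / 8 ^ k n) \<le> F (C n)"
      if "k (Suc n) = k n" "n < p" "k p = Suc (k n)" "k (Suc p) = Suc (Suc (k n))" for n p
    proof -
      have "k (Suc p) \<noteq> k p" using that by simp
      then obtain t where t: "t \<in> C p" "\<forall>y\<in>C (Suc p). d y t \<le> \<rho> / 8 ^ Suc (k p)"
        using kS[of p] by (auto split: if_splits)
      \<comment> \<open>Two labels later the cell lies in a ball of radius a / 8 around a point of
        the remainder cell, exactly the set to which the gain of the split refers.\<close>
      have "F (C (Suc p)) \<le> F {y \<in> C (Suc n). d y t \<le> \<rho> / 8 ^ (k n + 2)}"
        using t xC[of "Suc p"] xC(2)[of "Suc n"] Cmono[of "Suc n" "Suc p"] that by (intro F_mono) auto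
      moreover have "t \<in> C (Suc n)" using t Cmono[of "Suc n" p] that by auto
      ultimately show ?thesis using rem[OF that(1), of t] by simp
    qed
  qed (use \<rho> in \<open>auto simp: k_def\<close>)
  also have "C 0 = K" by (simp add: C_def)
  finally show ?thesis by (simp add: k_def)
qed

lemma gamma2_le_functional:
  assumes \<rho>: "\<rho> > 0" and "K \<noteq> {}" and K: "\<And>y. y \<in> K \<Longrightarrow> d y t0 \<le> \<rho>"
  shows "gamma2 K d \<le> ennreal (4 * \<rho> + 2560 * F K)"
proof -
  have "(\<Sum>n. ennreal (2 powr (real n / 2)) * ediam d (cell (levels \<rho> n) x)) \<le> ennreal (4 * \<rho> + 2560 * F K)"
    if x: "x \<in> K" for x
  proof (rule suminf_le_const)
    fix N
    have ed: "ediam d (cell (levels \<rho> n) x) \<le> ennreal (2 * \<rho> / 8 ^ snd (cpath \<rho> x n))" for n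
    proof -
      have "cell (levels \<rho> n) x = fst (cpath \<rho> x n)"
        using path_cell[OF \<rho> x, of n] x by (intro cell_eqI[OF partition_levels[OF \<rho>]]) (auto simp: levels_def)
      moreover obtain t where t: "\<forall>y\<in>fst (cpath \<rho> x n). d y t \<le> \<rho> / 8 ^ snd (cpath \<rho> x n)"
        using path_diam[OF \<rho> x K] by blast
      have "d y z \<le> 2 * \<rho> / 8 ^ snd (cpath \<rho> x n)" if "y \<in> fst (cpath \<rho> x n)" "z \<in> fst (cpath \<rho> x n)" for y z
        using t[rule_format, OF that(1)] t[rule_format, OF that(2)] d_triangle[of y z t] d_commute[of t z] by simp
      ultimately show ?thesis by (auto intro: ediam_le)
    qed
    have "(\<Sum>n<N. ennreal (2 powr (real n / 2)) * ediam d (cell (levels \<rho> n) x))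
        \<le> (\<Sum>n<N. ennreal (sqrt 2 ^ n) * ennreal (2 * \<rho> / 8 ^ snd (cpath \<rho> x n)))"
      unfolding two_powr_half by (intro sum_mono mult_left_mono ed) auto
    also have "\<dots> = ennreal (\<Sum>n<N. sqrt 2 ^ n * (2 * \<rho> / 8 ^ snd (cpath \<rho> x n)))"
      using \<rho> by (simp add: ennreal_mult[symmetric] sum_ennreal)
    also have "(\<Sum>n<N. sqrt 2 ^ n * (2 * \<rho> / 8 ^ snd (cpath \<rho> x n)))
        = 2 * \<rho> * (\<Sum>n<N. sqrt 2 ^ n / 8 ^ snd (cpath \<rho> x n))"
      by (simp add: sum_distrib_left algebra_simps)
    also have "ennreal \<dots> \<le> ennreal (2 * \<rho> * (2 + 1280 * F K / \<rho>))"
      using path_sum[OF \<rho> x] \<rho> by (intro ennreal_leI mult_left_mono) auto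
    also have "2 * \<rho> * (2 + 1280 * F K / \<rho>) = 4 * \<rho> + 2560 * F K" using \<rho> by (simp add: field_simps)
    finally show "(\<Sum>n<N. ennreal (2 powr (real n / 2)) * ediam d (cell (levels \<rho> n) x))
        \<le> ennreal (4 * \<rho> + 2560 * F K)" .
  qed (rule summableI)
  then show ?thesis
    unfolding gamma2_def using admissible_levels[OF assms(1,2)]
    by (intro INF_lower2[of "levels \<rho>"]) (auto intro: SUP_least)
qed

end

section \<open>Convex hulls in Euclidean space\<close>

context coords
begin

text \<open>Stands in for the Gaussian width of a possibly infinite set. Finite subsets enter
  because \<open>width\<close> is a maximum, eventual lower bounds because widths are compared only
  for large \<open>n\<close>.\<close>

definition wsup :: "'v set \<Rightarrow> real" where
  "wsup A = Sup {c. \<exists>S. finite S \<and> S \<noteq> {} \<and> S \<subseteq> A \<and> (\<forall>\<^sub>F n in sequentially. c \<le> width n S)}"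

text \<open>The supremum is taken over a bounded set, since \<open>M\<close> bounds the widths of
  all finite subsets of the hull, and for nonempty \<open>A\<close> that set contains 0.\<close>

lemma wsup_props:
  assumes T: "finite T" and M: "\<And>n. n > 0 \<Longrightarrow> width n T \<le> M" and A: "A \<subseteq> convex hull T"
  shows wsup_upper: "finite S \<Longrightarrow> S \<noteq> {} \<Longrightarrow> S \<subseteq> A \<Longrightarrow> \<forall>\<^sub>F n in sequentially. c \<le> width n S \<Longrightarrow> c \<le> wsup A"
    and wsup_le: "A \<noteq> {} \<Longrightarrow> wsup A \<le> M"
    and wsup_nonneg: "A \<noteq> {} \<Longrightarrow> 0 \<le> wsup A"
    and less_wsupD: "A \<noteq> {} \<Longrightarrow> c < wsup A \<Longrightarrow>
      \<exists>S. finite S \<and> S \<noteq> {} \<and> S \<subseteq> A \<and> (\<forall>\<^sub>F n in sequentially. c \<le> width n S)"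
    and wsup_mono: "B \<noteq> {} \<Longrightarrow> B \<subseteq> A \<Longrightarrow> wsup B \<le> wsup A"
proof -
  let ?X = "\<lambda>A. {c. \<exists>S. finite S \<and> S \<noteq> {} \<and> S \<subseteq> A \<and> (\<forall>\<^sub>F n in sequentially. c \<le> width n S)}"
  have le: "c \<le> M" if "c \<in> ?X A" for c
  proof -
    from that obtain S where S: "finite S" "S \<noteq> {}" "S \<subseteq> A" "\<forall>\<^sub>F n in sequentially. c \<le> width n S" by blast
    from S(4) obtain N where "\<And>n. n \<ge> N \<Longrightarrow> c \<le> width n S" by (auto simp: eventually_sequentially)
    then have "c \<le> width (Suc N) S" by simp
    also have "\<dots> \<le> width (Suc N) T" using S A T by (intro width_convex_hull) auto
    also have "\<dots> \<le> M" by (rule M) simp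
    finally show ?thesis .
  qed
  then have bdd: "bdd_above (?X A)" by (rule bdd_aboveI)
  have ne: "0 \<in> ?X B" if "B \<noteq> {}" for B
  proof -
    from that obtain x where "x \<in> B" by blast
    then have "finite {x} \<and> {x} \<noteq> {} \<and> {x} \<subseteq> B \<and> (\<forall>\<^sub>F n in sequentially. 0 \<le> width n {x})"
      by (simp add: width_nonneg)
    then show ?thesis by blast
  qed
  show up: "c \<le> wsup A" if "finite S" "S \<noteq> {}" "S \<subseteq> A" "\<forall>\<^sub>F n in sequentially. c \<le> width n S" for S c
    unfolding wsup_def using that bdd by (intro cSup_upper) blast+
  show "wsup A \<le> M" if "A \<noteq> {}"
    unfolding wsup_def using ne[OF that] le by (intro cSup_least) blast+
  show "\<exists>S. finite S \<and> S \<noteq> {} \<and> S \<subseteq> A \<and> (\<forall>\<^sub>F n in sequentially. c \<le> width n S)"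
    if "A \<noteq> {}" "c < wsup A" for c
  proof -
    have "?X A \<noteq> {}" using ne[OF that(1)] by blast
    from less_cSupD[OF this that(2)[unfolded wsup_def]]
    obtain c' S where "c < c'" "finite S" "S \<noteq> {}" "S \<subseteq> A" "\<forall>\<^sub>F n in sequentially. c' \<le> width n S" by blast
    moreover from this have "\<forall>\<^sub>F n in sequentially. c \<le> width n S"
      by (elim eventually_mono) simp
    ultimately show ?thesis by blast
  qed
  show "0 \<le> wsup A" if "A \<noteq> {}"
    unfolding wsup_def using ne[OF that] bdd by (intro cSup_upper)
  show "wsup B \<le> wsup A" if "B \<noteq> {}" "B \<subseteq> A"
    unfolding wsup_def using ne[OF that(1)] bdd that(2) by (intro cSup_subset_mono) blast+
qed

text \<open>The exact growth inequality results from letting the loss tend to 0: half of it for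
  finite subsets of almost optimal width, half for \<open>width_growth\<close>, which is used with k
  = 2^n.\<close>

lemma growth_functional_wsup:
  assumes T: "finite T" and M: "\<And>n. n > 0 \<Longrightarrow> width n T \<le> M"
  shows "growth_functional ds (convex hull T) wsup"
proof
  fix n :: nat and a c :: real and \<tau> :: "nat set \<Rightarrow> 'v" and H
  assume a: "a > 0"
    and sep: "\<And>A B. A \<subseteq> {..<2 ^ n} \<Longrightarrow> B \<subseteq> {..<2 ^ n} \<Longrightarrow> A \<noteq> B \<Longrightarrow> a \<le> ds (\<tau> A) (\<tau> B)"
    and H: "\<And>A. A \<subseteq> {..<2 ^ n} \<Longrightarrow> H A \<noteq> {} \<and> H A \<subseteq> convex hull T"
    and near: "\<And>A t. A \<subseteq> {..<2 ^ n} \<Longrightarrow> t \<in> H A \<Longrightarrow> ds t (\<tau> A) \<le> a / 8"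
    and c: "\<And>A. A \<subseteq> {..<2 ^ n} \<Longrightarrow> c \<le> wsup (H A)"
  let ?U = "\<Union>A\<in>Pow {..<(2 ^ n :: nat)}. H A"
  show "a * sqrt 2 ^ n / 5 + c \<le> wsup ?U"
  proof (rule field_le_epsilon)
    fix \<epsilon> :: real assume \<epsilon>: "\<epsilon> > 0"
    have "\<exists>S. finite S \<and> S \<noteq> {} \<and> S \<subseteq> H A \<and> (\<forall>\<^sub>F m in sequentially. c - \<epsilon> / 2 \<le> width m S)"
      if A: "A \<subseteq> {..<2 ^ n}" for A
    proof -
      have "c - \<epsilon> / 2 < wsup (H A)" using c[OF A] \<epsilon> by simp
      with H[OF A] show ?thesis by (intro less_wsupD[OF T M]) auto
    qed
    then obtain S where S: "\<And>A. A \<subseteq> {..<2 ^ n} \<Longrightarrow> finite (S A) \<and> S A \<noteq> {} \<and> S A \<subseteq> H A"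
      "\<And>A. A \<subseteq> {..<2 ^ n} \<Longrightarrow> \<forall>\<^sub>F m in sequentially. c - \<epsilon> / 2 \<le> width m (S A)" by metis
    have "\<forall>\<^sub>F m in sequentially.
        a * sqrt (2 ^ n :: nat) / 5 + (c - \<epsilon> / 2) - \<epsilon> / 2 \<le> width m (\<Union>A\<in>Pow {..<(2 ^ n :: nat)}. S A)"
      using S near \<epsilon> by (intro width_growth[where \<tau> = \<tau>] a sep) (auto, blast)
    then have "a * sqrt (2 ^ n :: nat) / 5 + (c - \<epsilon> / 2) - \<epsilon> / 2 \<le> wsup ?U"
      using S H by (intro wsup_upper[OF T M, of ?U "\<Union>A\<in>Pow {..<(2 ^ n :: nat)}. S A"]) (auto, blast+)
    then show "a * sqrt 2 ^ n / 5 + c \<le> wsup ?U + \<epsilon>" by (simp add: real_sqrt_power)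
  qed
qed (use wsup_nonneg[OF T M] wsup_mono[OF T M] in \<open>auto intro: ds_commute ds_triangle\<close>)

lemma convex_ds_ball: "convex {y. ds y t \<le> \<rho>}"
proof (rule convexI)
  fix x y and u v :: real
  assume xy: "x \<in> {y. ds y t \<le> \<rho>}" "y \<in> {y. ds y t \<le> \<rho>}" and uv: "0 \<le> u" "0 \<le> v" "u + v = 1"
  have "crd e (u *\<^sub>R x + v *\<^sub>R y) - crd e t = u * (crd e x - crd e t) + v * (crd e y - crd e t)" for e
  proof -
    have "crd e t = u * crd e t + v * crd e t" using uv(3) by (metis distrib_right mult_1)
    then show ?thesis by (simp add: linear_add[OF linear_crd] linear_cmul[OF linear_crd] algebra_simps)
  qed
  then have "ds (u *\<^sub>R x + v *\<^sub>R y) t \<le> u * ds x t + v * ds y t"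
    using L2_set_triangle_ineq[of "\<lambda>e. u * (crd e x - crd e t)" "\<lambda>e. v * (crd e y - crd e t)" "set es"] uv
    by (simp add: ds_def L2_set_right_distrib)
  also have "\<dots> \<le> u * \<rho> + v * \<rho>" using xy uv by (intro add_mono mult_left_mono) auto
  also have "\<dots> = \<rho>" using uv by (simp flip: distrib_right)
  finally show "u *\<^sub>R x + v *\<^sub>R y \<in> {y. ds y t \<le> \<rho>}" by simp
qed

text \<open>The known Hilbert space bound with an explicit constant: the radius is at most \<gamma>
  and \<open>wsup\<close> of the hull at most 6 \<gamma>, so 4 + 2560 * 6 = 15364.\<close>

theorem gamma2_convex_hull:
  assumes T: "finite T" "T \<noteq> {}"
  shows "gamma2 (convex hull T) ds \<le> ennreal 15364 * gamma2 T ds"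
proof -
  let ?K = "convex hull T"
  define V where "V A = (SUP x\<in>T. \<Sum>n. ennreal (2 powr (real n / 2)) * ediam ds (cell (A n) x))" for A
  have main: "gamma2 ?K ds \<le> ennreal (15364 * \<gamma>)" if A: "admissible T A" and \<gamma>: "\<gamma> > 0" "V A \<le> ennreal \<gamma>" for A \<gamma>
  proof -
    have sum: "(\<Sum>n. ennreal (2 powr (real n / 2)) * ediam ds (cell (A n) t)) \<le> ennreal \<gamma>" if "t \<in> T" for t
      using \<gamma>(2) that unfolding V_def by (meson SUP_upper order_trans)
    obtain t0 where t0: "t0 \<in> T" using T by blast
    have M: "width n T \<le> 6 * \<gamma>" if "n > 0" for n
      using width_le_admissible[OF T that A sum] \<gamma> by simp
    interpret growth_functional ds ?K wsup using T(1) M by (rule growth_functional_wsup)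
    \<comment> \<open>Level 0 has the single cell \<open>T\<close> and weight 1, so its term alone
      bounds the diameter of \<open>T\<close> and with it the radius of the hull.\<close>
    have "cell (A 0) t0 = T"
      using T(2) t0 unfolding admissible_0[OF A]
      by (intro cell_eqI[where K = T]) (simp_all add: partition_on_space)
    then have "ediam ds T \<le> ennreal (2 powr (real 0 / 2)) * ediam ds (cell (A 0) t0)" by simp
    also have "\<dots> \<le> (\<Sum>n. ennreal (2 powr (real n / 2)) * ediam ds (cell (A n) t0))"
      using sum_le_suminf[of "\<lambda>n. ennreal (2 powr (real n / 2)) * ediam ds (cell (A n) t0)" "{0}"] by simp
    also have "\<dots> \<le> ennreal \<gamma>" by (rule sum[OF t0])
    finally have ed: "ediam ds T \<le> ennreal \<gamma>" .
    have "ds t t0 \<le> \<gamma>" if "t \<in> T" for t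
    proof -
      have "ennreal (ds t t0) \<le> ennreal \<gamma>" by (rule order_trans[OF le_ediam[OF that t0] ed])
      then show ?thesis using \<gamma>(1) by (simp add: ennreal_le_iff)
    qed
    then have "?K \<subseteq> {y. ds y t0 \<le> \<gamma>}" by (intro hull_minimal convex_ds_ball) auto
    then have "gamma2 ?K ds \<le> ennreal (4 * \<gamma> + 2560 * wsup ?K)"
      using T \<gamma> by (intro gamma2_le_functional[of \<gamma> t0]) auto
    also have "\<dots> \<le> ennreal (15364 * \<gamma>)"
      using wsup_le[OF T(1) M order_refl] T by (intro ennreal_leI) simp
    finally show ?thesis .
  qed
  have "gamma2 ?K ds \<le> ennreal 15364 * V A" if A: "admissible T A" for A
  proof (cases "V A = top")
    case True
    then show ?thesis by (simp add: ennreal_mult_top)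
  next
    case False
    then obtain s where s: "s \<ge> 0" "V A = ennreal s" by (cases "V A") auto
    \<comment> \<open>\<open>main\<close> asks for a strictly positive bound, while \<open>s\<close>
      may be 0.\<close>
    have "gamma2 ?K ds \<le> ennreal (15364 * s)"
    proof (rule ennreal_le_epsilon)
      fix \<epsilon> :: real assume \<epsilon>: "\<epsilon> > 0"
      have "gamma2 ?K ds \<le> ennreal (15364 * (s + \<epsilon> / 15364))"
        using s \<epsilon> by (intro main[OF A]) (auto intro!: ennreal_leI)
      also have "\<dots> = ennreal (15364 * s) + ennreal \<epsilon>" using s \<epsilon> by (simp add: ennreal_plus[symmetric] del: ennreal_plus)
      finally show "gamma2 ?K ds \<le> ennreal (15364 * s) + ennreal \<epsilon>" .
    qed
    then show ?thesis using s by (simp add: ennreal_mult)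
  qed
  then have "gamma2 ?K ds / ennreal 15364 \<le> V A" if "admissible T A" for A
    using that by (simp add: divide_le_posI_ennreal mult.commute)
  then have "gamma2 ?K ds / ennreal 15364 \<le> gamma2 T ds"
    unfolding gamma2_def[of T] V_def by (intro INF_greatest) simp
  from mult_left_mono[OF this, of "ennreal 15364"] show ?thesis
    by (simp add: ennreal_times_divide mult.commute ennreal_mult_divide_eq)
qed

end

section \<open>The lower bound\<close>

lemma sum_fun_apply: "(\<Sum>a\<in>A. f a) x = (\<Sum>a\<in>A. f a x)" for f :: "'a \<Rightarrow> 'b \<Rightarrow> 'c::comm_monoid_add"
  by (induction A rule: infinite_finite_induct) auto

definition corner :: "nat \<Rightarrow> (nat \<Rightarrow> nat) \<Rightarrow> nat \<Rightarrow> nat \<Rightarrow> real" where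
  "corner r h = (\<lambda>i j. if i < r \<and> j = h i then 1 else 0)"

definition corners :: "nat \<Rightarrow> nat \<Rightarrow> (nat \<Rightarrow> nat \<Rightarrow> real) set" where
  "corners r D = corner r ` ({..<r} \<rightarrow>\<^sub>E {..<D})"

lemma finite_corners: "finite (corners r D)"
  by (auto simp: corners_def intro!: finite_PiE)

lemma corners_subset: "corners r D \<subseteq> lpl2_space r D"
  by (auto simp: corners_def corner_def lpl2_space_def PiE_def Pi_def)

lemma card_corners: "card (corners r D) = D ^ r"
proof -
  have "inj_on (corner r) ({..<r} \<rightarrow>\<^sub>E {..<D})"
  proof (rule inj_onI)
    fix g h assume gh: "g \<in> {..<r} \<rightarrow>\<^sub>E {..<D}" "h \<in> {..<r} \<rightarrow>\<^sub>E {..<D}" "corner r g = corner r h"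
    have "g i = h i" if "i < r" for i
      using fun_cong[OF fun_cong[OF gh(3)], of i "g i"] that by (simp add: corner_def split: if_splits)
    with gh(1,2) show "g = h" by (intro PiE_ext[of g "{..<r}" _ h]) auto
  qed
  then show ?thesis unfolding corners_def by (simp add: card_image card_PiE)
qed

lemma L2_set_corner_diff: "L2_set (\<lambda>j. corner r g i j - corner r h i j) {..<D} \<le> 2"
proof -
  have le1: "L2_set (corner r g i) {..<D} \<le> 1" for g
  proof -
    have "(\<Sum>j<D. (corner r g i j)\<^sup>2) \<le> (\<Sum>j<D. if j = g i then 1 else 0)"
      by (intro sum_mono) (auto simp: corner_def)
    also have "\<dots> \<le> 1" by (simp add: sum.delta)
    finally show ?thesis by (simp add: L2_set_def)
  qed
  have "L2_set (\<lambda>j. corner r g i j + - corner r h i j) {..<D}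
      \<le> L2_set (corner r g i) {..<D} + L2_set (\<lambda>j. - corner r h i j) {..<D}"
    by (rule L2_set_triangle_ineq)
  also have "L2_set (\<lambda>j. - corner r h i j) {..<D} = L2_set (corner r h i) {..<D}"
    by (simp add: L2_set_def)
  finally show ?thesis using le1[of g] le1[of h] by simp
qed

text \<open>Block \<open>i\<close> of \<open>spread r M \<omega>\<close> is the average of the basis vectors with index \<open>b * M + \<omega> i b\<close>, \<open>b < 2 ^ i\<close>.\<close>

definition spread :: "nat \<Rightarrow> nat \<Rightarrow> (nat \<Rightarrow> nat \<Rightarrow> nat) \<Rightarrow> nat \<Rightarrow> nat \<Rightarrow> real" where
  "spread r M \<omega> = (\<lambda>i j. if i < r \<and> j div M < 2 ^ i \<and> \<omega> i (j div M) = j mod M then 1 / 2 ^ i else 0)"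

definition words :: "nat \<Rightarrow> nat \<Rightarrow> (nat \<Rightarrow> nat \<Rightarrow> nat) set" where
  "words r M = (\<Pi>\<^sub>E i\<in>{..<r}. {..<2 ^ i} \<rightarrow>\<^sub>E {..<M})"

lemma card_residue_class:
  fixes i r b :: nat
  assumes "i \<le> r" "b < 2 ^ i"
  shows "card {a. a < 2 ^ r \<and> a mod 2 ^ i = b} = 2 ^ (r - i)"
proof -
  have r: "(2::nat) ^ r = 2 ^ (r - i) * 2 ^ i" using assms by (simp flip: power_add)
  have "bij_betw (\<lambda>c. c * 2 ^ i + b) {..<2 ^ (r - i)} {a. a < 2 ^ r \<and> a mod 2 ^ i = b}"
  proof (rule bij_betw_byWitness[where f' = "\<lambda>a. a div 2 ^ i"])
    show "(\<lambda>c. c * 2 ^ i + b) ` {..<2 ^ (r - i)} \<subseteq> {a. a < 2 ^ r \<and> a mod 2 ^ i = b}"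
    proof safe
      fix c :: nat assume "c < 2 ^ (r - i)"
      then have "Suc c * 2 ^ i \<le> 2 ^ (r - i) * 2 ^ i" by (intro mult_right_mono) auto
      then show "c * 2 ^ i + b < 2 ^ r" using assms(2) by (simp add: r)
    qed (use assms in simp)
    show "(\<lambda>a. a div 2 ^ i) ` {a. a < 2 ^ r \<and> a mod 2 ^ i = b} \<subseteq> {..<2 ^ (r - i)}"
      by (auto simp: r less_mult_imp_div_less)
  qed (use assms in \<open>auto simp: div_mult_mod_eq\<close>)
  then show ?thesis by (simp flip: bij_betw_same_card)
qed

text \<open>One uniform average over a < 2^r serves all blocks at once: in block i the index a
  selects sub-block a mod 2^i, and by \<open>card_residue_class\<close> every sub-block is selected
  equally often.\<close>

lemma spread_in_hull:
  assumes \<omega>: "\<omega> \<in> words r M" and D: "D = 2 ^ r * M"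
  shows "spread r M \<omega> \<in> convex hull (corners r D)"
proof -
  define h where "h a = (\<lambda>i\<in>{..<r}. (a mod 2 ^ i) * M + \<omega> i (a mod 2 ^ i))" for a :: nat
  have \<omega>M: "\<omega> i b < M" if "i < r" "b < 2 ^ i" for i b
    using \<omega> that by (auto simp: words_def PiE_def Pi_def)
  have hD: "corner r (h a) \<in> corners r D" for a
  proof -
    have "h a i < D" if i: "i < r" for i
    proof -
      have "h a i < Suc (a mod 2 ^ i) * M" using \<omega>M[OF i, of "a mod 2 ^ i"] i by (simp add: h_def)
      also have "\<dots> \<le> 2 ^ i * M" by (intro mult_right_mono) (auto simp: Suc_le_eq)
      also have "\<dots> \<le> D" unfolding D using i by (intro mult_right_mono power_increasing) auto
      finally show ?thesis .
    qed
    then show ?thesis unfolding corners_def by (intro imageI PiE_I) (auto simp: h_def)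
  qed
  have "spread r M \<omega> = (\<Sum>a<2 ^ r. (1 / 2 ^ r) *\<^sub>R corner r (h a))"
  proof (intro ext)
    fix i j
    have eq: "(\<Sum>a<2 ^ r. (1 / 2 ^ r) *\<^sub>R corner r (h a)) i j = (\<Sum>a<2 ^ r. (1 / 2 ^ r) * corner r (h a) i j)"
      by (simp add: sum_fun_apply scaleR_fun_def)
    show "spread r M \<omega> i j = (\<Sum>a<2 ^ r. (1 / 2 ^ r) *\<^sub>R corner r (h a)) i j"
    proof (cases "i < r")
      case i: True
      have M: "M > 0" using \<omega>M[OF i, of 0] by simp
      have iff: "j = h a i \<longleftrightarrow> a mod 2 ^ i = j div M \<and> \<omega> i (j div M) = j mod M" for a
      proof
        assume "j = h a i"
        then have j: "j = (a mod 2 ^ i) * M + \<omega> i (a mod 2 ^ i)" using i by (simp add: h_def)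
        have "\<omega> i (a mod 2 ^ i) < M" by (rule \<omega>M[OF i]) simp
        then have "j div M = a mod 2 ^ i" "j mod M = \<omega> i (a mod 2 ^ i)" unfolding j using M by simp_all
        then show "a mod 2 ^ i = j div M \<and> \<omega> i (j div M) = j mod M" by simp
      next
        assume "a mod 2 ^ i = j div M \<and> \<omega> i (j div M) = j mod M"
        then have "h a i = (j div M) * M + j mod M" using i by (simp add: h_def)
        then show "j = h a i" by simp
      qed
      have "(\<Sum>a<2 ^ r. (1 / 2 ^ r) * corner r (h a) i j) = (1 / 2 ^ r) * real (card {a. a < 2 ^ r \<and> j = h a i})"
      proof -
        have "(\<Sum>a<2 ^ r. corner r (h a) i j) = (\<Sum>a\<in>{a. a < 2 ^ r \<and> j = h a i}. 1)"
          using i by (intro sum.mono_neutral_cong_right) (auto simp: corner_def)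
        then show ?thesis by (simp only: sum_distrib_left[symmetric]) simp
      qed
      also have "\<dots> = spread r M \<omega> i j"
      proof (cases "j div M < 2 ^ i \<and> \<omega> i (j div M) = j mod M")
        case True
        then have "{a. a < 2 ^ r \<and> j = h a i} = {a. a < 2 ^ r \<and> a mod 2 ^ i = j div M}" using iff by auto
        then have "card {a. a < 2 ^ r \<and> j = h a i} = 2 ^ (r - i)"
          using True i by (simp add: card_residue_class)
        moreover have "(2::real) ^ r = 2 ^ (r - i) * 2 ^ i" using i by (simp flip: power_add)
        ultimately show ?thesis using True i by (simp add: spread_def)
      next
        case False
        have lt: "a mod 2 ^ i < 2 ^ i" for a :: nat by simp
        have "j \<noteq> h a i" for a
        proof
          assume "j = h a i"
          then have "a mod 2 ^ i = j div M" "\<omega> i (j div M) = j mod M" using iff by blast+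
          with lt[of a] False show False by metis
        qed
        then have "{a. a < 2 ^ r \<and> j = h a i} = {}" by blast
        then show ?thesis using False by (auto simp: spread_def)
      qed
      finally show ?thesis using eq by simp
    next
      case False
      then show ?thesis unfolding eq by (simp add: spread_def corner_def)
    qed
  qed
  also have "\<dots> \<in> convex hull (corners r D)"
    using hD by (intro convex_sum) (auto intro: hull_inc)
  finally show ?thesis .
qed

text \<open>Each position where the words differ gives a coordinate of block \<open>i\<close> where
  the first point is 2^(-i) and the second is 0; different positions lie in different sub-blocks.
  The corresponding coordinates of the second point are dropped.\<close>

lemma spread_block_distance:
  assumes \<omega>: "\<omega> \<in> words r M" and D: "D = 2 ^ r * M" and i: "i < r"
  shows "sqrt (real (card {b. b < 2 ^ i \<and> \<omega> i b \<noteq> \<omega>' i b})) / 2 ^ i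
    \<le> L2_set (\<lambda>j. spread r M \<omega> i j - spread r M \<omega>' i j) {..<D}"
proof -
  let ?Z = "{b. b < 2 ^ i \<and> \<omega> i b \<noteq> \<omega>' i b}"
  define J where "J b = b * M + \<omega> i b" for b
  have \<omega>M: "\<omega> i b < M" if "b < 2 ^ i" for b
    using \<omega> i that by (auto simp: words_def PiE_def Pi_def)
  have J: "J b div M = b" "J b mod M = \<omega> i b" if "b < 2 ^ i" for b
    using \<omega>M[OF that] by (auto simp: J_def)
  have JD: "J b < D" if "b < 2 ^ i" for b
  proof -
    have "J b < Suc b * M" using \<omega>M[OF that] by (simp add: J_def)
    also have "\<dots> \<le> 2 ^ i * M" using that by (intro mult_right_mono) auto
    also have "\<dots> \<le> D" unfolding D using i by (intro mult_right_mono power_increasing) auto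
    finally show ?thesis .
  qed
  have inj: "inj_on J ?Z" using J(1) by (intro inj_onI) (metis (no_types, lifting) mem_Collect_eq)
  have "real (card ?Z) / (2 ^ i)\<^sup>2 = (\<Sum>j\<in>J ` ?Z. (1 / 2 ^ i)\<^sup>2)"
    by (simp add: card_image[OF inj] power_divide)
  also have "\<dots> = (\<Sum>j\<in>J ` ?Z. (spread r M \<omega> i j - spread r M \<omega>' i j)\<^sup>2)"
  proof (rule sum.cong[OF refl])
    fix j assume "j \<in> J ` ?Z"
    then obtain b where b: "b < 2 ^ i" "\<omega> i b \<noteq> \<omega>' i b" "j = J b" by auto
    have "spread r M \<omega> i j = 1 / 2 ^ i" "spread r M \<omega>' i j = 0"
      unfolding spread_def b(3) J[OF b(1)] using b i by auto
    then show "(1 / 2 ^ i)\<^sup>2 = (spread r M \<omega> i j - spread r M \<omega>' i j)\<^sup>2" by simp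
  qed
  also have "\<dots> \<le> (\<Sum>j<D. (spread r M \<omega> i j - spread r M \<omega>' i j)\<^sup>2)"
    using JD by (intro sum_mono2) auto
  finally have "sqrt (real (card ?Z) / (2 ^ i)\<^sup>2) \<le> sqrt (\<Sum>j<D. (spread r M \<omega> i j - spread r M \<omega>' i j)\<^sup>2)"
    by (rule real_sqrt_le_mono)
  then show ?thesis unfolding L2_set_def by (simp add: real_sqrt_divide)
qed

section \<open>Counting words in Hamming balls and in cells\<close>

lemma card_hamming_ball:
  assumes f: "f \<in> {..<k} \<rightarrow>\<^sub>E {..<M}" and M: "M \<ge> 1"
  shows "card {g \<in> {..<k} \<rightarrow>\<^sub>E {..<M}. 2 * card {b. b < k \<and> f b \<noteq> g b} \<le> k} \<le> 2 ^ k * M ^ (k div 2)"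
proof -
  let ?B = "{g \<in> {..<k} \<rightarrow>\<^sub>E {..<M}. 2 * card {b. b < k \<and> f b \<noteq> g b} \<le> k}"
  let ?ZZ = "{Z \<in> Pow {..<k}. 2 * card Z \<le> k}"
  let ?G = "\<lambda>Z. (\<Pi>\<^sub>E b\<in>{..<k}. if b \<in> Z then {..<M} else {f b})"
  \<comment> \<open>A word of the ball is determined by the set \<open>Z\<close> of positions where
    it differs from \<open>f\<close> and by its letters on \<open>Z\<close>.\<close>
  have "?B \<subseteq> (\<Union>Z\<in>?ZZ. ?G Z)"
  proof
    fix g assume g: "g \<in> ?B"
    then have "g \<in> ?G {b. b < k \<and> f b \<noteq> g b}" by (auto simp: PiE_def Pi_def)
    moreover have "{b. b < k \<and> f b \<noteq> g b} \<in> ?ZZ" using g by auto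
    ultimately show "g \<in> (\<Union>Z\<in>?ZZ. ?G Z)" by (rule UN_I[rotated])
  qed
  then have "card ?B \<le> card (\<Union>Z\<in>?ZZ. ?G Z)" by (intro card_mono) (auto intro!: finite_PiE)
  also have "\<dots> \<le> (\<Sum>Z\<in>?ZZ. card (?G Z))" by (intro card_UN_le) auto
  also have "\<dots> \<le> (\<Sum>Z\<in>?ZZ. M ^ (k div 2))"
  proof (rule sum_mono)
    fix Z assume Z: "Z \<in> ?ZZ"
    have "card (?G Z) = (\<Prod>b<k. if b \<in> Z then M else 1)"
      by (subst card_PiE) (auto intro!: prod.cong)
    also have "\<dots> = M ^ card Z"
      using Z by (simp add: prod.If_cases Int_absorb1)
    also have "\<dots> \<le> M ^ (k div 2)" using Z M by (intro power_increasing) auto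
    finally show "card (?G Z) \<le> M ^ (k div 2)" .
  qed
  also have "\<dots> = card ?ZZ * M ^ (k div 2)" by simp
  also have "\<dots> \<le> 2 ^ k * M ^ (k div 2)"
    using card_mono[of "Pow {..<k}" ?ZZ] by (intro mult_right_mono) (auto simp: card_Pow)
  finally show ?thesis .
qed

lemma finite_words: "finite (words r M)"
  unfolding words_def by (intro finite_PiE) auto

text \<open>With k = 2^i, block \<open>i\<close> has M^k words, at most 2^k M^(k/2) of them near. In
  exponents of 2 the difference is at least 127 r k - 63.5 r k - k, which exceeds 62 r k; the other
  blocks count equally on both sides.\<close>

lemma card_words_near:
  assumes r: "r \<ge> 1" and M: "M = 2 ^ (127 * r)" and \<omega>: "\<omega> \<in> words r M" and i: "i < r"
  shows "card {\<omega>' \<in> words r M. 2 * card {b. b < 2 ^ i \<and> \<omega> i b \<noteq> \<omega>' i b} \<le> 2 ^ i} * 2 ^ (62 * r * 2 ^ i)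
    \<le> card (words r M)"
proof -
  define k :: nat where "k = 2 ^ i"
  define W where "W i = ({..<(2::nat) ^ i} \<rightarrow>\<^sub>E {..<M})" for i :: nat
  define B where "B = {g \<in> {..<k} \<rightarrow>\<^sub>E {..<M}. 2 * card {b. b < k \<and> \<omega> i b \<noteq> g b} \<le> k}"
  define R where "R = (\<Prod>i'\<in>{..<r} - {i}. card (W i'))"
  have fin: "finite (W i')" for i' unfolding W_def by (intro finite_PiE) auto
  have BW: "B \<subseteq> W i" by (auto simp: B_def W_def k_def)
  have "{\<omega>' \<in> words r M. 2 * card {b. b < 2 ^ i \<and> \<omega> i b \<noteq> \<omega>' i b} \<le> 2 ^ i}
      \<subseteq> (\<Pi>\<^sub>E i'\<in>{..<r}. if i' = i then B else W i')"
    using i by (auto simp: words_def B_def W_def k_def PiE_def Pi_def)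
  then have "card {\<omega>' \<in> words r M. 2 * card {b. b < 2 ^ i \<and> \<omega> i b \<noteq> \<omega>' i b} \<le> 2 ^ i}
      \<le> card (\<Pi>\<^sub>E i'\<in>{..<r}. if i' = i then B else W i')"
    using fin finite_subset[OF BW fin] by (intro card_mono finite_PiE) auto
  also have "\<dots> = card B * R"
    using i by (subst card_PiE, simp, subst prod.remove[of _ i]) (auto simp: R_def intro!: prod.cong)
  also have "card B \<le> 2 ^ k * M ^ (k div 2)"
    unfolding B_def using \<omega> i by (intro card_hamming_ball) (auto simp: words_def PiE_def Pi_def k_def M extensional_def)
  finally have le: "card {\<omega>' \<in> words r M. 2 * card {b. b < 2 ^ i \<and> \<omega> i b \<noteq> \<omega>' i b} \<le> 2 ^ i}
      \<le> 2 ^ k * M ^ (k div 2) * R" by simp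
  have "2 ^ k * M ^ (k div 2) * 2 ^ (62 * r * k) = (2::nat) ^ (k + 127 * r * (k div 2) + 62 * r * k)"
    by (simp add: M power_add power_mult)
  also have "\<dots> \<le> 2 ^ (127 * r * k)"
  proof (rule power_increasing)
    have "r * (2 * (k div 2)) \<le> r * k" by (intro mult_left_mono) auto
    moreover have "k \<le> r * k" using r by simp
    moreover have "127 * r * (k div 2) = 127 * (r * (k div 2))" "62 * r * k = 62 * (r * k)"
      "127 * r * k = 127 * (r * k)" "r * (2 * (k div 2)) = 2 * (r * (k div 2))" by simp_all
    ultimately show "k + 127 * r * (k div 2) + 62 * r * k \<le> 127 * r * k" by linarith
  qed simp
  also have "\<dots> = card (W i)" by (simp add: W_def card_PiE M k_def power_mult)
  finally have "(2 ^ k * M ^ (k div 2) * 2 ^ (62 * r * k)) * R \<le> card (W i) * R" by (rule mult_right_mono) simp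
  also have "card (W i) * R = card (words r M)"
    unfolding words_def W_def[symmetric] R_def using i by (subst card_PiE, simp, subst prod.remove[of _ i]) auto
  finally have "2 ^ k * M ^ (k div 2) * R * 2 ^ (62 * r * k) \<le> card (words r M)" by (simp only: mult_ac)
  moreover have "card {\<omega>' \<in> words r M. 2 * card {b. b < 2 ^ i \<and> \<omega> i b \<noteq> \<omega>' i b} \<le> 2 ^ i} * 2 ^ (62 * r * k)
      \<le> 2 ^ k * M ^ (k div 2) * R * 2 ^ (62 * r * k)"
    using le by (rule mult_right_mono) simp
  ultimately show ?thesis unfolding k_def by (rule order_trans[rotated])
qed

text \<open>At level n the cells with at most |\<Omega>| / 2^(2^(n+1)) words hold together at most
  |\<Omega>| / 2^(2^n), hence at most |\<Omega>| / 2^(n+1) words. These bounds sum to less than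
  |\<Omega>|, so one word avoids such cells at all \<open>r\<close> levels simultaneously.\<close>

lemma exists_large_cells:
  fixes pt :: "'w \<Rightarrow> 'a"
  assumes A: "admissible K A" and \<Omega>: "finite \<Omega>" "\<Omega> \<noteq> {}" "pt ` \<Omega> \<subseteq> K" and "q \<ge> 1"
  shows "\<exists>\<omega>\<in>\<Omega>. \<forall>n\<in>{q..<q + r}. card \<Omega> < card {\<omega>' \<in> \<Omega>. pt \<omega>' \<in> cell (A n) (pt \<omega>)} * 2 ^ 2 ^ Suc n"
proof -
  define N where "N B = card {\<omega>' \<in> \<Omega>. pt \<omega>' \<in> B}" for B
  define bad where "bad n = {\<omega> \<in> \<Omega>. N (cell (A n) (pt \<omega>)) * 2 ^ 2 ^ Suc n \<le> card \<Omega>}" for n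
  have bad_le: "real (card (bad n)) \<le> real (card \<Omega>) / 2 ^ Suc n" if "n \<ge> 1" for n
  proof -
    have part: "partition_on K (A n)" and fin: "finite (A n)" and cd: "card (A n) \<le> 2 ^ 2 ^ n"
      using A that by (auto simp: admissible_def)
    let ?S = "{B \<in> A n. N B * 2 ^ 2 ^ Suc n \<le> card \<Omega>}"
    have "bad n \<subseteq> (\<Union>B\<in>?S. {\<omega>' \<in> \<Omega>. pt \<omega>' \<in> B})"
    proof
      fix \<omega> assume \<omega>: "\<omega> \<in> bad n"
      then have "pt \<omega> \<in> K" using \<Omega> by (auto simp: bad_def)
      from partition_on_cell[OF part this] \<omega> show "\<omega> \<in> (\<Union>B\<in>?S. {\<omega>' \<in> \<Omega>. pt \<omega>' \<in> B})"
        by (intro UN_I[of "cell (A n) (pt \<omega>)"]) (auto simp: bad_def)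
    qed
    then have "card (bad n) \<le> card (\<Union>B\<in>?S. {\<omega>' \<in> \<Omega>. pt \<omega>' \<in> B})"
      using fin \<Omega> by (intro card_mono) auto
    also have "\<dots> \<le> (\<Sum>B\<in>?S. N B)" unfolding N_def using fin by (intro card_UN_le) auto
    finally have "card (bad n) * 2 ^ 2 ^ Suc n \<le> (\<Sum>B\<in>?S. N B) * 2 ^ 2 ^ Suc n" by (rule mult_right_mono) simp
    also have "\<dots> = (\<Sum>B\<in>?S. N B * 2 ^ 2 ^ Suc n)" by (rule sum_distrib_right)
    also have "\<dots> \<le> (\<Sum>B\<in>?S. card \<Omega>)" by (intro sum_mono) auto
    also have "\<dots> = card ?S * card \<Omega>" by simp
    also have "\<dots> \<le> 2 ^ 2 ^ n * card \<Omega>"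
      using card_mono[OF fin, of ?S] cd by (intro mult_right_mono) auto
    finally have "card (bad n) * 2 ^ 2 ^ Suc n \<le> 2 ^ 2 ^ n * card \<Omega>" .
    moreover have "(2::nat) ^ 2 ^ Suc n = 2 ^ 2 ^ n * 2 ^ 2 ^ n" by (simp flip: power_add)
    ultimately have "card (bad n) * 2 ^ 2 ^ n \<le> card \<Omega>" by (simp add: mult.commute)
    moreover have "(2::nat) ^ Suc n \<le> 2 ^ 2 ^ n" using Suc_leI[OF less_exp[of n]] by (intro power_increasing)  auto
    ultimately have "card (bad n) * 2 ^ Suc n \<le> card \<Omega>" by (meson mult_left_mono order_trans zero_le)
    then have "real (card (bad n) * 2 ^ Suc n) \<le> real (card \<Omega>)" by (rule of_nat_mono)
    then show ?thesis by (simp add: field_simps)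
  qed
  have "real (card (\<Union>n\<in>{q..<q + r}. bad n)) \<le> (\<Sum>n\<in>{q..<q + r}. real (card (bad n)))"
    unfolding of_nat_sum[symmetric] of_nat_le_iff by (rule card_UN_le) simp
  also have "\<dots> \<le> (\<Sum>n\<in>{q..<q + r}. real (card \<Omega>) / 2 ^ Suc n)"
    using \<open>q \<ge> 1\<close> by (intro sum_mono bad_le) auto
  also have "\<dots> = real (card \<Omega>) * (\<Sum>n\<in>{q..<q + r}. 1 / 2 ^ Suc n)" by (simp add: sum_distrib_left)
  also have "(\<Sum>n\<in>{q..<q + r}. 1 / 2 ^ Suc n) = (1 / 2 ^ q - 1 / 2 ^ (q + r) :: real)"
  proof (induction r)
    case (Suc r)
    have "(\<Sum>n\<in>{q..<q + Suc r}. 1 / 2 ^ Suc n :: real) = (1 / 2 ^ q - 1 / 2 ^ (q + r)) + 1 / 2 ^ Suc (q + r)"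
      unfolding add_Suc_right by (subst sum.atLeastLessThan_Suc) (simp, simp only: Suc)
    also have "\<dots> = 1 / 2 ^ q - 1 / 2 ^ (q + Suc r)" by simp
    finally show ?case .
  qed simp
  also have "real (card \<Omega>) * (1 / 2 ^ q - 1 / 2 ^ (q + r)) < real (card \<Omega>) * 1"
  proof (rule mult_strict_left_mono)
    have "1 / 2 ^ q - 1 / 2 ^ (q + r) < (1 / 2 ^ q :: real)" by simp
    also have "\<dots> \<le> 1" by simp
    finally show "1 / 2 ^ q - 1 / 2 ^ (q + r) < (1::real)" .
    show "0 < real (card \<Omega>)" using \<Omega> by (simp add: card_gt_0_iff)
  qed
  finally have "card (\<Union>n\<in>{q..<q + r}. bad n) < card \<Omega>" by simp
  then have "\<not> \<Omega> \<subseteq> (\<Union>n\<in>{q..<q + r}. bad n)"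
    using card_mono[of "\<Union>n\<in>{q..<q + r}. bad n" \<Omega>] \<Omega>(1) by (auto simp: bad_def not_le[symmetric])
  then obtain \<omega> where "\<omega> \<in> \<Omega>" "\<And>n. n \<in> {q..<q + r} \<Longrightarrow> \<omega> \<notin> bad n" by blast
  then show ?thesis by (intro bexI[of _ \<omega>]) (auto simp: bad_def N_def not_le)
qed

text \<open>\<open>d\<close> only has to dominate every block norm, so one estimate covers all
  p.\<close>

lemma gamma2_hull_corners_lower:
  assumes r: "r \<ge> 2" and D: "D = 2 ^ (128 * r)"
    and d: "\<And>x y i. i < r \<Longrightarrow> L2_set (\<lambda>j. x i j - y i j) {..<D} \<le> d x y"
  shows "ennreal (2 * real r * sqrt r) \<le> gamma2 (convex hull (corners r D)) d"
  unfolding gamma2_def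
proof (rule INF_greatest)
  let ?K = "convex hull (corners r D)"
  fix A assume "A \<in> {A. admissible ?K A}"
  then have A: "admissible ?K A" by simp
  define M :: nat where "M = 2 ^ (127 * r)"
  have M: "M \<ge> 1" by (simp add: M_def)
  have DM: "D = 2 ^ r * M" unfolding D M_def by (simp flip: power_add)
  let ?pt = "spread r M"
  have pt: "?pt ` words r M \<subseteq> ?K" using spread_in_hull[OF _ DM] by blast
  have ne: "words r M \<noteq> {}" unfolding words_def using M by (auto simp: PiE_eq_empty_iff lessThan_empty_iff)
  \<comment> \<open>Two demands fix the size of \<open>q\<close>: 2^(q+i+1) is at most 62 r 2^i, the
    exponent in \<open>card_words_near\<close>, and 2^(q-1) is at least 4 r, so that each scale
    contributes at least 2 sqrt r.\<close>
  obtain q where q: "2 ^ q \<le> 31 * r" "31 * r < 2 ^ (q + 1)"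
    using ex_power_ivl1[of 2 "31 * r"] r by auto
  have q1: "q \<ge> 1" using q r by (cases q) auto
  obtain \<omega> where \<omega>: "\<omega> \<in> words r M"
    and large: "\<And>n. n \<in> {q..<q + r} \<Longrightarrow>
      card (words r M) < card {\<omega>' \<in> words r M. ?pt \<omega>' \<in> cell (A n) (?pt \<omega>)} * 2 ^ 2 ^ Suc n"
    using exists_large_cells[OF A finite_words ne pt q1] by blast
  have x: "?pt \<omega> \<in> ?K" using pt \<omega> by blast
  \<comment> \<open>If the cell were smaller, all its words would be near \<open>\<omega>\<close> in
    block \<open>i\<close>, and there are too few of those.\<close>
  have diam: "ennreal (1 / sqrt 2 ^ Suc i) \<le> ediam d (cell (A (q + i)) (?pt \<omega>))" if i: "i < r" for i
  proof (rule ccontr)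
    let ?B = "cell (A (q + i)) (?pt \<omega>)"
    assume small: "\<not> ennreal (1 / sqrt 2 ^ Suc i) \<le> ediam d ?B"
    have xB: "?pt \<omega> \<in> ?B" using A x by (intro partition_on_cell) (auto simp: admissible_def)
    have near: "2 * card {b. b < 2 ^ i \<and> \<omega> i b \<noteq> \<omega>' i b} \<le> 2 ^ i" if \<omega>': "?pt \<omega>' \<in> ?B" for \<omega>'
    proof (rule ccontr)
      let ?c = "card {b. b < 2 ^ i \<and> \<omega> i b \<noteq> \<omega>' i b}"
      assume "\<not> 2 * ?c \<le> 2 ^ i"
      then have "real (2 ^ i) \<le> real (2 * ?c)" by (intro of_nat_mono) simp
      then have "2 ^ i / 2 \<le> real ?c" by simp
      then have "sqrt (2 ^ i / 2) / 2 ^ i \<le> sqrt (real ?c) / 2 ^ i" by (intro divide_right_mono real_sqrt_le_mono) auto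
      also have "\<dots> \<le> d (?pt \<omega>) (?pt \<omega>')"
        using spread_block_distance[OF \<omega> DM i, of \<omega>'] d[OF i, of "?pt \<omega>" "?pt \<omega>'"] by linarith
      finally have "sqrt (2 ^ i / 2) / 2 ^ i \<le> d (?pt \<omega>) (?pt \<omega>')" .
      moreover have "sqrt (2 ^ i / 2) / 2 ^ i = 1 / sqrt 2 ^ Suc i"
      proof -
        have "(2::real) ^ i = sqrt 2 ^ i * sqrt 2 ^ i" by (simp flip: power_mult_distrib)
        moreover have "sqrt (2 ^ i / 2) = sqrt 2 ^ i / sqrt 2" by (simp add: real_sqrt_divide real_sqrt_power)
        ultimately show ?thesis by simp
      qed
      ultimately have "ennreal (1 / sqrt 2 ^ Suc i) \<le> ennreal (d (?pt \<omega>) (?pt \<omega>'))" by (simp add: ennreal_leI)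
      also have "\<dots> \<le> ediam d ?B" by (rule le_ediam[OF xB \<omega>'])
      finally show False using small by simp
    qed
    have "card (words r M) < card {\<omega>' \<in> words r M. ?pt \<omega>' \<in> ?B} * 2 ^ 2 ^ Suc (q + i)"
      using i by (intro large) auto
    also have "\<dots> \<le> card {\<omega>' \<in> words r M. 2 * card {b. b < 2 ^ i \<and> \<omega> i b \<noteq> \<omega>' i b} \<le> 2 ^ i}
        * 2 ^ (62 * r * 2 ^ i)"
    proof (intro mult_mono card_mono power_increasing)
      have "2 ^ Suc (q + i) = 2 * 2 ^ q * (2 ^ i :: nat)" by (simp add: power_add)
      also have "\<dots> \<le> 62 * r * 2 ^ i" using q by (intro mult_right_mono) auto
      finally show "2 ^ Suc (q + i) \<le> 62 * r * 2 ^ i" .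
    qed (use near finite_words in auto)
    also have "\<dots> \<le> card (words r M)" using r by (intro card_words_near[OF _ M_def \<omega> i]) auto
    finally show False by simp
  qed
  let ?s = "\<lambda>n. ennreal (2 powr (real n / 2)) * ediam d (cell (A n) (?pt \<omega>))"
  have "2 * real r * sqrt r \<le> (\<Sum>i<r. sqrt 2 ^ (q + i) * (1 / sqrt 2 ^ Suc i))"
  proof -
    have "real (31 * r) \<le> real (2 ^ (q + 1))" using q(2) by (intro of_nat_mono) simp
    then have "4 * real r \<le> real (2 ^ (q + 1)) / 4" by (simp del: power_Suc)
    then have "sqrt (4 * real r) \<le> sqrt (2 ^ q / 2)" by (intro real_sqrt_le_mono) simp
    also have "\<dots> = sqrt 2 ^ q / sqrt 2" by (simp add: real_sqrt_divide real_sqrt_power)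
    finally have "2 * sqrt r \<le> sqrt 2 ^ q / sqrt 2" by (simp add: real_sqrt_mult)
    then have "real r * (2 * sqrt r) \<le> real r * (sqrt 2 ^ q / sqrt 2)" by (intro mult_left_mono) auto
    moreover have "sqrt 2 ^ (q + i) * (1 / sqrt 2 ^ Suc i) = sqrt 2 ^ q / sqrt 2" for i
      by (simp add: power_add)
    ultimately show ?thesis by (simp add: mult_ac)
  qed
  then have "ennreal (2 * real r * sqrt r) \<le> ennreal (\<Sum>i<r. sqrt 2 ^ (q + i) * (1 / sqrt 2 ^ Suc i))"
    by (rule ennreal_leI)
  also have "\<dots> = (\<Sum>i<r. ennreal (sqrt 2 ^ (q + i) * (1 / sqrt 2 ^ Suc i)))"
    by (rule sum_ennreal[symmetric]) simp
  also have "\<dots> = (\<Sum>i<r. ennreal (2 powr (real (q + i) / 2)) * ennreal (1 / sqrt 2 ^ Suc i))"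
    unfolding two_powr_half by (intro sum.cong refl ennreal_mult) auto
  also have "\<dots> \<le> (\<Sum>i<r. ?s (q + i))" by (intro sum_mono mult_left_mono diam) auto
  also have "\<dots> = (\<Sum>n\<in>(\<lambda>i. q + i) ` {..<r}. ?s n)" by (subst sum.reindex) (auto simp: inj_on_def)
  also have "\<dots> \<le> (\<Sum>n. ?s n)" by (rule sum_le_suminf) auto
  also have "\<dots> \<le> (SUP x\<in>?K. \<Sum>n. ennreal (2 powr (real n / 2)) * ediam d (cell (A n) x))"
    using x by (rule SUP_upper)
  finally show "ennreal (2 * real r * sqrt r) \<le> (SUP x\<in>?K. \<Sum>n. ennreal (2 powr (real n / 2)) * ediam d (cell (A n) x))" .
qed

text \<open>The trivial partition is kept below level \<open>N\<close> and replaced by singletons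
  from there on, which leaves a geometric sum of diameters.\<close>

lemma gamma2_finite_le:
  assumes T: "finite T" "T \<noteq> {}" "card T \<le> 2 ^ 2 ^ N" and N: "N \<ge> 1"
    and d: "\<And>x y. x \<in> T \<Longrightarrow> y \<in> T \<Longrightarrow> d x y \<le> \<Delta>" "\<And>x. d x x = 0" and "\<Delta> \<ge> 0"
  shows "gamma2 T d \<le> ennreal (4 * sqrt 2 ^ N * \<Delta>)"
proof -
  define A where "A n = (if n < N then {T} else (\<lambda>x. {x}) ` T)" for n
  have part: "partition_on T (A n)" for n
    using T by (auto simp: A_def partition_on_space intro!: partition_onI)
  have adm: "admissible T A"
    unfolding admissible_def
  proof (intro conjI allI impI)
    show "partition_on T (A n)" for n by (rule part)
    show "refines T (A (Suc n)) (A n)" for n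
      unfolding refines_def using part by (auto simp: A_def)
    show "card (A 0) = 1" using N by (simp add: A_def)
    show "finite (A n)" for n using T by (simp add: A_def)
    show "card (A n) \<le> 2 ^ 2 ^ n" for n
    proof (cases "n < N")
      case False
      have "card (A n) \<le> card T" using False T by (simp add: A_def card_image_le)
      also have "\<dots> \<le> 2 ^ 2 ^ N" by (rule T)
      also have "\<dots> \<le> 2 ^ 2 ^ n" using False by (intro power_increasing) auto
      finally show ?thesis .
    qed (simp add: A_def)
  qed
  have "(\<Sum>n. ennreal (2 powr (real n / 2)) * ediam d (cell (A n) x)) \<le> ennreal (4 * sqrt 2 ^ N * \<Delta>)"
    if x: "x \<in> T" for x
  proof -
    have c: "cell (A n) x = (if n < N then T else {x})" for n
      using x by (intro cell_eqI[OF part]) (auto simp: A_def)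
    have "(\<Sum>n. ennreal (2 powr (real n / 2)) * ediam d (cell (A n) x))
        = (\<Sum>n<N. ennreal (2 powr (real n / 2)) * ediam d (cell (A n) x))"
      by (intro suminf_finite) (auto simp: c ediam_def d)
    also have "\<dots> \<le> (\<Sum>n<N. ennreal (sqrt 2 ^ n) * ennreal \<Delta>)"
      unfolding two_powr_half using d by (intro sum_mono mult_left_mono) (auto simp: c intro: ediam_le)
    also have "\<dots> = ennreal ((\<Sum>n<N. sqrt 2 ^ n) * \<Delta>)"
      using \<open>\<Delta> \<ge> 0\<close> by (simp add: ennreal_mult[symmetric] sum_ennreal sum_distrib_right)
    also have "\<dots> \<le> ennreal (4 * sqrt 2 ^ N * \<Delta>)"
    proof (intro ennreal_leI mult_right_mono)
      have "(\<Sum>n<N. sqrt 2 ^ n) \<le> (\<Sum>n\<le>N. sqrt 2 ^ n)" by (intro sum_mono2) auto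
      also have "\<dots> \<le> 4 * sqrt 2 ^ N" by (rule sum_sqrt2_powers)
      finally show "(\<Sum>n<N. sqrt 2 ^ n) \<le> 4 * sqrt 2 ^ N" .
    qed fact
    finally show ?thesis .
  qed
  then show ?thesis unfolding gamma2_def using adm
    by (intro INF_lower2[of A]) (auto intro: SUP_least)
qed

lemma gamma2_corners_upper:
  assumes r: "r \<ge> 2" and D: "D = 2 ^ (128 * r)"
    and d: "\<And>x y. x \<in> corners r D \<Longrightarrow> y \<in> corners r D \<Longrightarrow> d x y \<le> \<Delta>" "\<And>x. d x x = 0" and "\<Delta> \<ge> 0"
  shows "gamma2 (corners r D) d \<le> ennreal (64 * real r * \<Delta>)"
proof -
  \<comment> \<open>The corners number 2^(128 r^2), so level n + 1 can separate them, and 2^(n+1) is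
    at most 256 r^2 = (16 r)^2; the constant 64 is 4 times 16.\<close>
  obtain n where n: "2 ^ n \<le> 128 * r * r" "128 * r * r < 2 ^ (n + 1)"
    using ex_power_ivl1[of 2 "128 * r * r"] r by auto
  have "card (corners r D) = 2 ^ (128 * r * r)" by (simp add: card_corners D power_mult)
  also have "\<dots> \<le> 2 ^ 2 ^ (n + 1)" using n by (intro power_increasing) auto
  finally have card: "card (corners r D) \<le> 2 ^ 2 ^ (n + 1)" .
  have "corners r D \<noteq> {}" by (auto simp: corners_def PiE_eq_empty_iff D lessThan_empty_iff)
  then have "gamma2 (corners r D) d \<le> ennreal (4 * sqrt 2 ^ (n + 1) * \<Delta>)"
    using card d \<open>\<Delta> \<ge> 0\<close> by (intro gamma2_finite_le finite_corners) auto
  also have "\<dots> \<le> ennreal (64 * real r * \<Delta>)"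
  proof (intro ennreal_leI mult_right_mono \<open>\<Delta> \<ge> 0\<close>)
    have "real (2 ^ (n + 1)) \<le> real (2 * (128 * r * r))" using n by (intro of_nat_mono) simp
    then have "2 ^ (n + 1) \<le> (16 * real r)\<^sup>2" by (simp add: power2_eq_square)
    then have "sqrt (2 ^ (n + 1)) \<le> 16 * real r" by (rule real_le_lsqrt[rotated]) simp
    then show "4 * sqrt 2 ^ (n + 1) \<le> 64 * real r" unfolding real_sqrt_power by linarith
  qed
  finally show ?thesis .
qed

section \<open>Mixed norms and the theorem\<close>

lemma ereal_gt_2_cases:
  assumes "2 < (p :: ereal)"
  obtains "p = \<infinity>" | q where "p = ereal q" "q > 2" "real_of_ereal (1 / p) = 1 / q"
  using assms by (cases p) (auto simp: one_ereal_def)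

lemma lpl2_norm_finite:
  "lpl2_norm (ereal q) r D x = (\<Sum>i<r. L2_set (x i) {..<D} powr q) powr (1 / q)"
  by (simp add: lpl2_norm_def)

lemma lpl2_norm_infinity:
  "lpl2_norm \<infinity> r D x = Max ((\<lambda>i. L2_set (x i) {..<D}) ` {..<r})"
  by (simp add: lpl2_norm_def)

lemma L2_set_le_lpl2_norm:
  assumes "2 < p" "i < r"
  shows "L2_set (x i) {..<D} \<le> lpl2_norm p r D x"
  using assms(1)
proof (cases rule: ereal_gt_2_cases)
  case 1
  then show ?thesis using assms(2) by (auto simp: lpl2_norm_infinity intro!: Max_ge)
next
  case (2 q)
  have "L2_set (x i) {..<D} powr q \<le> (\<Sum>i<r. L2_set (x i) {..<D} powr q)"
    using assms(2) by (intro member_le_sum) auto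
  then have "(L2_set (x i) {..<D} powr q) powr (1 / q) \<le> (\<Sum>i<r. L2_set (x i) {..<D} powr q) powr (1 / q)"
    using 2 by (intro powr_mono2) auto
  then show ?thesis using 2 by (simp add: lpl2_norm_finite powr_powr L2_set_nonneg)
qed

lemma lpl2_norm_le:
  assumes "2 < p" "r \<ge> 1" "\<And>i. i < r \<Longrightarrow> L2_set (x i) {..<D} \<le> c" "c \<ge> 0"
  shows "lpl2_norm p r D x \<le> c * real r powr real_of_ereal (1 / p)"
  using assms(1)
proof (cases rule: ereal_gt_2_cases)
  case 1
  then show ?thesis using assms by (auto simp: lpl2_norm_infinity lessThan_empty_iff)
next
  case (2 q)
  have "(\<Sum>i<r. L2_set (x i) {..<D} powr q) \<le> (\<Sum>i<r. c powr q)"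
    using 2 assms by (intro sum_mono powr_mono2) (auto simp: L2_set_nonneg)
  then have "(\<Sum>i<r. L2_set (x i) {..<D} powr q) powr (1 / q) \<le> (real r * c powr q) powr (1 / q)"
    using 2 by (intro powr_mono2) (auto intro!: sum_nonneg)
  also have "\<dots> = c * real r powr (1 / q)"
    using 2 assms(4) by (simp add: powr_mult powr_powr)
  finally show ?thesis unfolding 2(3) unfolding 2(1) lpl2_norm_finite .
qed

lemma lpl2_norm_le_L2_set:
  assumes "2 < p" "r \<ge> 1"
  shows "lpl2_norm p r D x \<le> L2_set (\<lambda>i. L2_set (x i) {..<D}) {..<r}"
    (is "_ \<le> ?S")
proof -
  define s where "s i = L2_set (x i) {..<D}" for i
  have S: "?S \<ge> 0" "?S = L2_set s {..<r}" by (simp_all add: L2_set_nonneg s_def[abs_def])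
  have s0: "s i \<ge> 0" for i by (simp add: s_def L2_set_nonneg)
  have sS: "s i \<le> ?S" if "i < r" for i
    using that unfolding S(2) by (intro member_le_L2_set) auto
  show ?thesis
    using assms(1)
  proof (cases rule: ereal_gt_2_cases)
    case 1
    then show ?thesis using assms sS by (auto simp: lpl2_norm_infinity s_def lessThan_empty_iff)
  next
    case (2 q)
    have le: "s i powr q \<le> ?S powr (q - 2) * (s i)\<^sup>2" if "i < r" for i
    proof -
      have "s i powr q = s i powr (q - 2) * s i powr 2" by (simp flip: powr_add)
      also have "\<dots> \<le> ?S powr (q - 2) * s i powr 2"
        using 2 sS[OF that] s0 by (intro mult_right_mono powr_mono2) auto
      also have "s i powr 2 = (s i)\<^sup>2" using s0[of i] by (cases "s i = 0") auto
      finally show ?thesis .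
    qed
    have "(\<Sum>i<r. s i powr q) \<le> ?S powr (q - 2) * (\<Sum>i<r. (s i)\<^sup>2)"
      unfolding sum_distrib_left using le by (intro sum_mono) auto
    also have "(\<Sum>i<r. (s i)\<^sup>2) = (L2_set s {..<r})\<^sup>2" by (simp add: L2_set_def sum_nonneg)
    also have "\<dots> = ?S\<^sup>2" by (simp only: S(2))
    also have "?S powr (q - 2) * ?S\<^sup>2 = ?S powr q"
      using S(1) by (cases "?S = 0") (auto simp flip: powr_add powr_numeral)
    finally have "(\<Sum>i<r. s i powr q) powr (1 / q) \<le> (?S powr q) powr (1 / q)"
      using 2 by (intro powr_mono2) (auto intro!: sum_nonneg)
    then show ?thesis using 2 S(1) by (simp add: lpl2_norm_finite powr_powr s_def)
  qed
qed

text \<open>For finite p this is the power mean inequality, obtained from Young's inequality after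
  dividing the block norms by their power mean.\<close>

lemma L2_set_le_scaled_lpl2_norm:
  assumes "2 < p" "r \<ge> 1"
  shows "L2_set (\<lambda>i. L2_set (x i) {..<D}) {..<r} \<le> real r powr (1 / 2 - real_of_ereal (1 / p)) * lpl2_norm p r D x"
proof -
  define s where "s i = L2_set (x i) {..<D}" for i
  have s0: "s i \<ge> 0" for i by (simp add: s_def L2_set_nonneg)
  show ?thesis
    using assms(1)
  proof (cases rule: ereal_gt_2_cases)
    case 1
    have "s i \<le> lpl2_norm p r D x" if "i < r" for i
      using that unfolding s_def by (rule L2_set_le_lpl2_norm[OF assms(1)])
    then have "(\<Sum>i<r. (s i)\<^sup>2) \<le> (\<Sum>i<r. (lpl2_norm p r D x)\<^sup>2)"
      using s0 by (intro sum_mono power_mono) auto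
    then have "L2_set s {..<r} \<le> sqrt (real r * (lpl2_norm p r D x)\<^sup>2)"
      unfolding L2_set_def by (intro real_sqrt_le_mono) simp
    also have "0 \<le> lpl2_norm p r D x"
      by (rule order_trans[OF L2_set_nonneg L2_set_le_lpl2_norm[OF assms(1), of 0]]) (use assms(2) in simp)
    then have "sqrt (real r * (lpl2_norm p r D x)\<^sup>2) = real r powr (1 / 2) * lpl2_norm p r D x"
      by (simp add: real_sqrt_mult powr_half_sqrt)
    finally show ?thesis using 1 by (simp add: s_def[abs_def])
  next
    case (2 q)
    define Q where "Q = (\<Sum>i<r. s i powr q)"
    have Q0: "Q \<ge> 0" by (simp add: Q_def sum_nonneg)
    show ?thesis
    proof (cases "Q = 0")
      case True
      then have "s i = 0" if "i < r" for i
        using that unfolding Q_def by (subst (asm) sum_nonneg_eq_0_iff) auto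
      then have "L2_set s {..<r} = 0" by (intro L2_set_0') auto
      then show ?thesis using 2 True by (simp add: lpl2_norm_finite s_def[symmetric] Q_def)
    next
      case False
      define a where "a = (Q / r) powr (1 / q)"
      have a: "a > 0" "a powr q = Q / r" using False Q0 assms(2) 2 by (auto simp: a_def powr_powr)
      have young: "t\<^sup>2 \<le> (2 / q) * t powr q + (1 - 2 / q)" if "t \<ge> 0" for t
      proof -
        have "t\<^sup>2 * 1 \<le> (t\<^sup>2) powr (q / 2) / (q / 2) + 1 powr (1 / (1 - 2 / q)) / (1 / (1 - 2 / q))"
          using 2 that by (intro Youngs_inequality) (auto simp: field_simps)
        moreover have "(t\<^sup>2) powr (q / 2) = t powr q"
          using that by (cases "t = 0") (auto simp: powr_powr simp flip: powr_numeral)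
        ultimately show ?thesis using 2 by (simp add: mult.commute)
      qed
      have "(\<Sum>i<r. (s i / a)\<^sup>2) \<le> (\<Sum>i<r. (2 / q) * (s i / a) powr q + (1 - 2 / q))"
        using s0 a by (intro sum_mono young) auto
      also have "\<dots> = (2 / q) * (Q / a powr q) + r * (1 - 2 / q)"
      proof -
        have "(\<Sum>i<r. (s i / a) powr q) = Q / a powr q"
          using s0 a(1) by (simp add: powr_divide sum_divide_distrib Q_def)
        then show ?thesis by (simp only: sum.distrib sum_distrib_left[symmetric]) simp
      qed
      also have "\<dots> = r" unfolding a(2) using False assms(2) 2 by (simp add: field_simps)
      finally have "(\<Sum>i<r. (s i)\<^sup>2) / a\<^sup>2 \<le> r" by (simp add: power_divide sum_divide_distrib)
      then have "(\<Sum>i<r. (s i)\<^sup>2) \<le> r * a\<^sup>2" using a by (simp add: field_simps)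
      then have "L2_set s {..<r} \<le> sqrt (r * a\<^sup>2)" unfolding L2_set_def by (rule real_sqrt_le_mono)
      also have "\<dots> = r powr (1 / 2) * a" using a by (simp add: real_sqrt_mult powr_half_sqrt)
      also have "\<dots> = r powr (1 / 2 - 1 / q) * Q powr (1 / q)"
        using assms(2) Q0 by (simp add: a_def powr_divide powr_diff)
      finally show ?thesis using 2 by (simp add: lpl2_norm_finite s_def[symmetric] Q_def)
    qed
  qed
qed

lemma inverse_ennreal_antimono: "a \<le> b \<Longrightarrow> inverse b \<le> inverse a" for a b :: ennreal
  including ennreal.lifting by transfer (auto intro: ereal_inverse_antimono)

lemma gamma2_mono:
  assumes "\<And>x y. x \<in> K \<Longrightarrow> y \<in> K \<Longrightarrow> d x y \<le> c * d' x y" "c > 0"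
  shows "gamma2 K d \<le> ennreal c * gamma2 K d'"
proof -
  let ?V = "\<lambda>d A. (SUP x\<in>K. \<Sum>n. ennreal (2 powr (real n / 2)) * ediam d (cell (A n) x))"
  have le: "?V d A \<le> ennreal c * ?V d' A" if A: "admissible K A" for A
  proof (rule SUP_least)
    fix x assume x: "x \<in> K"
    have "ediam d (cell (A n) x) \<le> ennreal c * ediam d' (cell (A n) x)" for n
      unfolding ediam_def
    proof (intro SUP_least)
      fix y z assume yz: "y \<in> cell (A n) x" "z \<in> cell (A n) x"
      have part: "partition_on K (A n)" using A by (simp add: admissible_def)
      then have "cell (A n) x \<subseteq> K" using partition_on_cell[OF part x] by (auto dest: partition_onD1)
      then have "ennreal (d y z) \<le> ennreal (c * d' y z)" using assms yz by (intro ennreal_leI) auto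
      also have "\<dots> = ennreal c * ennreal (d' y z)" using assms(2) by (simp add: ennreal_mult')
      also have "\<dots> \<le> ennreal c * ediam d' (cell (A n) x)" using yz by (intro mult_left_mono le_ediam) auto
      finally show "ennreal (d y z) \<le> ennreal c * (SUP u\<in>cell (A n) x. SUP v\<in>cell (A n) x. ennreal (d' u v))"
        by (simp add: ediam_def)
    qed
    then have "ennreal (2 powr (real n / 2)) * ediam d (cell (A n) x)
        \<le> ennreal c * (ennreal (2 powr (real n / 2)) * ediam d' (cell (A n) x))" for n
      by (subst mult.left_commute) (intro mult_left_mono, auto)
    then have "(\<Sum>n. ennreal (2 powr (real n / 2)) * ediam d (cell (A n) x))
        \<le> (\<Sum>n. ennreal c * (ennreal (2 powr (real n / 2)) * ediam d' (cell (A n) x)))"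
      by (intro suminf_le) (auto intro: summableI)
    also have "\<dots> = ennreal c * (\<Sum>n. ennreal (2 powr (real n / 2)) * ediam d' (cell (A n) x))" by simp
    also have "\<dots> \<le> ennreal c * ?V d' A" using x by (intro mult_left_mono SUP_upper) auto
    finally show "(\<Sum>n. ennreal (2 powr (real n / 2)) * ediam d (cell (A n) x)) \<le> ennreal c * ?V d' A" .
  qed
  have c: "ennreal c > 0" "ennreal c \<noteq> top" using assms(2) by auto
  have "gamma2 K d / ennreal c \<le> ?V d' A" if A: "admissible K A" for A
  proof (rule divide_le_posI_ennreal[OF c(1)])
    have "gamma2 K d \<le> ?V d A" unfolding gamma2_def using A by (intro INF_lower) auto
    also have "\<dots> \<le> ennreal c * ?V d' A" by (rule le[OF A])
    finally show "gamma2 K d \<le> ennreal c * ?V d' A" .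
  qed
  then have "gamma2 K d / ennreal c \<le> gamma2 K d'" unfolding gamma2_def[of K d'] by (intro INF_greatest) auto
  then have "gamma2 K d / ennreal c * ennreal c \<le> gamma2 K d' * ennreal c" by (rule mult_right_mono) simp
  moreover have "gamma2 K d / ennreal c * ennreal c = gamma2 K d"
    using c by (simp add: ennreal_times_divide mult.commute[of _ "ennreal c"])
      (simp add: mult.commute[of "ennreal c"] ennreal_mult_divide_eq)
  ultimately show ?thesis by (simp add: mult.commute)
qed

section \<open>Upper and lower bound for the profile\<close>

lemma convexification_profile_upper:
  assumes p: "2 < p" and r: "r \<ge> 1"
  shows "convexification_profile (lpl2_space r D) (lpl2_norm p r D)
    \<le> ennreal (15364 * real r powr (1 / 2 - real_of_ereal (1 / p)))"
  unfolding convexification_profile_def convexification_profile_at_def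
proof (intro SUP_least)
  fix N T assume "T \<in> {T. T \<subseteq> lpl2_space r D \<and> finite T \<and> 2 \<le> card T \<and> card T \<le> N}"
  then have T: "finite T" "T \<noteq> {}" by auto
  \<comment> \<open>All index pairs serve as coordinates, so \<open>ds\<close> is the Euclidean
    distance; passing to it and back costs the factors 1 and r^(1/2 - 1/p).\<close>
  define es where "es = List.product [0..<r] [0..<D]"
  define crd where "crd e x = x (fst e) (snd e)" for e and x :: "nat \<Rightarrow> nat \<Rightarrow> real"
  interpret coords es crd
    by standard (auto simp: es_def distinct_product crd_def scaleR_fun_def intro!: linearI)
  have ds: "ds x y = L2_set (\<lambda>i. L2_set ((x - y) i) {..<D}) {..<r}" for x y
  proof -
    have "set es = {..<r} \<times> {..<D}" by (auto simp: es_def)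
    then show ?thesis
      by (simp add: ds_def crd_def L2_set_def sum_nonneg sum.cartesian_product case_prod_beta)
  qed
  let ?c = "real r powr (1 / 2 - real_of_ereal (1 / p))"
  let ?d = "\<lambda>x y. lpl2_norm p r D (x - y)"
  have "gamma2 (convex hull T) ?d \<le> ennreal 1 * gamma2 (convex hull T) ds"
  proof (rule gamma2_mono)
    show "?d x y \<le> 1 * ds x y" for x y
      using lpl2_norm_le_L2_set[OF p r, of D "x - y"] by (simp only: ds mult_1)
  qed simp
  also have "\<dots> \<le> ennreal 15364 * gamma2 T ds" using gamma2_convex_hull[OF T] by simp
  also have "\<dots> \<le> ennreal 15364 * (ennreal ?c * gamma2 T ?d)"
  proof (intro mult_left_mono gamma2_mono)
    show "ds x y \<le> ?c * ?d x y" for x y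
      unfolding ds by (rule L2_set_le_scaled_lpl2_norm[OF p r])
  qed (use r in auto)
  also have "\<dots> = gamma2 T ?d * ennreal (15364 * ?c)" by (simp add: ennreal_mult mult_ac)
  finally have le: "gamma2 (convex hull T) ?d \<le> gamma2 T ?d * ennreal (15364 * ?c)" .
  show "gamma2_norm (lpl2_norm p r D) (convex hull T) / gamma2_norm (lpl2_norm p r D) T \<le> ennreal (15364 * ?c)"
  \<comment> \<open>For the value 0, \<open>le\<close> forces the numerator to be 0 as well, and
    \<open>0 / 0 = 0\<close> in \<open>ennreal\<close>.\<close>
  proof (cases "gamma2 T ?d = 0")
    case True
    with le show ?thesis by (simp add: gamma2_norm_def)
  next
    case False
    then show ?thesis unfolding gamma2_norm_def
      by (intro divide_le_posI_ennreal le) (simp add: zero_less_iff_neq_zero)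
  qed
qed

lemma convexification_profile_lower:
  assumes p: "2 < p" and r: "r \<ge> 2" and D: "D = 2 ^ (128 * r)"
  shows "ennreal (1 / 64 * real r powr (1 / 2 - real_of_ereal (1 / p)))
    \<le> convexification_profile (lpl2_space r D) (lpl2_norm p r D)"
proof -
  define s where "s = real_of_ereal (1 / p)"
  let ?T = "corners r D" and ?d = "\<lambda>x y. lpl2_norm p r D (x - y)"
  have sub: "(x - y) i = (\<lambda>j. x i j - y i j)" for x y :: "nat \<Rightarrow> nat \<Rightarrow> real" and i
    by (simp add: fun_eq_iff)
  have num: "ennreal (2 * real r * sqrt r) \<le> gamma2 (convex hull ?T) ?d"
  proof (rule gamma2_hull_corners_lower[OF r D])
    show "L2_set (\<lambda>j. x i j - y i j) {..<D} \<le> ?d x y" if "i < r" for x y i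
      using L2_set_le_lpl2_norm[OF p that, of "x - y" D] by (simp only: sub)
  qed
  have den: "gamma2 ?T ?d \<le> ennreal (64 * real r * (2 * real r powr s))"
  proof (rule gamma2_corners_upper[OF r D])
    fix x y assume "x \<in> ?T" "y \<in> ?T"
    then obtain g h where xy: "x = corner r g" "y = corner r h" by (auto simp: corners_def)
    have "L2_set ((x - y) i) {..<D} \<le> 2" for i unfolding sub xy by (rule L2_set_corner_diff)
    then show "?d x y \<le> 2 * real r powr s"
      unfolding s_def using r by (intro lpl2_norm_le[OF p]) simp_all
  next
    show "lpl2_norm p r D (x - x) = 0" for x :: "nat \<Rightarrow> nat \<Rightarrow> real"
    proof -
      have "L2_set ((x - x) i) {..<D} = 0" for i by (intro L2_set_0') simp
      then have "lpl2_norm p r D (x - x) \<le> 0 * real r powr real_of_ereal (1 / p)"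
        using r by (intro lpl2_norm_le[OF p]) auto
      moreover have "0 \<le> lpl2_norm p r D (x - x)"
        by (rule order_trans[OF L2_set_nonneg L2_set_le_lpl2_norm[OF p, of 0]]) (use r in simp)
      ultimately show ?thesis by simp
    qed
  qed simp
  have card: "2 \<le> card ?T"
  proof -
    have "(2::nat) ^ 1 \<le> 2 ^ (128 * r * r)" using r by (intro power_increasing) auto
    then show ?thesis by (simp add: card_corners D power_mult)
  qed
  \<comment> \<open>Order r^(3/2) against r^(1 + 1/p); the constant is 2 / (64 * 2).\<close>
  have "1 / 64 * real r powr (1 / 2 - s) = 2 * real r * sqrt r / (64 * real r * (2 * real r powr s))"
    using r by (simp add: powr_diff powr_half_sqrt)
  then have "ennreal (1 / 64 * real r powr (1 / 2 - s))
      = ennreal (2 * real r * sqrt r) / ennreal (64 * real r * (2 * real r powr s))"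
    using r by (simp add: divide_ennreal)
  also have "\<dots> \<le> gamma2 (convex hull ?T) ?d / gamma2 ?T ?d"
    unfolding divide_ennreal_def by (intro mult_mono num inverse_ennreal_antimono den) auto
  also have "\<dots> = gamma2_norm (lpl2_norm p r D) (convex hull ?T) / gamma2_norm (lpl2_norm p r D) ?T"
    by (simp add: gamma2_norm_def)
  also have "\<dots> \<le> convexification_profile_at (lpl2_space r D) (lpl2_norm p r D) (card ?T)"
    unfolding convexification_profile_at_def
    using card corners_subset finite_corners by (intro SUP_upper) auto
  also have "\<dots> \<le> convexification_profile (lpl2_space r D) (lpl2_norm p r D)"
    unfolding convexification_profile_def using card by (intro SUP_upper) auto
  finally show ?thesis by (simp add: s_def)
qed

theorem mainTheorem4:
  shows "\<exists>c C :: real. 0 < c \<and> 0 < C \<and>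
    (\<forall>(p::ereal) (r::nat) (D::nat). 2 < p \<longrightarrow> 2 \<le> r \<longrightarrow> D = 2 ^ (128 * r) \<longrightarrow>
      ennreal (c * real r powr (1 / 2 - real_of_ereal (1 / p)))
        \<le> convexification_profile (lpl2_space r D) (lpl2_norm p r D) \<and>
      convexification_profile (lpl2_space r D) (lpl2_norm p r D)
        \<le> ennreal (C * real r powr (1 / 2 - real_of_ereal (1 / p))))"
proof (intro exI conjI allI impI)
  show "(0::real) < 1 / 64" "(0::real) < 15364" by simp_all
next
  fix p :: ereal and r D :: nat
  assume A: "2 < p" "2 \<le> r" "D = 2 ^ (128 * r)"
  from A show "ennreal (1 / 64 * real r powr (1 / 2 - real_of_ereal (1 / p)))
      \<le> convexification_profile (lpl2_space r D) (lpl2_norm p r D)"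
    by (rule convexification_profile_lower)
  from A show "convexification_profile (lpl2_space r D) (lpl2_norm p r D)
      \<le> ennreal (15364 * real r powr (1 / 2 - real_of_ereal (1 / p)))"
    by (intro convexification_profile_upper) auto
qed

end
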